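(* Let $\mathcal{O}=\{t_1,\dots,t_\mu\}$ be an order ideal in $\mathbb{T}^n$, and let $\Delta=\#\{i\in\{1,\dots,\mu\}\mid\deg(t_i)=\deg(t_\mu)\}$. Let $I(\mathbb{B}^{\mathrm{df}}_{\mathcal{O}})=I(\mathbb{B}_{\mathcal{O}})+I^{\mathrm{df}}_{\mathcal{O}}$. For $i=1,\dots,\mu$ let $M_{t_i}=t_i(\mathcal{A}^{\mathrm{df}}_1,\dots,\mathcal{A}^{\mathrm{df}}_n)$, where $\mathcal{A}^{\mathrm{df}}_1,\dots,\mathcal{A}^{\mathrm{df}}_n$ are the generic degree filtered multiplication matrices. For $j=1,\dots,\Delta$ let $V_j\in\mathrm{Mat}_\mu(K[C])$ be the matrix whose $i$-th column is the $(\mu-\Delta+j)$-th column of $M_{t_i}^{\mathrm{tr}}$ for $i=1,\dots,\mu$. Let $W=\mathrm{Col}(V_1,\dots,V_\Delta)$ be the block column matrix (of size $\Delta\mu\times\mu$), and let $J_{\mathcal{O}}$ be the ideal of $K[C]$ generated by the maximal minors of $W$. Then the ideal $I(\mathbb{B}^{\mathrm{df}}_{\mathcal{O}})+J_{\mathcal{O}}$ defines a closed subscheme $\mathrm{NonCB}^{\mathrm{df}}_{\mathcal{O}}$ of $\mathbb{B}^{\mathrm{df}}_{\mathcal{O}}$ whose $K$-rational points represent exactly those 0-dimensional subschemes of $\mathbb{A}^n_K$ which have a degree filtered $\mathcal{O}$-border basis, but are not Cayley-Bacharach schemes.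
   Context: $K$ is an arbitrary field, $P=K[x_1,\dots,x_n]$, and $\mathbb{T}^n$ is the monoid of terms (power products) in $x_1,\dots,x_n$. An order ideal is a finite set $\mathcal{O}=\{t_1,\dots,t_\mu\}\subset\mathbb{T}^n$ with $\mu\ge 1$ containing every divisor in $\mathbb{T}^n$ of each of its elements; it is always ordered so that $\deg(t_1)\le\cdots\le\deg(t_\mu)$, hence $t_1=1$. Its border is $\partial\mathcal{O}=(x_1\mathcal{O}\cup\cdots\cup x_n\mathcal{O})\setminus\mathcal{O}=\{b_1,\dots,b_\nu\}$. Let $C=\{c_{ij}\mid 1\le i\le\mu,\ 1\le j\le\nu\}$ be new indeterminates. The $r$-th generic multiplication matrix $\mathcal{A}_r=(a^{(r)}_{ij})\in\mathrm{Mat}_\mu(K[C])$ has $a^{(r)}_{ij}=\delta_{im}$ if $x_rt_j=t_m$ and $a^{(r)}_{ij}=c_{im}$ if $x_rt_j=b_m$. $I(\mathbb{B}_{\mathcal{O}})\subseteq K[C]$ is generated by the entries of all commutators $\mathcal{A}_r\mathcal{A}_s-\mathcal{A}_s\mathcal{A}_r$, and the border basis scheme $\mathbb{B}_{\mathcal{O}}\subseteq\mathrm{Spec}(K[C])$ is the closed subscheme it defines. For a $K$-rational point $\Gamma=(\gamma_{ij})$ of $\mathbb{B}_{\mathcal{O}}$, let $I_\Gamma\subset P$ be generated by $b_j-\sum_i\gamma_{ij}t_i$; $\Gamma$ represents the 0-dimensional scheme $\mathbb{X}_\Gamma\subset\mathbb{A}^n_K$ with vanishing ideal $I_\Gamma$.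 $I^{\mathrm{df}}_{\mathcal{O}}\subseteq K[C]$ is generated by all $c_{ij}$ with $\deg(t_i)>\deg(b_j)$; $\mathbb{B}^{\mathrm{df}}_{\mathcal{O}}$ is the closed subscheme of $\mathbb{B}_{\mathcal{O}}$ defined by $I(\mathbb{B}_{\mathcal{O}})+I^{\mathrm{df}}_{\mathcal{O}}$; $\mathcal{A}^{\mathrm{df}}_r$ is obtained from $\mathcal{A}_r$ by setting all these $c_{ij}$ to zero. For a term $t=x_1^{\alpha_1}\cdots x_n^{\alpha_n}$, $t(M_1,\dots,M_n)=M_1^{\alpha_1}\cdots M_n^{\alpha_n}$. For a 0-dimensional subscheme $\mathbb{X}\subset\mathbb{A}^n_K$ with vanishing ideal $I_{\mathbb{X}}$ put $R_{\mathbb{X}}=P/I_{\mathbb{X}}$, let $F_iR_{\mathbb{X}}$ be the image of the polynomials of degree $\le i$ (including $0$), let $\mathrm{ord}_{\mathcal{F}}(f)=\min\{i\mid f\in F_iR_{\mathbb{X}}\}$ for $f\neq 0$, and let $\mathrm{ri}(R_{\mathbb{X}})=\min\{i\in\mathbb{Z}\mid F_jR_{\mathbb{X}}=R_{\mathbb{X}}\text{ for all }j\ge i\}$. $\mathbb{X}$ has a degree filtered $\mathcal{O}$-border basis if $\mathcal{O}$ is a degree filtered $K$-basis of $R_{\mathbb{X}}$, i.e. for every $i\ge 0$ the residue classes of the elements of $\mathcal{O}$ of degree $\le i$ form a $K$-basis of $F_iR_{\mathbb{X}}$. Cayley-Bacharach schemes: let $I_{\mathbb{X}}=\mathfrak{Q}_1\cap\cdots\cap\mathfrak{Q}_s$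 be the primary decomposition with $\mathfrak{Q}_i$ being $\mathfrak{M}_i$-primary, $\mathfrak{M}_i$ maximal, and let $\mathfrak{m}_i$ be the image of $\mathfrak{M}_i$ in $R_{\mathbb{X}}$. A minimal $\mathfrak{Q}_i$-divisor of $I_{\mathbb{X}}$ is an ideal $J=\mathfrak{Q}_1\cap\cdots\cap\mathfrak{Q}'_i\cap\cdots\cap\mathfrak{Q}_s$ with $\mathfrak{Q}_i\subset\mathfrak{Q}'_i\subseteq\mathfrak{M}_i$ (for $\mathfrak{Q}_i=\mathfrak{M}_i$ one takes $\mathfrak{Q}'_i=P$) and $\dim_K(\mathfrak{Q}'_i/\mathfrak{Q}_i)=\dim_K(P/\mathfrak{M}_i)$. Put $\mathrm{ri}(J/I_{\mathbb{X}})=\max\{\mathrm{ord}_{\mathcal{F}}(f)\mid f\in J/I_{\mathbb{X}}\setminus\{0\}\}$, and let $\mathrm{sepdeg}(\mathfrak{m}_i)$ be the minimum of $\mathrm{ri}(J/I_{\mathbb{X}})$ over all minimal $\mathfrak{Q}_i$-divisors $J$. $\mathbb{X}$ is a Cayley-Bacharach scheme if $\mathrm{sepdeg}(\mathfrak{m}_i)=\mathrm{ri}(R_{\mathbb{X}})$ for $i=1,\dots,s$. Conventions: statements about $K$-rational points may be read for $L$-rational points for any field extension $L\supseteq K$; an ideal is said to define a subscheme up to radical. *)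

theory Defs
  imports
    "HOL-Library.Poly_Mapping"
    "HOL-Algebra.QuotRing"
    "HOL-Algebra.Embedded_Algebras"
    "Jordan_Normal_Form.Determinant"
    "Jordan_Normal_Form.DL_Submatrix"
begin

section \<open>Polynomial rings\<close>

text \<open>A term with indeterminates from \<open>'v\<close> is an exponent vector; terms are multiplied by adding
  exponent vectors, and the term 1 is \<open>0\<close>. The ring \<open>K[x\<^sub>v | v \<in> X]\<close> is
  cut out of the monoid algebra by restricting the indeterminates that may occur to \<open>X\<close>.\<close>

type_synonym 'v trm = "'v \<Rightarrow>\<^sub>0 nat"

type_synonym ('v, 'k) mpoly = "('v \<Rightarrow>\<^sub>0 nat) \<Rightarrow>\<^sub>0 'k"

definition terms :: "'v set \<Rightarrow> 'v trm set" where
  "terms X = {t. Poly_Mapping.keys t \<subseteq> X}"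

definition term_deg :: "'v trm \<Rightarrow> nat" where
  "term_deg t = (\<Sum>v\<in>Poly_Mapping.keys t. Poly_Mapping.lookup t v)"

definition poly_ring :: "'v set \<Rightarrow> (('v, 'k::field) mpoly) ring" where
  "poly_ring X = \<lparr>carrier = {p. Poly_Mapping.keys p \<subseteq> terms X},
     monoid.mult = (*), one = 1, zero = 0, add = (+)\<rparr>"

definition const_poly :: "'k::zero \<Rightarrow> ('v, 'k) mpoly" where
  "const_poly c = Poly_Mapping.single 0 c"

definition poly_eval ::
    "('k::zero \<Rightarrow> 'a) \<Rightarrow> ('v \<Rightarrow> 'a) \<Rightarrow> ('v, 'k) mpoly \<Rightarrow> 'a::comm_semiring_1" where
  "poly_eval \<phi> g p = (\<Sum>t\<in>Poly_Mapping.keys p.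
     \<phi> (Poly_Mapping.lookup p t) * (\<Prod>v\<in>Poly_Mapping.keys t. g v ^ Poly_Mapping.lookup t v))"

text \<open>\<open>P = K[x\<^sub>0, \<dots>, x\<^sub>n\<^sub>-\<^sub>1]\<close>; all indices are zero-based.\<close>

abbreviation P_ring :: "nat \<Rightarrow> ((nat, 'k::field) mpoly) ring" where
  "P_ring n \<equiv> poly_ring {..<n}"


section \<open>Order ideals and borders\<close>

abbreviation x_term :: "nat \<Rightarrow> nat trm" where
  "x_term r \<equiv> Poly_Mapping.single r 1"

definition order_ideal :: "nat \<Rightarrow> nat trm list \<Rightarrow> bool" where
  "order_ideal n ts \<longleftrightarrow>
     ts \<noteq> [] \<and> distinct ts \<and> set ts \<subseteq> terms {..<n} \<and>
     (\<forall>t\<in>set ts. \<forall>s u. t = s + u \<longrightarrow> s \<in> set ts) \<and>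
     sorted (map term_deg ts)"

definition border :: "nat \<Rightarrow> nat trm set \<Rightarrow> nat trm set" where
  "border n T = {x_term r + t | r t. r < n \<and> t \<in> T} - T"

definition enumerates_border :: "nat \<Rightarrow> nat trm list \<Rightarrow> nat trm list \<Rightarrow> bool" where
  "enumerates_border n ts bs \<longleftrightarrow> distinct bs \<and> set bs = border n (set ts)"


section \<open>The border basis scheme and its degree filtered subscheme\<close>

text \<open>A closed subscheme of the affine space \<open>Spec K[C]\<close> is given by an ideal of \<open>K[C]\<close>, where the
  indeterminate \<open>c\<^sub>i\<^sub>j\<close> is indexed by the pair \<open>(i, j)\<close>.\<close>

abbreviation C_ring ::
    "nat trm list \<Rightarrow> nat trm list \<Rightarrow> ((nat \<times> nat, 'k::field) mpoly) ring" where
  "C_ring ts bs \<equiv> poly_ring ({..<length ts} \<times> {..<length bs})"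

definition c_var :: "nat \<Rightarrow> nat \<Rightarrow> (nat \<times> nat, 'k::field) mpoly" where
  "c_var i j = Poly_Mapping.single (Poly_Mapping.single (i, j) 1) 1"

definition mult_mat ::
    "nat trm list \<Rightarrow> nat trm list \<Rightarrow> nat \<Rightarrow> (nat \<times> nat, 'k::field) mpoly mat" where
  "mult_mat ts bs r = mat (length ts) (length ts) (\<lambda>(i, j).
     let t = x_term r + ts ! j in
     if t \<in> set ts then (if ts ! i = t then 1 else 0)
     else c_var i (THE m. m < length bs \<and> bs ! m = t))"

definition border_scheme_ideal ::
    "nat \<Rightarrow> nat trm list \<Rightarrow> nat trm list \<Rightarrow> (nat \<times> nat, 'k::field) mpoly set" where
  "border_scheme_ideal n ts bs = Idl\<^bsub>C_ring ts bs\<^esub>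
     {(mult_mat ts bs r * mult_mat ts bs s - mult_mat ts bs s * mult_mat ts bs r) $$ (i, j)
       | r s i j. r < n \<and> s < n \<and> i < length ts \<and> j < length ts}"

definition df_ideal ::
    "nat trm list \<Rightarrow> nat trm list \<Rightarrow> (nat \<times> nat, 'k::field) mpoly set" where
  "df_ideal ts bs = Idl\<^bsub>C_ring ts bs\<^esub>
     {c_var i j | i j. i < length ts \<and> j < length bs \<and> term_deg (ts ! i) > term_deg (bs ! j)}"

definition df_scheme_ideal ::
    "nat \<Rightarrow> nat trm list \<Rightarrow> nat trm list \<Rightarrow> (nat \<times> nat, 'k::field) mpoly set" where
  "df_scheme_ideal n ts bs = border_scheme_ideal n ts bs <+>\<^bsub>C_ring ts bs\<^esub> df_ideal ts bs"

definition df_mult_mat ::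
    "nat trm list \<Rightarrow> nat trm list \<Rightarrow> nat \<Rightarrow> (nat \<times> nat, 'k::field) mpoly mat" where
  "df_mult_mat ts bs r = map_mat
     (poly_eval const_poly
       (\<lambda>(i, j). if term_deg (ts ! i) > term_deg (bs ! j) then 0 else c_var i j))
     (mult_mat ts bs r)"


section \<open>The ideal of the non-Cayley-Bacharach locus\<close>

definition term_at_mats ::
    "nat \<Rightarrow> nat \<Rightarrow> (nat \<Rightarrow> 'a::comm_ring_1 mat) \<Rightarrow> nat trm \<Rightarrow> 'a mat" where
  "term_at_mats n d M t =
     foldr (\<lambda>r N. (M r ^\<^sub>m Poly_Mapping.lookup t r) * N) [0..<n] (1\<^sub>m d)"

definition top_count :: "nat trm list \<Rightarrow> nat" where
  "top_count ts = card {i. i < length ts \<and> term_deg (ts ! i) = term_deg (last ts)}"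

definition V_mat ::
    "nat \<Rightarrow> nat trm list \<Rightarrow> nat trm list \<Rightarrow> nat \<Rightarrow> (nat \<times> nat, 'k::field) mpoly mat" where
  "V_mat n ts bs j = mat_of_cols (length ts)
     (map (\<lambda>t. col (transpose_mat (term_at_mats n (length ts) (df_mult_mat ts bs) t))
                   (length ts - top_count ts + j)) ts)"

definition W_mat ::
    "nat \<Rightarrow> nat trm list \<Rightarrow> nat trm list \<Rightarrow> (nat \<times> nat, 'k::field) mpoly mat" where
  "W_mat n ts bs = mat_of_rows (length ts)
     (concat (map (\<lambda>j. rows (V_mat n ts bs j)) [0..<top_count ts]))"

text \<open>Since \<open>top_count ts \<ge> 1\<close>, the maximal minors of the matrix \<open>W\<close>, which has
  \<open>top_count ts * length ts\<close> rows and \<open>length ts\<close> columns, have order \<open>length ts\<close>.\<close>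

definition minors_ideal ::
    "nat \<Rightarrow> nat trm list \<Rightarrow> nat trm list \<Rightarrow> (nat \<times> nat, 'k::field) mpoly set" where
  "minors_ideal n ts bs = Idl\<^bsub>C_ring ts bs\<^esub>
     {det (submatrix (W_mat n ts bs) I {..<length ts})
       | I. I \<subseteq> {..<top_count ts * length ts} \<and> card I = length ts}"

definition noncb_ideal ::
    "nat \<Rightarrow> nat trm list \<Rightarrow> nat trm list \<Rightarrow> (nat \<times> nat, 'k::field) mpoly set" where
  "noncb_ideal n ts bs = df_scheme_ideal n ts bs <+>\<^bsub>C_ring ts bs\<^esub> minors_ideal n ts bs"


section \<open>Rational points and the ideals they represent\<close>

text \<open>For a field embedding \<open>\<phi>: K \<rightarrow> L\<close>, these are the \<open>L\<close>-rational points of the closed subscheme of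
  \<open>Spec K[C]\<close> defined by \<open>I\<close>; the \<open>K\<close>-rational points arise for \<open>\<phi> = id\<close>.\<close>

definition rational_points ::
    "('k::field \<Rightarrow> 'l::field) \<Rightarrow> nat \<Rightarrow> nat \<Rightarrow> (nat \<times> nat, 'k) mpoly set \<Rightarrow> 'l mat set" where
  "rational_points \<phi> \<mu> \<nu> I =
     {\<Gamma> \<in> carrier_mat \<mu> \<nu>. \<forall>p\<in>I. poly_eval \<phi> (\<lambda>(i, j). \<Gamma> $$ (i, j)) p = 0}"

definition point_ideal ::
    "nat \<Rightarrow> nat trm list \<Rightarrow> nat trm list \<Rightarrow> 'k::field mat \<Rightarrow> (nat, 'k) mpoly set" where
  "point_ideal n ts bs \<Gamma> = Idl\<^bsub>P_ring n\<^esub>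
     {Poly_Mapping.single (bs ! j) 1 - (\<Sum>i<length ts. Poly_Mapping.single (ts ! i) (\<Gamma> $$ (i, j)))
       | j. j < length bs}"


section \<open>Degree filtration\<close>

text \<open>Closed subschemes of affine \<open>n\<close>-space are given by their vanishing ideals \<open>I\<close> in \<open>P\<close>, with
  coordinate ring \<open>P Quot I\<close>. The field is identified with its image \<open>scalars n I\<close> in \<open>P Quot I\<close>,
  so that bases and dimensions over it are those of embedded algebras.\<close>

definition zero_dim_ideal :: "nat \<Rightarrow> (nat, 'k::field) mpoly set \<Rightarrow> bool" where
  "zero_dim_ideal n I \<longleftrightarrow>
     ideal I (P_ring n) \<and> I \<noteq> carrier (P_ring n) \<and>
     (\<forall>p. primeideal p (P_ring n) \<and> I \<subseteq> p \<longrightarrow> maximalideal p (P_ring n))"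

definition residue_classes ::
    "nat \<Rightarrow> (nat, 'k::field) mpoly set \<Rightarrow> (nat, 'k) mpoly set \<Rightarrow> (nat, 'k) mpoly set set" where
  "residue_classes n I S = (\<lambda>p. I +>\<^bsub>P_ring n\<^esub> p) ` S"

definition scalars :: "nat \<Rightarrow> (nat, 'k::field) mpoly set \<Rightarrow> (nat, 'k) mpoly set set" where
  "scalars n I = residue_classes n I (range const_poly)"

definition deg_filtration ::
    "nat \<Rightarrow> (nat, 'k::field) mpoly set \<Rightarrow> int \<Rightarrow> (nat, 'k) mpoly set set" where
  "deg_filtration n I i = residue_classes n I
     {p \<in> carrier (P_ring n). \<forall>t\<in>Poly_Mapping.keys p. int (term_deg t) \<le> i}"

definition filt_ord :: "nat \<Rightarrow> (nat, 'k::field) mpoly set \<Rightarrow> (nat, 'k) mpoly set \<Rightarrow> int" where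
  "filt_ord n I f = (LEAST i. f \<in> deg_filtration n I i)"

definition reg_index :: "nat \<Rightarrow> (nat, 'k::field) mpoly set \<Rightarrow> int" where
  "reg_index n I = (LEAST i. \<forall>j\<ge>i. deg_filtration n I j = carrier (P_ring n Quot I))"

definition has_df_border_basis ::
    "nat \<Rightarrow> nat trm list \<Rightarrow> (nat, 'k::field) mpoly set \<Rightarrow> bool" where
  "has_df_border_basis n ts I \<longleftrightarrow>
     (\<forall>i::nat. let Us = map (\<lambda>t. I +>\<^bsub>P_ring n\<^esub> Poly_Mapping.single t 1)
                            (filter (\<lambda>t. term_deg t \<le> i) ts)
       in ring.independent (P_ring n Quot I) (scalars n I) Us \<and>
          ring.Span (P_ring n Quot I) (scalars n I) Us = deg_filtration n I (int i))"


section \<open>Cayley-Bacharach schemes\<close>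

definition radical_of :: "('a, 'b) ring_scheme \<Rightarrow> 'a set \<Rightarrow> 'a set" where
  "radical_of R I = {a \<in> carrier R. \<exists>k::nat. a [^]\<^bsub>R\<^esub> k \<in> I}"

definition primary_ideal :: "('a, 'b) ring_scheme \<Rightarrow> 'a set \<Rightarrow> bool" where
  "primary_ideal R Q \<longleftrightarrow>
     ideal Q R \<and> Q \<noteq> carrier R \<and>
     (\<forall>a\<in>carrier R. \<forall>b\<in>carrier R. a \<otimes>\<^bsub>R\<^esub> b \<in> Q \<longrightarrow> a \<in> Q \<or> b \<in> radical_of R Q)"

text \<open>\<open>QS\<close> is the set of components of the (irredundant) primary decomposition of \<open>I\<close>, all of whose
  associated primes are maximal. Intersections are taken with the carrier because the empty
  intersection is the unit ideal.\<close>

definition primary_decomposition :: "('a, 'b) ring_scheme \<Rightarrow> 'a set \<Rightarrow> 'a set set \<Rightarrow> bool" where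
  "primary_decomposition R I QS \<longleftrightarrow>
     finite QS \<and>
     (\<forall>Q\<in>QS. primary_ideal R Q \<and> maximalideal (radical_of R Q) R) \<and>
     inj_on (radical_of R) QS \<and>
     (\<forall>Q\<in>QS. \<not> carrier R \<inter> \<Inter>(QS - {Q}) \<subseteq> Q) \<and>
     I = carrier R \<inter> \<Inter>QS"

definition minimal_divisors ::
    "nat \<Rightarrow> (nat, 'k::field) mpoly set set \<Rightarrow> (nat, 'k) mpoly set \<Rightarrow> (nat, 'k) mpoly set set" where
  "minimal_divisors n QS Q =
     (let M = radical_of (P_ring n) Q in
      {Q' \<inter> \<Inter>(QS - {Q}) | Q'.
         ideal Q' (P_ring n) \<and> Q \<subset> Q' \<and>
         (if Q = M then Q' = carrier (P_ring n) else Q' \<subseteq> M) \<and>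
         (\<exists>d. ring.dimension (P_ring n Quot Q) d (scalars n Q) (residue_classes n Q Q') \<and>
              ring.dimension (P_ring n Quot M) d (scalars n M) (carrier (P_ring n Quot M)))})"

definition divisor_reg_index ::
    "nat \<Rightarrow> (nat, 'k::field) mpoly set \<Rightarrow> (nat, 'k) mpoly set \<Rightarrow> int" where
  "divisor_reg_index n I J =
     Max (filt_ord n I ` (residue_classes n I J - {\<zero>\<^bsub>P_ring n Quot I\<^esub>}))"

definition sepdeg ::
    "nat \<Rightarrow> (nat, 'k::field) mpoly set \<Rightarrow> (nat, 'k) mpoly set set \<Rightarrow> (nat, 'k) mpoly set \<Rightarrow> int" where
  "sepdeg n I QS Q = Min (divisor_reg_index n I ` minimal_divisors n QS Q)"

definition cayley_bacharach :: "nat \<Rightarrow> (nat, 'k::field) mpoly set \<Rightarrow> bool" where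
  "cayley_bacharach n I \<longleftrightarrow>
     (\<exists>QS. primary_decomposition (P_ring n) I QS \<and>
           (\<forall>Q\<in>QS. sepdeg n I QS Q = reg_index n I))"

end

theory Submission
  imports Defs
begin

text \<open>
  Let \<open>I\<close> be an ideal for which \<open>\<O>\<close> is a degree filtered basis of \<open>R = P/I\<close>, and let \<open>d\<close> be the
  largest degree in \<open>\<O>\<close>, which is then the regularity index of \<open>R\<close>. The theorem rests on three facts.

  The scheme fails to be Cayley-Bacharach iff \<open>F\<^sub>d\<^sub>-\<^sub>1R\<close> contains a nonzero ideal of \<open>R\<close>
  (\<open>not_cayley_bacharach_iff\<close>). The ideals \<open>J/I\<close> of minimal \<open>\<QQ>\<^sub>i\<close>-divisors are simple
  \<open>R\<close>-modules, and \<open>sepdeg(\<mm>\<^sub>i) < d\<close> says that one of them lies in \<open>F\<^sub>d\<^sub>-\<^sub>1R\<close>. Conversely a nonzero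
  ideal in \<open>F\<^sub>d\<^sub>-\<^sub>1R\<close> contains the residue class of some \<open>f\<close> whose annihilator \<open>(I : f)\<close> is a maximal
  ideal \<open>\<MM>\<close> (an associated prime), and \<open>f\<close> generates a minimal divisor for the component of \<open>I\<close>
  belonging to \<open>\<MM>\<close> (\<open>principal_minimal_divisor\<close>). Because \<open>R\<close> has finite dimension, chains of ideals
  above \<open>I\<close> have bounded length; associated primes, the maximality of primes and the primary
  decomposition all come from this.

  If \<open>f \<equiv> \<Sum>\<^sub>i v\<^sub>i t\<^sub>i\<close>, then \<open>fR \<subseteq> F\<^sub>d\<^sub>-\<^sub>1R\<close> means that no product \<open>f t\<^sub>l\<close> has a coordinate at a basis term of
  degree \<open>d\<close>. In terms of multiplication matrices this reads \<open>\<Sum>\<^sub>i (M\<^bsub>t\<^sub>i\<^esub>)\<^sub>k\<^sub>l v\<^sub>i = 0\<close> for all \<open>l\<close> and the last \<open>\<Delta>\<close>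
  row indices \<open>k\<close>, which is \<open>Wv = 0\<close> (\<open>not_cayley_bacharach_point_iff\<close>). A nonzero \<open>v\<close> of this kind
  exists iff all maximal minors of \<open>W\<close> vanish (\<open>maximal_minors_vanish_iff\<close>).

  The points at which \<open>I(\<BB>\<^sub>\<O>) + I\<^sup>d\<^sup>f\<^sub>\<O>\<close> vanishes parametrize the ideals with a degree filtered
  \<open>\<O>\<close>-border basis. Commuting matrices \<open>A\<^sub>r\<close> turn \<open>L\<^sup>\<mu>\<close> into a \<open>P\<close>-module, and the kernel of
  \<open>p \<mapsto> p(A)e\<^sub>0\<close>, with the unit vector \<open>e\<^sub>0\<close> of the basis term \<open>1\<close>, is the ideal represented by the point (\<open>coords_point_ideal\<close>,
  \<open>point_ideal_df_basis\<close>). Conversely the matrices of multiplication by the indeterminates on \<open>P/I\<close>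
  commute (\<open>ex_matrix_of_ideal\<close>). The coefficients are unique because \<open>\<O>\<close> is independent modulo \<open>I\<close>
  (\<open>point_ideal_inj\<close>).
\<close>


section \<open>Polynomial rings and evaluation\<close>

definition polys :: "'v set \<Rightarrow> ('v, 'k::field) mpoly set" where
  "polys X = {p. Poly_Mapping.keys p \<subseteq> terms X}"

abbreviation mon :: "'v trm \<Rightarrow> ('v, 'k::field) mpoly" where
  "mon t \<equiv> Poly_Mapping.single t 1"

lemma poly_ring_simps [simp]:
  "carrier (poly_ring X) = polys X" "monoid.mult (poly_ring X) = (*)" "one (poly_ring X) = 1"
  "zero (poly_ring X) = 0" "add (poly_ring X) = (+)"
  by (auto simp: poly_ring_def polys_def)

lemma keys_plus_nat: "Poly_Mapping.keys (s + t :: 'v trm) = Poly_Mapping.keys s \<union> Poly_Mapping.keys t"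
  by (auto simp: in_keys_iff lookup_add)

lemma terms_zero [simp]: "0 \<in> terms X"
  by (simp add: terms_def)

lemma terms_plus_iff [simp]: "s + t \<in> terms X \<longleftrightarrow> s \<in> terms X \<and> t \<in> terms X"
  by (simp add: terms_def keys_plus_nat)

lemma terms_x_term [simp]: "Poly_Mapping.single r (Suc 0) \<in> terms X \<longleftrightarrow> r \<in> X"
  by (simp add: terms_def)

lemma polys_zero [simp, intro]: "0 \<in> polys X"
  by (simp add: polys_def)

lemma polys_one [simp, intro]: "1 \<in> polys X"
  by (simp add: polys_def)

lemma polys_add [simp, intro]: "p \<in> polys X \<Longrightarrow> q \<in> polys X \<Longrightarrow> p + q \<in> polys X"
  using Poly_Mapping.keys_add[of p q] by (auto simp: polys_def)

lemma polys_uminus [simp, intro]: "p \<in> polys X \<Longrightarrow> - p \<in> polys X"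
  by (simp add: polys_def)

lemma polys_diff [simp, intro]: "p \<in> polys X \<Longrightarrow> q \<in> polys X \<Longrightarrow> p - q \<in> polys X"
  using polys_add[of p X "- q"] by simp

lemma polys_mult [simp, intro]: "p \<in> polys X \<Longrightarrow> q \<in> polys X \<Longrightarrow> p * q \<in> polys X"
  using keys_mult[of p q] by (fastforce simp: polys_def)

lemma polys_power [simp, intro]: "p \<in> polys X \<Longrightarrow> p ^ k \<in> polys X"
  by (induction k) auto

lemma polys_sum [intro]: "(\<And>i. i \<in> A \<Longrightarrow> f i \<in> polys X) \<Longrightarrow> sum f A \<in> polys X"
  by (induction A rule: infinite_finite_induct) auto

lemma polys_prod [intro]: "(\<And>i. i \<in> A \<Longrightarrow> f i \<in> polys X) \<Longrightarrow> prod f A \<in> polys X"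
  by (induction A rule: infinite_finite_induct) auto

lemma polys_single [simp]: "Poly_Mapping.single t c \<in> polys X \<longleftrightarrow> c = 0 \<or> t \<in> terms X"
  by (auto simp: polys_def)

lemma polys_const_poly [simp, intro]: "const_poly c \<in> polys X"
  by (simp add: const_poly_def)

lemma keys_subset_polys: "Poly_Mapping.keys p \<subseteq> D \<Longrightarrow> D \<subseteq> terms X \<Longrightarrow> p \<in> polys X"
  by (auto simp: polys_def)

lemma cring_poly_ring: "cring (poly_ring X :: (('v, 'k::field) mpoly) ring)"
proof (rule cringI)
  show "abelian_group (poly_ring X :: (('v, 'k) mpoly) ring)"
  proof (rule abelian_groupI, goal_cases)
    case (6 x)
    then show ?case by (intro bexI[of _ "- x"]) auto
  qed (auto simp: algebra_simps)
  show "comm_monoid (poly_ring X :: (('v, 'k) mpoly) ring)"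
    by (rule comm_monoidI) (auto simp: algebra_simps)
qed (auto simp: algebra_simps)

lemma ring_poly_ring: "ring (poly_ring X :: (('v, 'k::field) mpoly) ring)"
  using cring_poly_ring by (rule cring.axioms(1))

lemma poly_ring_pow [simp]: "(a :: ('v, 'k::field) mpoly) [^]\<^bsub>poly_ring X\<^esub> (k::nat) = a ^ k"
proof -
  interpret cring "poly_ring X :: (('v, 'k::field) mpoly) ring" by (rule cring_poly_ring)
  show ?thesis by (induction k) (auto simp: mult.commute)
qed

lemma sum_monomials: "p = (\<Sum>t\<in>Poly_Mapping.keys p. Poly_Mapping.single t (Poly_Mapping.lookup p t))"
proof (rule poly_mapping_eqI)
  fix s
  show "Poly_Mapping.lookup p s =
    Poly_Mapping.lookup (\<Sum>t\<in>Poly_Mapping.keys p. Poly_Mapping.single t (Poly_Mapping.lookup p t)) s"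
    by (simp add: lookup_sum lookup_single when_def in_keys_iff)
qed

lemma const_poly_mult_single: "const_poly c * Poly_Mapping.single t d = Poly_Mapping.single t (c * d)"
  by (simp add: const_poly_def mult_single)

lemma lookup_const_poly_mult: "Poly_Mapping.lookup (const_poly c * p) t = c * Poly_Mapping.lookup p t"
proof -
  have "Poly_Mapping.lookup (Poly_Mapping.map ((*) c) p) t = c * Poly_Mapping.lookup p t"
    by transfer (simp add: when_def)
  then show ?thesis by (simp add: const_poly_def mult_map_scale_conv_mult)
qed

lemma const_poly_hom:
  "const_poly 0 = 0" "const_poly 1 = 1"
  "const_poly (a + b) = const_poly a + const_poly b"
  "const_poly (a * b) = const_poly a * const_poly b"
  "const_poly (- a) = - const_poly (a :: 'k::field)"
  "const_poly (a - b) = const_poly a - const_poly b"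
  by (simp_all add: const_poly_def single_add single_diff single_uminus mult_single)

interpretation const_poly: comm_ring_hom "const_poly :: 'k::field \<Rightarrow> ('v, 'k) mpoly"
  by unfold_locales (auto simp: const_poly_hom)

lemma keys_const_poly_mult: "Poly_Mapping.keys (const_poly c * p) \<subseteq> Poly_Mapping.keys p"
  by (auto simp: in_keys_iff lookup_const_poly_mult)

context
  fixes \<phi> :: "'k::field \<Rightarrow> 'a::comm_ring_1" and g :: "'v \<Rightarrow> 'a"
  assumes hom: "comm_ring_hom \<phi>"
begin

interpretation comm_ring_hom \<phi> by (rule hom)

definition eval_term :: "'v trm \<Rightarrow> 'a" where
  "eval_term t = (\<Prod>v\<in>Poly_Mapping.keys t. g v ^ Poly_Mapping.lookup t v)"

lemma eval_term_plus: "eval_term (s + t) = eval_term s * eval_term t"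
proof -
  let ?A = "Poly_Mapping.keys s \<union> Poly_Mapping.keys t"
  have *: "eval_term u = (\<Prod>v\<in>?A. g v ^ Poly_Mapping.lookup u v)" if "Poly_Mapping.keys u \<subseteq> ?A" for u
    unfolding eval_term_def
    by (rule prod.mono_neutral_left) (use that in \<open>auto simp: in_keys_iff\<close>)
  show ?thesis
    by (simp add: * keys_plus_nat lookup_add power_add prod.distrib)
qed

lemma poly_eval_alt: "poly_eval \<phi> g p =
    (\<Sum>t\<in>Poly_Mapping.keys p. \<phi> (Poly_Mapping.lookup p t) * eval_term t)"
  by (simp add: poly_eval_def eval_term_def)

lemma poly_eval_add: "poly_eval \<phi> g (p + q) = poly_eval \<phi> g p + poly_eval \<phi> g q"
  unfolding poly_eval_alt
  by (rule setsum_keys_plus_distrib) (auto simp: hom_add algebra_simps)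

lemma poly_eval_zero: "poly_eval \<phi> g 0 = 0"
  by (simp add: poly_eval_def)

lemma poly_eval_sum: "poly_eval \<phi> g (sum f A) = (\<Sum>i\<in>A. poly_eval \<phi> g (f i))"
  by (induction A rule: infinite_finite_induct) (auto simp: poly_eval_add poly_eval_zero)

lemma poly_eval_single: "poly_eval \<phi> g (Poly_Mapping.single t c) = \<phi> c * eval_term t"
  by (simp add: poly_eval_alt)

lemma poly_eval_mult: "poly_eval \<phi> g (p * q) = poly_eval \<phi> g p * poly_eval \<phi> g q"
proof -
  have "p * q = (\<Sum>s\<in>Poly_Mapping.keys p. \<Sum>t\<in>Poly_Mapping.keys q.
      Poly_Mapping.single (s + t) (Poly_Mapping.lookup p s * Poly_Mapping.lookup q t))"
    by (subst (1) sum_monomials[of p], subst (1) sum_monomials[of q])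
      (simp add: sum_product mult_single)
  then show ?thesis
    by (simp add: poly_eval_sum poly_eval_single poly_eval_alt[of p] poly_eval_alt[of q]
        eval_term_plus hom_mult sum_product algebra_simps)
qed

lemma comm_ring_hom_poly_eval: "comm_ring_hom (poly_eval \<phi> g)"
proof
  show "poly_eval \<phi> g 1 = 1"
    using poly_eval_single[of 0 1] by (simp add: eval_term_def)
qed (auto simp: poly_eval_add poly_eval_mult poly_eval_zero)

end

lemma poly_eval_c_var: "comm_ring_hom \<phi> \<Longrightarrow> poly_eval \<phi> g (c_var i j) = g (i, j)"
  by (simp add: c_var_def poly_eval_single eval_term_def comm_ring_hom.axioms
      comm_semiring_hom.axioms comm_ring_hom_def ring_hom_def semiring_hom_def monoid_mult_hom_def
      one_hom.hom_one)

section \<open>Ideals of polynomials\<close>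

definition is_ideal :: "'v set \<Rightarrow> ('v, 'k::field) mpoly set \<Rightarrow> bool" where
  "is_ideal X I \<longleftrightarrow> I \<subseteq> polys X \<and> 0 \<in> I \<and> (\<forall>a\<in>I. \<forall>b\<in>I. a + b \<in> I) \<and>
     (\<forall>p\<in>polys X. \<forall>a\<in>I. p * a \<in> I)"

lemma ideal_iff: "ideal I (poly_ring X) \<longleftrightarrow> is_ideal X I"
proof
  assume "ideal I (poly_ring X)"
  then interpret ideal I "poly_ring X" .
  show "is_ideal X I"
    using a_subset additive_subgroup.a_closed[OF is_additive_subgroup]
      additive_subgroup.zero_closed[OF is_additive_subgroup] I_l_closed
    by (auto simp: is_ideal_def)
next
  assume I: "is_ideal X I"
  show "ideal I (poly_ring X)"
  proof (rule idealI)
    show "ring (poly_ring X :: (('a, 'b) mpoly) ring)" by (rule ring_poly_ring)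
    interpret cring "poly_ring X :: (('a, 'b) mpoly) ring" by (rule cring_poly_ring)
    have inv: "\<ominus>\<^bsub>poly_ring X\<^esub> a = - a" if "a \<in> polys X" for a :: "('a, 'b) mpoly"
      by (rule minus_equality) (use that in auto)
    have um: "- a \<in> I" if "a \<in> I" for a :: "('a, 'b) mpoly"
      using I that polys_uminus[OF polys_one] unfolding is_ideal_def by (metis mult_minus1)
    show "subgroup I (add_monoid (poly_ring X))"
      unfolding a_inv_def[symmetric]
    proof (rule subgroup.intro, goal_cases)
      case (4 x)
      then have "\<ominus>\<^bsub>poly_ring X\<^esub> x = - x" using I inv by (auto simp: is_ideal_def)
      then show ?case using um 4 by (simp add: a_inv_def)
    qed (use I in \<open>auto simp: is_ideal_def\<close>)
  next
    fix a x :: "('a, 'b) mpoly" assume "a \<in> I" "x \<in> carrier (poly_ring X)"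
    then have "x * a \<in> I" using I by (simp add: is_ideal_def)
    then show "x \<otimes>\<^bsub>poly_ring X\<^esub> a \<in> I" "a \<otimes>\<^bsub>poly_ring X\<^esub> x \<in> I"
      by (simp_all add: mult.commute[of a x])
  qed
qed

lemma is_idealI:
  assumes "I \<subseteq> polys X" "0 \<in> I" "\<And>a b. a \<in> I \<Longrightarrow> b \<in> I \<Longrightarrow> a + b \<in> I"
    "\<And>p a. p \<in> polys X \<Longrightarrow> a \<in> I \<Longrightarrow> p * a \<in> I"
  shows "is_ideal X I"
  using assms by (auto simp: is_ideal_def)

lemma is_ideal_subset: "is_ideal X I \<Longrightarrow> a \<in> I \<Longrightarrow> a \<in> polys X"
  and is_ideal_zero: "is_ideal X I \<Longrightarrow> 0 \<in> I"
  and is_ideal_add: "is_ideal X I \<Longrightarrow> a \<in> I \<Longrightarrow> b \<in> I \<Longrightarrow> a + b \<in> I"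
  and is_ideal_mult: "is_ideal X I \<Longrightarrow> p \<in> polys X \<Longrightarrow> a \<in> I \<Longrightarrow> p * a \<in> I"
  by (auto simp: is_ideal_def)

lemma is_ideal_mult2: "is_ideal X I \<Longrightarrow> p \<in> polys X \<Longrightarrow> a \<in> I \<Longrightarrow> a * p \<in> I"
  by (subst mult.commute) (rule is_ideal_mult)

lemma is_ideal_uminus: "is_ideal X I \<Longrightarrow> a \<in> I \<Longrightarrow> - a \<in> I"
  using is_ideal_mult[of X I "- 1" a] by simp

lemma is_ideal_diff: "is_ideal X I \<Longrightarrow> a \<in> I \<Longrightarrow> b \<in> I \<Longrightarrow> a - b \<in> I"
  using is_ideal_add[of X I a "- b"] is_ideal_uminus[of X I b] by simp

lemma is_ideal_sum: "is_ideal X I \<Longrightarrow> (\<And>i. i \<in> A \<Longrightarrow> f i \<in> I) \<Longrightarrow> sum f A \<in> I"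
  by (induction A rule: infinite_finite_induct) (auto simp: is_ideal_zero is_ideal_add)

lemma is_ideal_diff_swap: "is_ideal X I \<Longrightarrow> a - b \<in> I \<longleftrightarrow> b - a \<in> I"
  using is_ideal_uminus[of X I "a - b"] is_ideal_uminus[of X I "b - a"] by auto

lemma is_ideal_diff_trans: "is_ideal X I \<Longrightarrow> a - b \<in> I \<Longrightarrow> b - c \<in> I \<Longrightarrow> a - c \<in> I"
  using is_ideal_add[of X I "a - b" "b - c"] by simp

lemma is_ideal_diff_mem: "is_ideal X I \<Longrightarrow> a - b \<in> I \<Longrightarrow> a \<in> I \<longleftrightarrow> b \<in> I"
  using is_ideal_add[of X I "a - b" b] is_ideal_diff[of X I a "a - b"] by auto

lemma is_ideal_polys: "is_ideal X (polys X)"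
  by (auto simp: is_ideal_def)

lemma is_ideal_one: "is_ideal X I \<Longrightarrow> 1 \<in> I \<longleftrightarrow> I = polys X"
  using is_ideal_mult2[of X I _ 1] by (auto simp: is_ideal_def)

lemma is_ideal_Inter: "(\<And>I. I \<in> \<I> \<Longrightarrow> is_ideal X I) \<Longrightarrow> is_ideal X (polys X \<inter> \<Inter>\<I>)"
  by (auto simp: is_ideal_def)

lemma genideal_is_ideal: "S \<subseteq> polys X \<Longrightarrow> is_ideal X (genideal (poly_ring X) S)"
  unfolding ideal_iff[symmetric] by (rule ring.genideal_ideal[OF ring_poly_ring]) simp

lemma set_add_is_ideal: "is_ideal X I \<Longrightarrow> is_ideal X J \<Longrightarrow> is_ideal X (I <+>\<^bsub>poly_ring X\<^esub> J)"
  unfolding ideal_iff[symmetric] by (rule ring.add_ideals[OF ring_poly_ring])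

definition ideal_plus :: "'v set \<Rightarrow> ('v, 'k::field) mpoly set \<Rightarrow> ('v, 'k) mpoly \<Rightarrow> ('v, 'k) mpoly set" where
  "ideal_plus X I f = {a + p * f | a p. a \<in> I \<and> p \<in> polys X}"

lemma ideal_plus_ideal:
  fixes f :: "('v, 'k::field) mpoly"
  assumes I: "is_ideal X I" and f: "f \<in> polys X"
  shows "is_ideal X (ideal_plus X I f)"
proof (rule is_idealI)
  show "ideal_plus X I f \<subseteq> polys X"
    using f is_ideal_subset[OF I] by (auto simp: ideal_plus_def)
  show "0 \<in> ideal_plus X I f"
    using is_ideal_zero[OF I] by (force simp: ideal_plus_def intro: exI[of _ 0])
next
  fix a b assume "a \<in> ideal_plus X I f" "b \<in> ideal_plus X I f"
  then obtain a1 p1 a2 p2 where "a = a1 + p1 * f" "b = a2 + p2 * f" "a1 \<in> I" "a2 \<in> I"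
    "p1 \<in> polys X" "p2 \<in> polys X" by (auto simp: ideal_plus_def)
  then have "a + b = (a1 + a2) + (p1 + p2) * f" "a1 + a2 \<in> I" "p1 + p2 \<in> polys X"
    using is_ideal_add[OF I] by (auto simp: algebra_simps)
  then show "a + b \<in> ideal_plus X I f" unfolding ideal_plus_def by blast
next
  fix p a :: "('v, 'k) mpoly" assume p: "p \<in> polys X" and "a \<in> ideal_plus X I f"
  then obtain a1 p1 where "a = a1 + p1 * f" "a1 \<in> I" "p1 \<in> polys X" by (auto simp: ideal_plus_def)
  then have "p * a = p * a1 + (p * p1) * f" "p * a1 \<in> I" "p * p1 \<in> polys X"
    using p is_ideal_mult[OF I] by (simp_all add: distrib_left mult.assoc)
  then show "p * a \<in> ideal_plus X I f" unfolding ideal_plus_def by blast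
qed

lemma ideal_plus_superset: "I \<subseteq> ideal_plus X I f"
  by (force simp: ideal_plus_def intro: exI[of _ 0])

lemma ideal_plus_self: "is_ideal X I \<Longrightarrow> f \<in> ideal_plus X I f"
  unfolding ideal_plus_def using is_ideal_zero[of X I] polys_one by force

definition colon :: "'v set \<Rightarrow> ('v, 'k::field) mpoly set \<Rightarrow> ('v, 'k) mpoly \<Rightarrow> ('v, 'k) mpoly set" where
  "colon X I f = {p \<in> polys X. p * f \<in> I}"

lemma colon_ideal: "is_ideal X I \<Longrightarrow> is_ideal X (colon X I f)"
  by (auto simp: is_ideal_def colon_def distrib_right mult.assoc)

lemma colon_superset: "is_ideal X I \<Longrightarrow> f \<in> polys X \<Longrightarrow> I \<subseteq> colon X I f"
  using is_ideal_mult2[of X I f] by (auto simp: is_ideal_subset colon_def)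

lemma primeideal_iff: "primeideal M (poly_ring X) \<longleftrightarrow> is_ideal X M \<and> M \<noteq> polys X \<and>
    (\<forall>a\<in>polys X. \<forall>b\<in>polys X. a * b \<in> M \<longrightarrow> a \<in> M \<or> b \<in> M)"
  by (auto simp: primeideal_def primeideal_axioms_def ideal_iff cring_poly_ring)

lemma maximalideal_iff: "maximalideal M (poly_ring X) \<longleftrightarrow> is_ideal X M \<and> M \<noteq> polys X \<and>
    (\<forall>J. is_ideal X J \<and> M \<subseteq> J \<longrightarrow> J = M \<or> J = polys X)"
  by (auto simp: maximalideal_def maximalideal_axioms_def ideal_iff is_ideal_subset subset_iff)

lemma maximalideal_prime: "maximalideal M (poly_ring X) \<Longrightarrow> primeideal M (poly_ring X)"
  by (rule cring.maximalideal_prime[OF cring_poly_ring])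

section \<open>Vector spaces modulo an ideal\<close>

text \<open>Linear algebra in \<open>P/I\<close> is done with representatives in \<open>P\<close>: \<open>span_mod I D\<close> is the
  subspace \<open>I + \<langle>D\<rangle>\<close> of \<open>P\<close>, the preimage of the span of the residue classes of \<open>D\<close>. Sets of terms
  suffice as bases, so coefficients are simply the coefficients of a polynomial supported in \<open>D\<close>.\<close>

definition span_mod :: "('v, 'k::field) mpoly set \<Rightarrow> 'v trm set \<Rightarrow> ('v, 'k) mpoly set" where
  "span_mod I D = {p. \<exists>q. Poly_Mapping.keys q \<subseteq> D \<and> p - q \<in> I}"

definition indep_mod :: "('v, 'k::field) mpoly set \<Rightarrow> 'v trm set \<Rightarrow> bool" where
  "indep_mod I D \<longleftrightarrow> (\<forall>p\<in>I. Poly_Mapping.keys p \<subseteq> D \<longrightarrow> p = 0)"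

lemma span_modI: "Poly_Mapping.keys q \<subseteq> D \<Longrightarrow> p - q \<in> I \<Longrightarrow> p \<in> span_mod I D"
  by (auto simp: span_mod_def)

lemma span_mod_add: "is_ideal X I \<Longrightarrow> p \<in> span_mod I D \<Longrightarrow> q \<in> span_mod I D \<Longrightarrow> p + q \<in> span_mod I D"
proof -
  assume I: "is_ideal X I" and "p \<in> span_mod I D" "q \<in> span_mod I D"
  then obtain p' q' where "Poly_Mapping.keys p' \<subseteq> D" "p - p' \<in> I" "Poly_Mapping.keys q' \<subseteq> D" "q - q' \<in> I"
    by (auto simp: span_mod_def)
  then have "Poly_Mapping.keys (p' + q') \<subseteq> D" "(p + q) - (p' + q') \<in> I"
    using Poly_Mapping.keys_add[of p' q'] is_ideal_add[OF I, of "p - p'" "q - q'"]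
    by (auto simp: algebra_simps)
  then show ?thesis by (rule span_modI)
qed

lemma span_mod_scale: "is_ideal X I \<Longrightarrow> p \<in> span_mod I D \<Longrightarrow> const_poly c * p \<in> span_mod I D"
proof -
  assume I: "is_ideal X I" and "p \<in> span_mod I D"
  then obtain p' where "Poly_Mapping.keys p' \<subseteq> D" "p - p' \<in> I"
    by (auto simp: span_mod_def)
  then have "Poly_Mapping.keys (const_poly c * p') \<subseteq> D" "const_poly c * p - const_poly c * p' \<in> I"
    using keys_const_poly_mult[of c p'] is_ideal_mult[OF I polys_const_poly, of "p - p'" c]
    by (auto simp: algebra_simps)
  then show ?thesis by (rule span_modI)
qed

lemma span_mod_ideal: "is_ideal X I \<Longrightarrow> p \<in> I \<Longrightarrow> p \<in> span_mod I D"
  by (rule span_modI[of 0]) auto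

lemma span_mod_sum: "is_ideal X I \<Longrightarrow> (\<And>i. i \<in> A \<Longrightarrow> f i \<in> span_mod I D) \<Longrightarrow> sum f A \<in> span_mod I D"
  by (induction A rule: infinite_finite_induct)
    (auto intro: span_mod_add span_mod_ideal is_ideal_zero)

lemma span_mod_monomials:
  assumes I: "is_ideal X I" and "\<And>t. t \<in> Poly_Mapping.keys p \<Longrightarrow> mon t * f \<in> span_mod I D"
  shows "p * f \<in> span_mod I D"
proof -
  have "p * f = (\<Sum>t\<in>Poly_Mapping.keys p. const_poly (Poly_Mapping.lookup p t) * (mon t * f))"
    by (subst (1) sum_monomials[of p])
      (simp add: sum_distrib_right mult.assoc[symmetric] const_poly_mult_single)
  then show ?thesis using assms by (auto intro!: span_mod_sum span_mod_scale)
qed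

lemma span_mod_cong: "is_ideal X I \<Longrightarrow> p - q \<in> I \<Longrightarrow> p \<in> span_mod I D \<longleftrightarrow> q \<in> span_mod I D"
  using span_mod_add[of X I q D "p - q"] span_mod_add[of X I p D "q - p"]
    span_mod_ideal[of X I "p - q"] span_mod_ideal[of X I "q - p"]
  by (auto simp: is_ideal_diff_swap[of X I p q])

lemma span_mod_trans:
  assumes I: "is_ideal X I" and p: "p \<in> span_mod I D" and D: "\<And>t. t \<in> D \<Longrightarrow> mon t \<in> span_mod I E"
  shows "p \<in> span_mod I E"
proof -
  obtain q where q: "Poly_Mapping.keys q \<subseteq> D" "p - q \<in> I" using p by (auto simp: span_mod_def)
  have "q * 1 \<in> span_mod I E"
    by (rule span_mod_monomials[OF I]) (use q D in auto)
  then show ?thesis using span_mod_cong[OF I q(2)] by simp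
qed

lemma span_mod_mono: "I \<subseteq> J \<Longrightarrow> D \<subseteq> E \<Longrightarrow> span_mod I D \<subseteq> span_mod J E"
  by (fastforce simp: span_mod_def)

lemma span_mod_monom: "is_ideal X I \<Longrightarrow> t \<in> D \<Longrightarrow> mon t \<in> span_mod I D"
  by (rule span_modI[of "mon t"]) (auto simp: is_ideal_zero)

lemma span_mod_polys: "is_ideal X I \<Longrightarrow> D \<subseteq> terms X \<Longrightarrow> span_mod I D \<subseteq> polys X"
proof
  fix p assume I: "is_ideal X I" "D \<subseteq> terms X" "p \<in> span_mod I D"
  then obtain q where "Poly_Mapping.keys q \<subseteq> D" "p - q \<in> I" by (auto simp: span_mod_def)
  then have "(p - q) + q \<in> polys X" using I by (intro polys_add) (auto simp: polys_def is_ideal_def)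
  then show "p \<in> polys X" by simp
qed

lemma indep_mod_insert:
  assumes I: "is_ideal X I" and ind: "indep_mod I D" and t: "mon t \<notin> span_mod I D"
  shows "indep_mod I (insert t D)"
  unfolding indep_mod_def
proof (intro ballI impI)
  fix p assume p: "p \<in> I" "Poly_Mapping.keys p \<subseteq> insert t D"
  let ?c = "Poly_Mapping.lookup p t"
  show "p = 0"
  proof (cases "?c = 0")
    case True
    then have "Poly_Mapping.keys p \<subseteq> D" using p(2) by (auto simp: in_keys_iff)
    then show ?thesis using ind p(1) by (auto simp: indep_mod_def)
  next
    case False
    let ?q = "mon t - const_poly (1 / ?c) * p"
    have "Poly_Mapping.keys ?q \<subseteq> D"
    proof
      fix s assume "s \<in> Poly_Mapping.keys ?q"
      then have "s \<noteq> t" "s \<in> Poly_Mapping.keys p"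
        using False by (auto simp: in_keys_iff lookup_minus lookup_const_poly_mult lookup_single when_def
            split: if_splits)
      then show "s \<in> D" using p(2) by auto
    qed
    moreover have "mon t - ?q \<in> I" using is_ideal_mult[OF I polys_const_poly p(1)] by simp
    ultimately show ?thesis using t span_modI by blast
  qed
qed

lemma indep_mod_remove:
  assumes I: "is_ideal X I" and ind: "indep_mod I (insert t D)" and t: "t \<notin> D"
  shows "mon t \<notin> span_mod I D"
proof
  assume "mon t \<in> span_mod I D"
  then obtain q :: "('a, 'b) mpoly" where q: "Poly_Mapping.keys q \<subseteq> D" "mon t - q \<in> I" by (auto simp: span_mod_def)
  have "Poly_Mapping.keys (mon t - q) \<subseteq> insert t D"
    using q(1) keys_diff[of "mon t :: ('a, 'b) mpoly" q] by auto
  then have "mon t - q = 0" using ind q(2) by (auto simp: indep_mod_def)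
  then show False using q(1) t by auto
qed

lemma indep_mod_mono: "I \<subseteq> J \<Longrightarrow> D \<subseteq> E \<Longrightarrow> indep_mod J E \<Longrightarrow> indep_mod I D"
  by (auto simp: indep_mod_def)



section \<open>Residue class rings\<close>

lemma coset_eq: "I +>\<^bsub>poly_ring X\<^esub> p = {a + p | a. a \<in> I}"
  by (auto simp: a_r_coset_def')

lemma coset_eq_iff:
  assumes "is_ideal X I"
  shows "I +>\<^bsub>poly_ring X\<^esub> p = I +>\<^bsub>poly_ring X\<^esub> q \<longleftrightarrow> p - q \<in> I"
proof
  assume "I +>\<^bsub>poly_ring X\<^esub> p = I +>\<^bsub>poly_ring X\<^esub> q"
  moreover have "p \<in> I +>\<^bsub>poly_ring X\<^esub> p"
    using is_ideal_zero[OF assms] by (force simp: coset_eq)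
  ultimately obtain a where "a \<in> I" "p = a + q" by (auto simp: coset_eq)
  then show "p - q \<in> I" by simp
next
  assume d: "p - q \<in> I"
  have "\<exists>b. a + p = b + q \<and> b \<in> I" "\<exists>b. a + q = b + p \<and> b \<in> I" if "a \<in> I" for a
    using is_ideal_add[OF assms that d] is_ideal_diff[OF assms that d]
    by (auto intro: exI[of _ "a + (p - q)"] exI[of _ "a - (p - q)"])
  then show "I +>\<^bsub>poly_ring X\<^esub> p = I +>\<^bsub>poly_ring X\<^esub> q"
    unfolding coset_eq by blast
qed

lemma Quot_ring: "is_ideal X I \<Longrightarrow> ring (poly_ring X Quot I)"
  using ideal.quotient_is_ring ideal_iff by blast

lemma Quot_carrier: "carrier (poly_ring X Quot I) = (+>\<^bsub>poly_ring X\<^esub>) I ` polys X"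
  by (auto simp: FactRing_def A_RCOSETS_def' )

lemma Quot_zero: "is_ideal X I \<Longrightarrow> \<zero>\<^bsub>poly_ring X Quot I\<^esub> = I +>\<^bsub>poly_ring X\<^esub> 0"
  by (simp add: FactRing_def coset_eq)

lemma Quot_hom: "is_ideal X I \<Longrightarrow> (+>\<^bsub>poly_ring X\<^esub>) I \<in> Ring.ring_hom (poly_ring X) (poly_ring X Quot I)"
  using ideal.rcos_ring_hom ideal_iff by blast

lemma Quot_add:
  "is_ideal X I \<Longrightarrow> p \<in> polys X \<Longrightarrow> q \<in> polys X \<Longrightarrow>
   (I +>\<^bsub>poly_ring X\<^esub> p) \<oplus>\<^bsub>poly_ring X Quot I\<^esub> (I +>\<^bsub>poly_ring X\<^esub> q) = I +>\<^bsub>poly_ring X\<^esub> (p + q)"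
  using Ring.ring_hom_add[OF Quot_hom, of X I p q] by simp

lemma Quot_mult:
  "is_ideal X I \<Longrightarrow> p \<in> polys X \<Longrightarrow> q \<in> polys X \<Longrightarrow>
   (I +>\<^bsub>poly_ring X\<^esub> p) \<otimes>\<^bsub>poly_ring X Quot I\<^esub> (I +>\<^bsub>poly_ring X\<^esub> q) = I +>\<^bsub>poly_ring X\<^esub> (p * q)"
  using Ring.ring_hom_mult[OF Quot_hom, of X I p q] by simp

abbreviation coset :: "nat \<Rightarrow> (nat, 'k::field) mpoly set \<Rightarrow> (nat, 'k) mpoly \<Rightarrow> (nat, 'k) mpoly set" where
  "coset n I p \<equiv> I +>\<^bsub>P_ring n\<^esub> p"

lemma keys_insert_decomp:
  "Poly_Mapping.keys p \<subseteq> insert t D \<longleftrightarrow>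
   (\<exists>c q. Poly_Mapping.keys q \<subseteq> D \<and> p = const_poly c * mon t + q)"
proof
  assume p: "Poly_Mapping.keys p \<subseteq> insert t D"
  let ?c = "Poly_Mapping.lookup p t"
  let ?q = "p - Poly_Mapping.single t ?c"
  have "Poly_Mapping.keys ?q \<subseteq> D"
  proof
    fix s assume "s \<in> Poly_Mapping.keys ?q"
    then have "s \<noteq> t" "s \<in> Poly_Mapping.keys p"
      by (auto simp: in_keys_iff lookup_minus lookup_single when_def split: if_splits)
    then show "s \<in> D" using p by auto
  qed
  then show "\<exists>c q. Poly_Mapping.keys q \<subseteq> D \<and> p = const_poly c * mon t + q"
    by (intro exI[of _ ?c] exI[of _ ?q]) (simp add: const_poly_mult_single)
next
  assume "\<exists>c q. Poly_Mapping.keys q \<subseteq> D \<and> p = const_poly c * mon t + q"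
  then obtain c q where "Poly_Mapping.keys q \<subseteq> D" "p = Poly_Mapping.single t c + q"
    by (auto simp: const_poly_mult_single)
  then show "Poly_Mapping.keys p \<subseteq> insert t D"
    using Poly_Mapping.keys_add[of "Poly_Mapping.single t c" q] by (auto split: if_splits)
qed

lemma Span_cosets:
  assumes I: "is_ideal {..<n} I" and f: "f \<in> polys {..<n}" and D: "set us \<subseteq> terms {..<n}"
  shows "ring.Span (P_ring n Quot I) (scalars n I) (map (\<lambda>t. coset n I (mon t * f)) us) =
    coset n I ` {p * f | p. Poly_Mapping.keys p \<subseteq> set us}"
  using D
proof (induction us)
  case Nil
  interpret Q: ring "P_ring n Quot I" by (rule Quot_ring[OF I])
  show ?case by (auto simp: Quot_zero[OF I])
next
  case (Cons t us)
  interpret Q: ring "P_ring n Quot I" by (rule Quot_ring[OF I])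
  have IH: "foldr (Q.line_extension (scalars n I)) (map (\<lambda>t. coset n I (mon t * f)) us) {\<zero>\<^bsub>P_ring n Quot I\<^esub>} =
      coset n I ` {p * f | p. Poly_Mapping.keys p \<subseteq> set us}"
    using Cons by simp
  have t: "t \<in> terms {..<n}" and us: "set us \<subseteq> terms {..<n}" using Cons.prems by auto
  have tf: "mon t * f \<in> polys {..<n}" using t f by simp
  have *: "coset n I (const_poly c) \<otimes>\<^bsub>P_ring n Quot I\<^esub> coset n I (mon t * f) \<oplus>\<^bsub>P_ring n Quot I\<^esub> coset n I (q * f)
      = coset n I ((const_poly c * mon t + q) * f)" if "Poly_Mapping.keys q \<subseteq> set us" for c q
  proof -
    have "q * f \<in> polys {..<n}" using keys_subset_polys[OF that us] f by blast
    moreover have "const_poly c * (mon t * f) \<in> polys {..<n}" using tf by blast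
    ultimately show ?thesis using tf
      by (simp add: Quot_mult[OF I] Quot_add[OF I] distrib_right mult.assoc)
  qed
  have "x \<in> Q.Span (scalars n I) (map (\<lambda>t. coset n I (mon t * f)) (t # us)) \<longleftrightarrow>
      (\<exists>c q. Poly_Mapping.keys q \<subseteq> set us \<and> x = coset n I (const_poly c)
        \<otimes>\<^bsub>P_ring n Quot I\<^esub> coset n I (mon t * f) \<oplus>\<^bsub>P_ring n Quot I\<^esub> coset n I (q * f))" for x
    unfolding Q.Span.simps list.map foldr_Cons o_apply IH Q.line_extension_mem_iff
    unfolding scalars_def residue_classes_def by blast
  moreover have "(\<exists>c q. Poly_Mapping.keys q \<subseteq> set us \<and> x = coset n I (const_poly c)
        \<otimes>\<^bsub>P_ring n Quot I\<^esub> coset n I (mon t * f) \<oplus>\<^bsub>P_ring n Quot I\<^esub> coset n I (q * f)) \<longleftrightarrow>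
      (\<exists>c q. Poly_Mapping.keys q \<subseteq> set us \<and> x = coset n I ((const_poly c * mon t + q) * f))" for x
    by (intro ex_cong1 conj_cong refl) (simp only: *)
  moreover have "(\<exists>c q. Poly_Mapping.keys q \<subseteq> set us \<and> x = coset n I ((const_poly c * mon t + q) * f))
      \<longleftrightarrow> x \<in> coset n I ` {p * f | p. Poly_Mapping.keys p \<subseteq> set (t # us)}" for x
    unfolding list.set keys_insert_decomp by blast
  ultimately show ?case by (intro equalityI subsetI) (simp_all only:)
qed

text \<open>A linear relation between the products \<open>t f\<close> modulo \<open>I\<close> is a linear relation between the terms
  \<open>t\<close> modulo the ideal quotient \<open>I : f\<close>. Besides the case \<open>f = 1\<close>, this is needed to compare the
  dimension of \<open>P/(Q : f)\<close> with that of the ideal generated by \<open>f\<close> in \<open>P/Q\<close>.\<close>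

lemma independent_cosets:
  assumes I: "is_ideal {..<n} I" and f: "f \<in> polys {..<n}" and D: "set us \<subseteq> terms {..<n}"
  shows "ring.independent (P_ring n Quot I) (scalars n I) (map (\<lambda>t. coset n I (mon t * f)) us) \<longleftrightarrow>
    distinct us \<and> indep_mod (colon {..<n} I f) (set us)"
  using D
proof (induction us)
  case Nil
  interpret Q: ring "P_ring n Quot I" by (rule Quot_ring[OF I])
  show ?case by (auto simp: indep_mod_def)
next
  case (Cons t us)
  interpret Q: ring "P_ring n Quot I" by (rule Quot_ring[OF I])
  let ?J = "colon {..<n} I f"
  have J: "is_ideal {..<n} ?J" by (rule colon_ideal[OF I])
  have t: "t \<in> terms {..<n}" and us: "set us \<subseteq> terms {..<n}" using Cons.prems by auto
  have tf: "mon t * f \<in> polys {..<n}" using t f by simp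
  have "coset n I (mon t * f) \<in> ring.Span (P_ring n Quot I) (scalars n I) (map (\<lambda>t. coset n I (mon t * f)) us)
      \<longleftrightarrow> (\<exists>q. Poly_Mapping.keys q \<subseteq> set us \<and> mon t * f - q * f \<in> I)"
    unfolding Span_cosets[OF I f us] image_iff using coset_eq_iff[OF I] by blast
  also have "\<dots> \<longleftrightarrow> mon t \<in> span_mod ?J (set us)"
  proof -
    have "mon t - q \<in> polys {..<n}" if "Poly_Mapping.keys q \<subseteq> set us" for q :: "(nat, 'a) mpoly"
      using keys_subset_polys[OF that us] t by (intro polys_diff) auto
    then show ?thesis by (auto simp: span_mod_def colon_def left_diff_distrib)
  qed
  finally have *: "coset n I (mon t * f) \<in> Q.Span (scalars n I) (map (\<lambda>t. coset n I (mon t * f)) us)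
      \<longleftrightarrow> mon t \<in> span_mod ?J (set us)" .
  have "Q.independent (scalars n I) (map (\<lambda>t. coset n I (mon t * f)) (t # us)) \<longleftrightarrow>
      coset n I (mon t * f) \<notin> Q.Span (scalars n I) (map (\<lambda>t. coset n I (mon t * f)) us) \<and>
      Q.independent (scalars n I) (map (\<lambda>t. coset n I (mon t * f)) us)"
    using tf Q.independent_backwards[of "scalars n I" "coset n I (mon t * f)"]
    by (auto intro!: Q.li_Cons simp: Quot_carrier)
  also have "\<dots> \<longleftrightarrow> mon t \<notin> span_mod ?J (set us) \<and> distinct us \<and> indep_mod ?J (set us)"
    using Cons.IH us by (simp only: *)
  also have "\<dots> \<longleftrightarrow> distinct (t # us) \<and> indep_mod ?J (set (t # us))"
    using indep_mod_insert[OF J, of "set us" t] indep_mod_remove[OF J, of t "set us"]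
      indep_mod_mono[of ?J ?J "set us" "set (t # us)"] span_mod_monom[OF J, of t "set us"] by auto
  finally show ?case .
qed

lemma colon_one [simp]: "is_ideal X I \<Longrightarrow> colon X I 1 = I"
  by (auto simp: colon_def is_ideal_subset)

definition low_polys :: "nat \<Rightarrow> int \<Rightarrow> (nat, 'k::field) mpoly set" where
  "low_polys n i = {p \<in> polys {..<n}. \<forall>t\<in>Poly_Mapping.keys p. int (term_deg t) \<le> i}"

definition df_basis :: "nat \<Rightarrow> nat trm set \<Rightarrow> (nat, 'k::field) mpoly set \<Rightarrow> bool" where
  "df_basis n T I \<longleftrightarrow> indep_mod I T \<and>
     (\<forall>i::nat. low_polys n i \<subseteq> span_mod I {t \<in> T. term_deg t \<le> i})"

lemma has_df_border_basis_iff: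
  assumes I: "is_ideal {..<n} I" and T: "distinct ts" "set ts \<subseteq> terms {..<n}"
  shows "has_df_border_basis n ts I \<longleftrightarrow> df_basis n (set ts) I"
proof -
  let ?us = "\<lambda>i. filter (\<lambda>t. term_deg t \<le> i) ts"
  let ?U = "\<lambda>i. {t \<in> set ts. term_deg t \<le> i}"
  have us: "set (?us i) \<subseteq> terms {..<n}" for i using T by auto
  have ind: "ring.independent (P_ring n Quot I) (scalars n I) (map (\<lambda>t. coset n I (mon t)) (?us i))
      \<longleftrightarrow> indep_mod I (?U i)" for i
    using independent_cosets[OF I polys_one us, of i] T I by (simp add: Collect_conj_eq Int_commute)
  have span: "ring.Span (P_ring n Quot I) (scalars n I) (map (\<lambda>t. coset n I (mon t)) (?us i)) =
      coset n I ` {p. Poly_Mapping.keys p \<subseteq> ?U i}" for i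
    using Span_cosets[OF I polys_one us, of i] by simp
  have "coset n I ` {p. Poly_Mapping.keys p \<subseteq> ?U i} = deg_filtration n I (int i)
      \<longleftrightarrow> low_polys n i \<subseteq> span_mod I (?U i)" for i
  proof -
    have "coset n I ` {p. Poly_Mapping.keys p \<subseteq> ?U i} \<subseteq> deg_filtration n I (int i)"
      using T by (auto simp: deg_filtration_def residue_classes_def polys_def)
    moreover have "deg_filtration n I (int i) \<subseteq> coset n I ` {p. Poly_Mapping.keys p \<subseteq> ?U i}
        \<longleftrightarrow> low_polys n i \<subseteq> span_mod I (?U i)"
      unfolding deg_filtration_def residue_classes_def low_polys_def image_subset_iff image_iff
        subset_iff[of _ "span_mod I (?U i)"] span_mod_def
      by (auto simp: coset_eq_iff[OF I])
    ultimately show ?thesis by auto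
  qed
  then have "has_df_border_basis n ts I \<longleftrightarrow>
      (\<forall>i. indep_mod I (?U i) \<and> low_polys n i \<subseteq> span_mod I (?U i))"
    unfolding has_df_border_basis_def Let_def ind span by simp
  also have "(\<forall>i. indep_mod I (?U i)) \<longleftrightarrow> indep_mod I (set ts)"
  proof
    assume *: "\<forall>i. indep_mod I (?U i)"
    have "?U (Max (term_deg ` set ts)) = set ts" by auto
    then show "indep_mod I (set ts)" using * by metis
  next
    assume "indep_mod I (set ts)"
    then show "\<forall>i. indep_mod I (?U i)" by (auto simp: indep_mod_def)
  qed
  then have "(\<forall>i. indep_mod I (?U i) \<and> low_polys n i \<subseteq> span_mod I (?U i)) \<longleftrightarrow> df_basis n (set ts) I"
    unfolding df_basis_def by blast
  finally show ?thesis .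
qed



section \<open>Ideals of finite codimension\<close>

lemma prime_power_mem:
  "primeideal M (poly_ring X) \<Longrightarrow> a \<in> polys X \<Longrightarrow> a ^ k \<in> M \<Longrightarrow> a \<in> M"
proof (induction k)
  case 0
  then show ?case by (auto simp: primeideal_iff is_ideal_one)
next
  case (Suc k)
  then show ?case by (auto simp: primeideal_iff)
qed

lemma radical_of_poly_ring: "radical_of (poly_ring X) I = {a \<in> polys X. \<exists>k. a ^ k \<in> I}"
  by (simp add: radical_of_def)

lemma prime_avoid_Inter:
  assumes P: "primeideal P (poly_ring X)" and fin: "finite \<A>"
    and \<A>: "\<And>A. A \<in> \<A> \<Longrightarrow> A \<subseteq> polys X \<and> is_ideal X A \<and> \<not> A \<subseteq> P"
  shows "\<exists>x\<in>polys X \<inter> \<Inter>\<A>. x \<notin> P"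
  using fin \<A>
proof (induction \<A> rule: finite_induct)
  case empty
  have "1 \<notin> P" using P by (auto simp: primeideal_iff is_ideal_one)
  then show ?case by (intro bexI[of _ 1]) auto
next
  case (insert A \<A>)
  then obtain x where x: "x \<in> polys X \<inter> \<Inter>\<A>" "x \<notin> P" by auto
  obtain y where y: "y \<in> A" "y \<notin> P" "y \<in> polys X" using insert.prems[of A] by auto
  have "x * y \<notin> P" using P x y by (auto simp: primeideal_iff)
  moreover have "x * y \<in> polys X \<inter> \<Inter>(insert A \<A>)"
    using x(1) y insert.prems is_ideal_mult[of X A x y] is_ideal_mult2[of X _ y x] by auto
  ultimately show ?case by blast
qed

text \<open>A finite set of terms that spans \<open>P/I\<close> is enough to bound the length of chains of ideals above
  \<open>I\<close>, hence to have both chain conditions for them.\<close>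

locale finite_codim =
  fixes X :: "'v set" and T :: "'v trm set" and I :: "('v, 'k::field) mpoly set"
  assumes ideal_I: "is_ideal X I" and finite_T: "finite T" and terms_T: "T \<subseteq> terms X"
    and span_T: "polys X \<subseteq> span_mod I T"
begin

text \<open>This is the dimension of \<open>P/J\<close> for an ideal \<open>J\<close> above \<open>I\<close>. In this form its strict monotonicity
  is immediate from the extension of an independent set by a single term.\<close>

definition codim :: "('v, 'k) mpoly set \<Rightarrow> nat" where
  "codim J = Max (card ` {S. S \<subseteq> T \<and> indep_mod J S})"

lemma codim_ge: "S \<subseteq> T \<Longrightarrow> indep_mod J S \<Longrightarrow> card S \<le> codim J"
  unfolding codim_def using finite_T by (intro Max_ge) auto

lemma codim_attained: "\<exists>S\<subseteq>T. indep_mod J S \<and> card S = codim J"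
proof -
  have "{} \<in> {S. S \<subseteq> T \<and> indep_mod J S}" by (simp add: indep_mod_def)
  then have "codim J \<in> card ` {S. S \<subseteq> T \<and> indep_mod J S}"
    unfolding codim_def using finite_T by (intro Max_in) auto
  then show ?thesis by auto
qed

lemma codim_le: "codim J \<le> card T"
  using codim_attained[of J] card_mono[OF finite_T] by metis

lemma max_indep_spans:
  assumes J: "is_ideal X J" "I \<subseteq> J" and S: "S \<subseteq> T" "indep_mod J S" "codim J \<le> card S"
  shows "polys X \<subseteq> span_mod J S"
proof
  fix p :: "('v, 'k) mpoly" assume "p \<in> polys X"
  then have "p \<in> span_mod J T" using span_T span_mod_mono[OF J(2), of T T] by auto
  moreover have "mon t \<in> span_mod J S" if t: "t \<in> T" for t
  proof (rule ccontr)
    assume n: "mon t \<notin> span_mod J S"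
    then have "t \<notin> S" using span_mod_monom[OF J(1)] by blast
    moreover have "indep_mod J (insert t S)" by (rule indep_mod_insert[OF J(1) S(2) n])
    ultimately show False
      using codim_ge[of "insert t S" J] t S finite_subset[OF S(1) finite_T] by simp
  qed
  ultimately show "p \<in> span_mod J S" by (rule span_mod_trans[OF J(1)])
qed

text \<open>A largest set \<open>S\<close> that is independent modulo \<open>J'\<close> is independent modulo \<open>J\<close>. If it were
  largest for \<open>J\<close> too, it would span \<open>P/J\<close>, and then every element of \<open>J'\<close> would reduce modulo \<open>J\<close>
  to a relation modulo \<open>J'\<close> between the elements of \<open>S\<close>, hence to \<open>0\<close>.\<close>

lemma codim_strict:
  assumes J: "is_ideal X J" "I \<subseteq> J" and J': "is_ideal X J'" "J \<subset> J'"
  shows "codim J' < codim J"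
proof (rule ccontr)
  assume n: "\<not> codim J' < codim J"
  obtain S where S: "S \<subseteq> T" "indep_mod J' S" "card S = codim J'" using codim_attained by blast
  have "indep_mod J S" using S(2) J'(2) by (auto simp: indep_mod_def)
  then have sp: "polys X \<subseteq> span_mod J S" using n S by (intro max_indep_spans J) auto
  obtain x where x: "x \<in> J'" "x \<notin> J" using J'(2) by auto
  then have "x \<in> span_mod J S" using sp is_ideal_subset[OF J'(1)] by auto
  then obtain q where q: "Poly_Mapping.keys q \<subseteq> S" "x - q \<in> J" by (auto simp: span_mod_def)
  then have "q \<in> J'" using is_ideal_diff_mem[OF J'(1), of x q] x(1) J'(2) by auto
  then have "q = 0" using S(2) q(1) by (auto simp: indep_mod_def)
  then show False using q(2) x(2) by simp
qed

lemma ex_maximal_ideal_in: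
  assumes "\<J> \<noteq> {}" and "\<And>J. J \<in> \<J> \<Longrightarrow> is_ideal X J \<and> I \<subseteq> J"
  shows "\<exists>J\<in>\<J>. \<forall>J'\<in>\<J>. J \<subseteq> J' \<longrightarrow> J' = J"
proof -
  obtain J where J: "J \<in> \<J>" "\<And>J'. J' \<in> \<J> \<Longrightarrow> codim J \<le> codim J'"
    using ex_has_least_nat[of "\<lambda>J. J \<in> \<J>" _ codim] assms(1) by blast
  have "J' = J" if "J' \<in> \<J>" "J \<subseteq> J'" for J'
    using codim_strict[of J J'] assms(2)[OF J(1)] assms(2)[OF that(1)] J(2)[OF that(1)] that by auto
  then show ?thesis using J(1) by blast
qed

text \<open>The descending chain \<open>I + (a\<^sup>k)\<close> becomes stationary. In \<open>P/I\<close> this relation plays the role of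
  a minimal polynomial of \<open>a\<close> with its power of the indeterminate split off.\<close>

lemma ex_power_stable:
  assumes a: "a \<in> polys X"
  shows "\<exists>k. \<exists>p\<in>polys X. a ^ k * (1 - a * p) \<in> I"
proof -
  let ?J = "\<lambda>k. ideal_plus X I (a ^ k)"
  obtain k where k: "\<And>j. codim (?J j) \<le> codim (?J k)"
    using ex_has_greatest_nat[of "\<lambda>_. True" 0 "\<lambda>k. codim (?J k)" "Suc (card T)"] codim_le
    by (auto simp: less_Suc_eq_le)
  have id: "is_ideal X (?J j)" for j using a by (intro ideal_plus_ideal ideal_I) auto
  have "?J (Suc k) \<subseteq> ?J k"
  proof
    fix x assume "x \<in> ?J (Suc k)"
    then obtain b p where "b \<in> I" "p \<in> polys X" "x = b + (p * a) * a ^ k"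
      by (auto simp: ideal_plus_def mult_ac)
    then show "x \<in> ?J k" using a unfolding ideal_plus_def by blast
  qed
  then have "?J (Suc k) = ?J k"
    using codim_strict[OF id ideal_plus_superset id, of "Suc k" k] k[of "Suc k"] by fastforce
  then have "a ^ k \<in> ?J (Suc k)" using ideal_plus_self[OF ideal_I] by simp
  then obtain b p where b: "b \<in> I" "p \<in> polys X" "a ^ k = b + p * a ^ Suc k"
    by (auto simp: ideal_plus_def)
  have "a ^ k * (1 - a * p) = a ^ k - p * a ^ Suc k" by (simp add: algebra_simps)
  also have "\<dots> = b" by (subst (1) b(3)) simp
  finally show ?thesis using b by blast
qed

text \<open>Modulo a prime, \<open>a\<^sup>k (1 - a p) = 0\<close> with \<open>a \<noteq> 0\<close> makes \<open>p\<close> an inverse of \<open>a\<close>.\<close>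

lemma prime_imp_maximal:
  assumes P: "primeideal P (poly_ring X)" and IP: "I \<subseteq> P"
  shows "maximalideal P (poly_ring X)"
proof -
  have "J = P \<or> J = polys X" if J: "is_ideal X J" "P \<subseteq> J" for J
  proof (rule ccontr)
    assume n: "\<not> (J = P \<or> J = polys X)"
    then obtain a where a: "a \<in> J" "a \<notin> P" using J by auto
    then have aX: "a \<in> polys X" using is_ideal_subset[OF J(1)] by auto
    then obtain k p where p: "p \<in> polys X" "a ^ k * (1 - a * p) \<in> I" using ex_power_stable by blast
    have "a ^ k \<notin> P" using prime_power_mem[OF P aX] a(2) by blast
    moreover have "a ^ k \<in> polys X" "1 - a * p \<in> polys X" using aX p(1) by auto
    ultimately have "1 - a * p \<in> P" using P IP p(2) unfolding primeideal_iff by blast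
    then have "1 \<in> J"
      using is_ideal_diff_mem[OF J(1), of 1 "a * p"] is_ideal_mult2[OF J(1) p(1) a(1)] J(2) by auto
    then show False using n J is_ideal_one by blast
  qed
  then show ?thesis using P by (auto simp: maximalideal_iff primeideal_iff)
qed

lemma ex_maximal_above:
  assumes J: "is_ideal X J" "I \<subseteq> J" "J \<noteq> polys X"
  shows "\<exists>M. maximalideal M (poly_ring X) \<and> J \<subseteq> M"
proof -
  let ?\<J> = "{K. is_ideal X K \<and> J \<subseteq> K \<and> K \<noteq> polys X}"
  have "\<exists>M\<in>?\<J>. \<forall>K\<in>?\<J>. M \<subseteq> K \<longrightarrow> K = M"
    by (rule ex_maximal_ideal_in) (use J in auto)
  then obtain M where M: "M \<in> ?\<J>" "\<And>K. K \<in> ?\<J> \<Longrightarrow> M \<subseteq> K \<Longrightarrow> K = M"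
    by meson
  then have "K = M \<or> K = polys X" if "is_ideal X K" "M \<subseteq> K" for K
    using that by blast
  then have "maximalideal M (poly_ring X)" using M(1) by (auto simp: maximalideal_iff)
  then show ?thesis using M(1) by blast
qed

text \<open>Among the annihilators modulo \<open>Q\<close> of elements of \<open>A\<close> a maximal one is prime, by the usual
  argument for associated primes, and primes above \<open>I\<close> are maximal.\<close>

lemma ex_associated_prime:
  assumes Q: "is_ideal X Q" "I \<subseteq> Q" and A: "is_ideal X A" "\<not> A \<subseteq> Q"
  shows "\<exists>f\<in>A - Q. maximalideal (colon X Q f) (poly_ring X)"
proof -
  have c: "is_ideal X (colon X Q f)" "I \<subseteq> colon X Q f" if "f \<in> A" for f
    using colon_ideal[OF Q(1)] colon_superset[OF Q(1), of f] is_ideal_subset[OF A(1) that] Q(2) by auto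
  have "\<exists>J\<in>colon X Q ` (A - Q). \<forall>J'\<in>colon X Q ` (A - Q). J \<subseteq> J' \<longrightarrow> J' = J"
    by (rule ex_maximal_ideal_in) (use A(2) c in auto)
  then obtain f where f: "f \<in> A - Q" and fm: "\<And>g. g \<in> A - Q \<Longrightarrow> colon X Q f \<subseteq> colon X Q g \<Longrightarrow> colon X Q g = colon X Q f"
    by auto
  have "primeideal (colon X Q f) (poly_ring X)"
    unfolding primeideal_iff
  proof (intro conjI ballI impI)
    have "1 \<notin> colon X Q f" using f by (auto simp: colon_def)
    then show "colon X Q f \<noteq> polys X" by auto
    show "is_ideal X (colon X Q f)" using c f by auto
  next
    fix a b assume ab: "a \<in> polys X" "b \<in> polys X" "a * b \<in> colon X Q f"
    show "a \<in> colon X Q f \<or> b \<in> colon X Q f"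
    proof (rule disjCI)
      assume "b \<notin> colon X Q f"
      then have "b * f \<in> A - Q" using ab f is_ideal_mult[OF A(1)] by (auto simp: colon_def)
      moreover have "p * (b * f) \<in> Q" if "p \<in> polys X" "p * f \<in> Q" for p
        using is_ideal_mult[OF Q(1) ab(2) that(2)] by (simp add: mult_ac)
      then have "colon X Q f \<subseteq> colon X Q (b * f)" by (auto simp: colon_def)
      ultimately have "colon X Q (b * f) = colon X Q f" by (rule fm)
      moreover have "a \<in> colon X Q (b * f)" using ab by (auto simp: colon_def mult.assoc)
      ultimately show "a \<in> colon X Q f" by simp
    qed
  qed
  then show ?thesis using prime_imp_maximal c f by blast
qed

subsection \<open>Primary decomposition\<close>

text \<open>The component of \<open>I\<close> at a maximal ideal \<open>M\<close> is obtained directly as the kernel of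
  \<open>P \<rightarrow> (P/I)\<^sub>M\<close>.\<close>

definition loc :: "('v, 'k) mpoly set \<Rightarrow> ('v, 'k) mpoly set" where
  "loc M = {a \<in> polys X. \<exists>s\<in>polys X - M. s * a \<in> I}"

definition max_ideals :: "('v, 'k) mpoly set set" where
  "max_ideals = {M. maximalideal M (poly_ring X) \<and> I \<subseteq> M}"

text \<open>Intersecting distinct maximal ideals one after the other gives a strictly descending chain,
  since a prime that contains a finite intersection of ideals contains one of them.\<close>

lemma finite_max_ideals: "finite max_ideals"
proof (rule ccontr)
  assume "infinite max_ideals"
  then obtain f :: "nat \<Rightarrow> _" where f: "inj f" "range f \<subseteq> max_ideals"
    using infinite_countable_subset by blast
  define J where "J k = polys X \<inter> \<Inter>(f ` {..<k})" for k
  have max: "maximalideal (f i) (poly_ring X)" "I \<subseteq> f i" for i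
    using f(2) by (auto simp: max_ideals_def)
  have id: "is_ideal X (f i)" for i using max(1) by (simp add: maximalideal_iff)
  have J: "is_ideal X (J k)" "I \<subseteq> J k" for k
    unfolding J_def using id max(2) is_ideal_subset[OF ideal_I] by (auto intro!: is_ideal_Inter)
  have strict: "J (Suc k) \<subset> J k" for k
  proof -
    have "\<not> f i \<subseteq> f k" if "i < k" for i
    proof
      assume "f i \<subseteq> f k"
      then have "f k = f i" using max(1)[of i] max(1)[of k] by (auto simp: maximalideal_iff)
      then show False using f(1) that by (auto dest: injD)
    qed
    then obtain x where "x \<in> J k" "x \<notin> f k"
      using prime_avoid_Inter[OF maximalideal_prime[OF max(1)[of k]], of "f ` {..<k}"] id is_ideal_subset[OF id]
      unfolding J_def by blast
    then show ?thesis unfolding J_def by auto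
  qed
  have "k \<le> codim (J k)" for k
  proof (induction k)
    case (Suc k)
    then show ?case using codim_strict[OF J J(1) strict, of k] by simp
  qed simp
  from this[of "Suc (card T)"] codim_le[of "J (Suc (card T))"] show False by simp
qed

context
  fixes M assumes M: "M \<in> max_ideals"
begin

lemma M_prime: "primeideal M (poly_ring X)" "is_ideal X M" "1 \<notin> M" "I \<subseteq> M"
  "\<And>a b. a \<in> polys X \<Longrightarrow> b \<in> polys X \<Longrightarrow> a * b \<in> M \<Longrightarrow> a \<in> M \<or> b \<in> M"
  using M maximalideal_prime[of M X] by (auto simp: max_ideals_def maximalideal_iff is_ideal_one primeideal_iff)

lemma loc_ideal: "is_ideal X (loc M)"
proof (rule is_idealI)
  show "0 \<in> loc M" using M_prime(3) is_ideal_zero[OF ideal_I] by (auto simp: loc_def intro!: bexI[of _ 1])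
next
  fix a b assume "a \<in> loc M" "b \<in> loc M"
  then obtain s t where st: "s \<in> polys X - M" "s * a \<in> I" "t \<in> polys X - M" "t * b \<in> I"
    and ab: "a \<in> polys X" "b \<in> polys X" by (auto simp: loc_def)
  have "(s * t) * (a + b) = t * (s * a) + s * (t * b)" by (simp add: algebra_simps)
  then have "(s * t) * (a + b) \<in> I" using st is_ideal_mult[OF ideal_I] is_ideal_add[OF ideal_I] by simp
  moreover have "s * t \<in> polys X - M" using st M_prime(5) by blast
  ultimately show "a + b \<in> loc M" using ab by (auto simp: loc_def)
next
  fix p a :: "('v, 'k) mpoly" assume "p \<in> polys X" "a \<in> loc M"
  then obtain s where s: "s \<in> polys X - M" "s * a \<in> I" "a \<in> polys X" by (auto simp: loc_def)
  have "p * (s * a) \<in> I" by (rule is_ideal_mult[OF ideal_I \<open>p \<in> polys X\<close> s(2)])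
  then have "s * (p * a) \<in> I" by (simp only: mult.left_commute)
  then show "p * a \<in> loc M" using s \<open>p \<in> polys X\<close> by (auto simp: loc_def)
qed (auto simp: loc_def)

lemma loc_subset: "loc M \<subseteq> M"
  using M_prime(4,5) by (auto simp: loc_def)

lemma loc_superset: "I \<subseteq> loc M"
  using M_prime(3) is_ideal_subset[OF ideal_I] by (auto simp: loc_def intro!: bexI[of _ 1])

text \<open>For \<open>a \<in> M\<close> the factor \<open>1 - a p\<close> in \<open>a\<^sup>k (1 - a p) \<in> I\<close> lies outside \<open>M\<close>, so it is a denominator
  that shows \<open>a\<^sup>k \<in> loc M\<close>.\<close>

lemma loc_radical: "radical_of (poly_ring X) (loc M) = M"
proof
  show "radical_of (poly_ring X) (loc M) \<subseteq> M"
    using prime_power_mem[OF M_prime(1)] loc_subset by (auto simp: radical_of_poly_ring)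
  show "M \<subseteq> radical_of (poly_ring X) (loc M)"
  proof
    fix a assume a: "a \<in> M"
    then have aX: "a \<in> polys X" using is_ideal_subset[OF M_prime(2)] by blast
    then obtain k p where p: "p \<in> polys X" "a ^ k * (1 - a * p) \<in> I" using ex_power_stable by blast
    have "1 - a * p \<notin> M"
      using is_ideal_diff_mem[OF M_prime(2), of 1 "a * p"] is_ideal_mult2[OF M_prime(2) p(1) a] M_prime(3) by auto
    moreover have "1 - a * p \<in> polys X" using aX p by blast
    ultimately have "a ^ k \<in> loc M"
      using p(2) aX by (auto simp: loc_def mult.commute intro!: bexI[of _ "1 - a * p"])
    then show "a \<in> radical_of (poly_ring X) (loc M)" using aX by (auto simp: radical_of_poly_ring)
  qed
qed

lemma loc_primary: "primary_ideal (poly_ring X) (loc M)"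
  unfolding primary_ideal_def loc_radical ideal_iff
proof (intro conjI ballI impI loc_ideal)
  show "loc M \<noteq> carrier (poly_ring X)" using loc_subset M_prime(3) by auto
  fix a b assume ab: "a \<in> carrier (poly_ring X)" "b \<in> carrier (poly_ring X)"
    "a \<otimes>\<^bsub>poly_ring X\<^esub> b \<in> loc M"
  then obtain s where s: "s \<in> polys X - M" "s * (a * b) \<in> I" by (auto simp: loc_def)
  show "a \<in> loc M \<or> b \<in> M"
  proof (rule disjCI)
    assume "b \<notin> M"
    then have "s * b \<in> polys X - M" using s ab M_prime(5) by auto
    moreover have "(s * b) * a \<in> I" using s(2) by (simp add: mult_ac)
    ultimately show "a \<in> loc M" using ab by (auto simp: loc_def)
  qed
qed

end

text \<open>An element of all components \<open>loc M\<close> has an annihilator modulo \<open>I\<close> that lies in no maximal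
  ideal, so it belongs to \<open>I\<close>.\<close>

lemma ex_primary_decomposition: "\<exists>QS. primary_decomposition (poly_ring X) I QS"
proof
  have inj: "inj_on loc max_ideals" using loc_radical by (metis inj_onI)
  have irr: "\<not> polys X \<inter> \<Inter>(loc ` max_ideals - {loc M}) \<subseteq> loc M" if M: "M \<in> max_ideals" for M
  proof -
    have "\<not> loc M' \<subseteq> M" if M': "M' \<in> max_ideals" "M' \<noteq> M" for M'
    proof
      assume "loc M' \<subseteq> M"
      then have "radical_of (poly_ring X) (loc M') \<subseteq> M"
        using prime_power_mem[OF M_prime(1)[OF M]] by (auto simp: radical_of_poly_ring)
      then have "M' \<subseteq> M" using loc_radical[OF M'(1)] by simp
      then have "M = M'" using M M' by (auto simp: max_ideals_def maximalideal_iff)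
      then show False using M'(2) by simp
    qed
    then obtain x where "x \<in> polys X \<inter> \<Inter>(loc ` max_ideals - {loc M})" "x \<notin> M"
      using prime_avoid_Inter[OF M_prime(1)[OF M], of "loc ` max_ideals - {loc M}"]
        finite_max_ideals loc_ideal is_ideal_subset[OF loc_ideal] by blast
    then show ?thesis using loc_subset[OF M] by blast
  qed
  have "x \<in> I" if x: "x \<in> polys X" "\<And>M. M \<in> max_ideals \<Longrightarrow> x \<in> loc M" for x
  proof (rule ccontr)
    assume n: "x \<notin> I"
    have "1 \<notin> colon X I x" using n by (auto simp: colon_def)
    then obtain M where M: "maximalideal M (poly_ring X)" "colon X I x \<subseteq> M"
      using ex_maximal_above[OF colon_ideal[OF ideal_I] colon_superset[OF ideal_I x(1)]] by auto
    then have "M \<in> max_ideals"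
      using colon_superset[OF ideal_I x(1)] by (auto simp: max_ideals_def)
    then obtain s where "s \<in> polys X - M" "s * x \<in> I" using x(2) by (auto simp: loc_def)
    then show False using M(2) by (auto simp: colon_def)
  qed
  then have "I = polys X \<inter> \<Inter>(loc ` max_ideals)"
    using loc_superset is_ideal_subset[OF ideal_I] by blast
  moreover have "inj_on (radical_of (poly_ring X)) (loc ` max_ideals)"
    by (rule inj_onI) (auto simp: loc_radical)
  moreover have "maximalideal M (poly_ring X)" if "M \<in> max_ideals" for M
    using that by (simp add: max_ideals_def)
  ultimately show "primary_decomposition (poly_ring X) I (loc ` max_ideals)"
    unfolding primary_decomposition_def
    using finite_max_ideals irr by (auto simp: loc_primary loc_radical)
qed

end



section \<open>Minimal divisors and the Cayley-Bacharach property\<close>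

lemma maximalideal_subset_eq:
  "maximalideal M (poly_ring X) \<Longrightarrow> maximalideal N (poly_ring X) \<Longrightarrow> M \<subseteq> N \<Longrightarrow> M = N"
  by (auto simp: maximalideal_iff)

context
  fixes n :: nat and T :: "nat trm set" and I :: "(nat, 'k::field) mpoly set"
  assumes fc: "finite_codim {..<n} T I"
begin

interpretation finite_codim "{..<n}" T I by (rule fc)

lemma primary_component:
  assumes "primary_decomposition (P_ring n) I QS" "Q \<in> QS"
  shows "is_ideal {..<n} Q" "I \<subseteq> Q" "maximalideal (radical_of (P_ring n) Q) (P_ring n)"
    "\<And>a b. a \<in> polys {..<n} \<Longrightarrow> b \<in> polys {..<n} \<Longrightarrow> a * b \<in> Q \<Longrightarrow> a \<in> Q \<or> b \<in> radical_of (P_ring n) Q"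
    "Q \<noteq> polys {..<n}"
  using assms by (auto simp: primary_decomposition_def primary_ideal_def ideal_iff)

lemma radical_eq_colon:
  assumes QS: "primary_decomposition (P_ring n) I QS" "Q \<in> QS" and f: "f \<in> polys {..<n}"
    and M: "maximalideal (colon {..<n} Q f) (P_ring n)"
  shows "radical_of (P_ring n) Q = colon {..<n} Q f"
proof -
  note Q = primary_component[OF QS]
  have "radical_of (P_ring n) Q \<subseteq> colon {..<n} Q f"
    using prime_power_mem[OF maximalideal_prime[OF M]] colon_superset[OF Q(1) f]
    by (auto simp: radical_of_poly_ring)
  then show ?thesis using Q(3) M by (auto simp: maximalideal_iff)
qed

text \<open>With \<open>M = (Q : f)\<close>, multiplication by \<open>f\<close> is an isomorphism from \<open>P/M\<close> onto \<open>(Q + (f))/Q\<close>. Thus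
  if a set \<open>S\<close> of terms is a basis of the former, its multiples by \<open>f\<close> are a basis of the latter, and
  both spaces have the dimension that the definition of minimal divisors asks for.\<close>

lemma principal_minimal_divisor:
  assumes QS: "primary_decomposition (P_ring n) I QS" "Q \<in> QS" and f: "f \<in> polys {..<n}" "f \<notin> Q"
    and M: "maximalideal (colon {..<n} Q f) (P_ring n)"
  shows "ideal_plus {..<n} Q f \<inter> \<Inter>(QS - {Q}) \<in> minimal_divisors n QS Q"
proof -
  note Q = primary_component[OF QS]
  let ?M = "radical_of (P_ring n) Q"
  let ?Q' = "ideal_plus {..<n} Q f"
  have eqM: "?M = colon {..<n} Q f" by (rule radical_eq_colon[OF QS f(1) M])
  have idM: "is_ideal {..<n} ?M" and mM: "\<And>J. is_ideal {..<n} J \<Longrightarrow> ?M \<subseteq> J \<Longrightarrow> J = ?M \<or> J = polys {..<n}"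
    using Q(3) by (auto simp: maximalideal_iff)
  have QM: "Q \<subseteq> ?M" unfolding eqM by (rule colon_superset[OF Q(1) f(1)])
  have idQ': "is_ideal {..<n} ?Q'" by (rule ideal_plus_ideal[OF Q(1) f(1)])
  have fQ': "f \<in> ?Q'" by (rule ideal_plus_self[OF Q(1)])
  have QQ': "Q \<subset> ?Q'" using ideal_plus_superset[of Q "{..<n}" f] fQ' f(2) by auto
  have shape: "if Q = ?M then ?Q' = carrier (P_ring n) else ?Q' \<subseteq> ?M"
  proof (cases "Q = ?M")
    case True
    then have "?Q' = polys {..<n}" using mM[OF idQ'] QQ' by auto
    then show ?thesis using True by simp
  next
    case False
    have "f \<in> ?M"
    proof (rule ccontr)
      assume nf: "f \<notin> ?M"
      have "m \<in> Q" if "m \<in> ?M" for m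
        using Q(4)[of m f] that nf f(1) unfolding eqM by (auto simp: colon_def)
      then show False using False QM by blast
    qed
    then have "?Q' \<subseteq> ?M"
      using QM is_ideal_mult[OF idM] is_ideal_add[OF idM] by (auto simp: ideal_plus_def)
    then show ?thesis using False by simp
  qed
  obtain S where S: "S \<subseteq> T" "indep_mod ?M S" "card S = codim ?M" using codim_attained by blast
  have finS: "finite S" using S(1) finite_T finite_subset by blast
  then obtain us where us: "set us = S" "distinct us" using finite_distinct_list by blast
  have usX: "set us \<subseteq> terms {..<n}" using us(1) S(1) terms_T by blast
  have IM: "I \<subseteq> ?M" using Q(2) QM by blast
  have span: "polys {..<n} \<subseteq> span_mod ?M S" by (rule max_indep_spans[OF idM IM S(1,2)]) (simp add: S(3))
  interpret RM: ring "P_ring n Quot ?M" by (rule Quot_ring[OF idM])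
  interpret RQ: ring "P_ring n Quot Q" by (rule Quot_ring[OF Q(1)])
  have "RM.independent (scalars n ?M) (map (\<lambda>t. coset n ?M (mon t * 1)) us)"
    using independent_cosets[OF idM polys_one usX] us S(2) idM by simp
  moreover have "RM.Span (scalars n ?M) (map (\<lambda>t. coset n ?M (mon t * 1)) us) = carrier (P_ring n Quot ?M)"
  proof -
    have "coset n ?M p \<in> coset n ?M ` {p * 1 | p. Poly_Mapping.keys p \<subseteq> S}" if p: "p \<in> polys {..<n}" for p
    proof -
      obtain q where "Poly_Mapping.keys q \<subseteq> S" "p - q \<in> ?M" using span p by (auto simp: span_mod_def)
      then show ?thesis using coset_eq_iff[OF idM, of p q] by auto
    qed
    moreover have "p \<in> polys {..<n}" if "Poly_Mapping.keys p \<subseteq> S" for p :: "(nat, 'k) mpoly"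
      using keys_subset_polys[OF that] usX us(1) by simp
    ultimately show ?thesis unfolding Span_cosets[OF idM polys_one usX] Quot_carrier us(1) by auto
  qed
  ultimately have dM: "RM.dimension (length us) (scalars n ?M) (carrier (P_ring n Quot ?M))"
    using RM.dimension_independent by force
  have "RQ.independent (scalars n Q) (map (\<lambda>t. coset n Q (mon t * f)) us)"
    using independent_cosets[OF Q(1) f(1) usX] us S(2) eqM by simp
  moreover have "RQ.Span (scalars n Q) (map (\<lambda>t. coset n Q (mon t * f)) us) = residue_classes n Q ?Q'"
  proof -
    have "coset n Q x \<in> coset n Q ` {p * f | p. Poly_Mapping.keys p \<subseteq> S}" if x: "x \<in> ?Q'" for x
    proof -
      obtain b p where b: "b \<in> Q" "p \<in> polys {..<n}" "x = b + p * f" using x by (auto simp: ideal_plus_def)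
      obtain q where q: "Poly_Mapping.keys q \<subseteq> S" "p - q \<in> ?M" using span b(2) by (auto simp: span_mod_def)
      have "(p - q) * f \<in> Q" using q(2) unfolding eqM by (simp add: colon_def)
      then have "b + (p - q) * f \<in> Q" using is_ideal_add[OF Q(1) b(1)] by blast
      moreover have "x - q * f = b + (p - q) * f" by (simp add: b(3) algebra_simps)
      ultimately have "coset n Q x = coset n Q (q * f)" using coset_eq_iff[OF Q(1)] by simp
      then show ?thesis using q(1) by blast
    qed
    moreover have "p * f \<in> ?Q'" if "Poly_Mapping.keys p \<subseteq> S" for p
      using is_ideal_mult[OF idQ' keys_subset_polys[OF that] fQ'] usX us(1) by simp
    ultimately show ?thesis
      unfolding Span_cosets[OF Q(1) f(1) usX] residue_classes_def us(1) by auto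
  qed
  ultimately have dQ: "RQ.dimension (length us) (scalars n Q) (residue_classes n Q ?Q')"
    using RQ.dimension_independent by force
  show ?thesis
    unfolding minimal_divisors_def Let_def ideal_iff
    using idQ' QQ' shape dQ dM by blast
qed

text \<open>The minimum in the definition of the separator degree is meaningful only because of this:
  an element of \<open>P\<close> with maximal annihilator modulo \<open>Q\<close> generates a minimal divisor.\<close>

lemma minimal_divisors_nonempty:
  assumes QS: "primary_decomposition (P_ring n) I QS" "Q \<in> QS"
  shows "minimal_divisors n QS Q \<noteq> {}"
proof -
  note Q = primary_component[OF QS]
  have "\<not> polys {..<n} \<subseteq> Q" using Q(1,5) by (auto simp: is_ideal_def)
  then obtain f where "f \<in> polys {..<n} - Q" "maximalideal (colon {..<n} Q f) (P_ring n)"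
    using ex_associated_prime[OF Q(1,2) is_ideal_polys] by blast
  then show ?thesis using principal_minimal_divisor[OF QS] by blast
qed

text \<open>The inclusion of \<open>I\<close> is strict: multiply an element of \<open>Q' - Q\<close> by an element \<open>g\<close> of the other
  components that avoids the radical of \<open>Q\<close>; as \<open>Q\<close> is primary, the product stays outside \<open>Q\<close>.\<close>

lemma minimal_divisor_ideal:
  assumes QS: "primary_decomposition (P_ring n) I QS" "Q \<in> QS" and J: "J \<in> minimal_divisors n QS Q"
  shows "is_ideal {..<n} J" "I \<subset> J"
proof -
  note Q = primary_component[OF QS]
  let ?M = "radical_of (P_ring n) Q"
  obtain Q' where Q': "is_ideal {..<n} Q'" "Q \<subset> Q'" "J = Q' \<inter> \<Inter>(QS - {Q})"
    using J by (auto simp: minimal_divisors_def Let_def ideal_iff)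
  have comp: "is_ideal {..<n} A" if "A \<in> QS" for A using primary_component(1)[OF QS(1) that] .
  show "is_ideal {..<n} J"
    unfolding Q'(3) using Q'(1) comp by (auto simp: is_ideal_def)
  have I: "I = polys {..<n} \<inter> \<Inter>QS" using QS(1) by (simp add: primary_decomposition_def)
  have "\<not> A \<subseteq> ?M" if A: "A \<in> QS - {Q}" for A
  proof
    assume "A \<subseteq> ?M"
    have "radical_of (P_ring n) A \<subseteq> ?M"
    proof
      fix a assume "a \<in> radical_of (P_ring n) A"
      then obtain k where "a \<in> polys {..<n}" "a ^ k \<in> A" unfolding radical_of_poly_ring by blast
      then show "a \<in> ?M"
        using prime_power_mem[OF maximalideal_prime[OF Q(3)]] \<open>A \<subseteq> ?M\<close> by blast
    qed
    then have "radical_of (P_ring n) A = ?M"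
      using maximalideal_subset_eq[OF primary_component(3)[OF QS(1)] Q(3)] A by blast
    moreover have "inj_on (radical_of (P_ring n)) QS"
      using QS(1) by (simp add: primary_decomposition_def)
    ultimately show False using A QS(2) by (auto dest: inj_onD)
  qed
  moreover have "finite (QS - {Q})" using QS(1) by (simp add: primary_decomposition_def)
  ultimately have "\<exists>x\<in>polys {..<n} \<inter> \<Inter>(QS - {Q}). x \<notin> ?M"
    using comp is_ideal_subset[OF comp]
    by (intro prime_avoid_Inter[OF maximalideal_prime[OF Q(3)]]) auto
  then obtain g where g: "g \<in> polys {..<n} \<inter> \<Inter>(QS - {Q})" "g \<notin> ?M" by blast
  obtain h where h: "h \<in> Q'" "h \<notin> Q" using Q'(2) by blast
  have hX: "h \<in> polys {..<n}" using is_ideal_subset[OF Q'(1) h(1)] .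
  have "h * g \<notin> Q" using Q(4)[of h g] g h hX by blast
  moreover have "h * g \<in> J"
    unfolding Q'(3) using g(1) h hX is_ideal_mult2[OF Q'(1), of g h] is_ideal_mult[OF comp] by auto
  moreover have "I \<subseteq> J" unfolding Q'(3) using I Q'(2) QS(2) by blast
  ultimately show "I \<subset> J" using Q(2) by blast
qed

end

subsection \<open>The degree filtration\<close>

locale df_quotient =
  fixes n :: nat and T :: "nat trm set" and I :: "(nat, 'k::field) mpoly set" and d :: nat
  assumes ideal_I: "is_ideal {..<n} I" and finite_T: "finite T" and terms_T: "T \<subseteq> terms {..<n}"
    and basis: "df_basis n T I" and d_max: "\<And>t. t \<in> T \<Longrightarrow> term_deg t \<le> d"
    and d_attained: "\<exists>t\<in>T. term_deg t = d"
begin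

text \<open>By the basis property, this is the preimage in \<open>P\<close> of \<open>F\<^sub>iR\<close> (\<open>deg_filtration_iff\<close>). Negative \<open>i\<close>
  are allowed, with \<open>span_le i = I\<close>, so that \<open>i = d - 1\<close> is no exception for \<open>d = 0\<close>.\<close>

definition span_le :: "int \<Rightarrow> (nat, 'k) mpoly set" where
  "span_le i = span_mod I {t \<in> T. int (term_deg t) \<le> i}"

lemma span_le_mono: "i \<le> j \<Longrightarrow> span_le i \<subseteq> span_le j"
  unfolding span_le_def by (rule span_mod_mono) auto

lemma span_le_neg: "i < 0 \<Longrightarrow> span_le i = I"
  by (auto simp: span_le_def span_mod_def)

lemma span_le_polys: "span_le i \<subseteq> polys {..<n}"
  unfolding span_le_def using terms_T by (intro span_mod_polys[OF ideal_I]) auto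

lemma low_polys_span: "low_polys n i \<subseteq> span_le i"
proof (cases "i < 0")
  case True
  then have "Poly_Mapping.keys p = {}" if "p \<in> low_polys n i" for p :: "(nat, 'k) mpoly"
    using that by (fastforce simp: low_polys_def)
  then have "low_polys n i \<subseteq> {0 :: (nat, 'k) mpoly}" by auto
  then show ?thesis using True is_ideal_zero[OF ideal_I] by (auto simp: span_le_neg)
next
  case False
  then obtain k where "i = int k" by (metis not_le nonneg_int_cases linorder_not_less)
  then show ?thesis using basis by (auto simp: df_basis_def span_le_def)
qed

lemma span_le_d: "span_le (int d) = polys {..<n}"
proof -
  have "p \<in> span_le (int d)" if p: "p \<in> polys {..<n}" for p
  proof -
    obtain k where k: "\<forall>t\<in>Poly_Mapping.keys p. term_deg t \<le> k"
      using finite_nat_set_iff_bounded_le[of "term_deg ` Poly_Mapping.keys p"] by auto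
    then have "p \<in> low_polys n (int k)" using p by (auto simp: low_polys_def)
    then have "p \<in> span_le (int k)" using low_polys_span by blast
    then show ?thesis
      unfolding span_le_def using span_mod_mono[of I I "{t \<in> T. int (term_deg t) \<le> int k}" "{t \<in> T. int (term_deg t) \<le> int d}"] d_max
      by auto
  qed
  then show ?thesis using span_le_polys by blast
qed

lemma span_le_d_ge: "int d \<le> i \<Longrightarrow> span_le i = polys {..<n}"
  using span_le_mono[of "int d" i] span_le_d span_le_polys[of i] by blast

lemma fc: "finite_codim {..<n} T I"
proof
  have "span_le (int d) \<subseteq> span_mod I T" unfolding span_le_def by (rule span_mod_mono) auto
  then show "polys {..<n} \<subseteq> span_mod I T" unfolding span_le_d .
qed (use ideal_I finite_T terms_T in auto)

lemma deg_filtration_iff: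
  assumes "p \<in> polys {..<n}"
  shows "coset n I p \<in> deg_filtration n I i \<longleftrightarrow> p \<in> span_le i"
proof
  assume "coset n I p \<in> deg_filtration n I i"
  then obtain q where "q \<in> low_polys n i" "coset n I p = coset n I q"
    by (auto simp: deg_filtration_def residue_classes_def low_polys_def)
  then have "q \<in> span_le i" "p - q \<in> I"
    using low_polys_span coset_eq_iff[OF ideal_I] by auto
  then show "p \<in> span_le i" unfolding span_le_def using span_mod_cong[OF ideal_I] by blast
next
  assume "p \<in> span_le i"
  then obtain q where "Poly_Mapping.keys q \<subseteq> {t \<in> T. int (term_deg t) \<le> i}" "p - q \<in> I"
    by (auto simp: span_le_def span_mod_def)
  then have "q \<in> low_polys n i" "coset n I p = coset n I q"
    using coset_eq_iff[OF ideal_I] terms_T by (auto simp: low_polys_def polys_def)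
  then show "coset n I p \<in> deg_filtration n I i"
    by (auto simp: deg_filtration_def residue_classes_def low_polys_def)
qed

lemma reg_index_eq: "reg_index n I = int d"
  unfolding reg_index_def
proof (rule Least_equality)
  have "deg_filtration n I j = carrier (P_ring n Quot I)" if "int d \<le> j" for j
  proof -
    have "deg_filtration n I j \<subseteq> carrier (P_ring n Quot I)"
      unfolding Quot_carrier by (auto simp: deg_filtration_def residue_classes_def)
    moreover have "carrier (P_ring n Quot I) \<subseteq> deg_filtration n I j"
      unfolding Quot_carrier using deg_filtration_iff span_le_d_ge[OF that] by auto
    ultimately show ?thesis by blast
  qed
  then show "\<forall>j\<ge>int d. deg_filtration n I j = carrier (P_ring n Quot I)" by blast
next
  fix i assume i: "\<forall>j\<ge>i. deg_filtration n I j = carrier (P_ring n Quot I)"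
  obtain t where t: "t \<in> T" "term_deg t = d" using d_attained by blast
  then have mt: "mon t \<in> polys {..<n}" using terms_T by auto
  have "coset n I (mon t) \<in> deg_filtration n I i" using i mt unfolding Quot_carrier by blast
  then have "mon t \<in> span_le i" using deg_filtration_iff mt by blast
  moreover have "mon t \<notin> span_mod I (T - {t})"
    by (rule indep_mod_remove[OF ideal_I]) (use basis t in \<open>auto simp: df_basis_def insert_absorb\<close>)
  moreover have "span_le i \<subseteq> span_mod I (T - {t})" if "i < int d"
    unfolding span_le_def by (rule span_mod_mono) (use that t in auto)
  ultimately show "int d \<le> i" by fastforce
qed

lemma filt_ord_le_iff:
  assumes f: "f \<in> polys {..<n}" "f \<notin> I"
  shows "filt_ord n I (coset n I f) \<le> i \<longleftrightarrow> f \<in> span_le i"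
    and "0 \<le> filt_ord n I (coset n I f)"
proof -
  let ?k = "LEAST k::nat. f \<in> span_le (int k)"
  have k: "f \<in> span_le (int ?k)" by (rule LeastI[of _ d]) (use f span_le_d in auto)
  have *: "int ?k \<le> j" if "f \<in> span_le j" for j
  proof -
    have "0 \<le> j" using that f(2) span_le_neg[of j] by force
    then show ?thesis using Least_le[of "\<lambda>k. f \<in> span_le (int k)" "nat j"] that by simp
  qed
  have "filt_ord n I (coset n I f) = int ?k"
    unfolding filt_ord_def deg_filtration_iff[OF f(1)] by (rule Least_equality) (use k * in auto)
  then show "filt_ord n I (coset n I f) \<le> i \<longleftrightarrow> f \<in> span_le i" "0 \<le> filt_ord n I (coset n I f)"
    using k * span_le_mono[of "int ?k" i] by auto
qed

lemma divisor_reg_index: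
  assumes J: "is_ideal {..<n} J" "I \<subset> J"
  shows "divisor_reg_index n I J \<in> {0..int d}"
    and "divisor_reg_index n I J < int d \<longleftrightarrow> J \<subseteq> span_le (int d - 1)"
proof -
  have JX: "f \<in> polys {..<n}" if "f \<in> J" for f using is_ideal_subset[OF J(1) that] .
  have "residue_classes n I J - {\<zero>\<^bsub>P_ring n Quot I\<^esub>} = coset n I ` (J - I)"
    unfolding Quot_zero[OF ideal_I] residue_classes_def
    using coset_eq_iff[OF ideal_I, of _ "0"] by auto
  then have eq: "divisor_reg_index n I J = Max ((\<lambda>f. filt_ord n I (coset n I f)) ` (J - I))"
    by (simp add: divisor_reg_index_def image_image)
  let ?A = "(\<lambda>f. filt_ord n I (coset n I f)) ` (J - I)"
  have sub: "?A \<subseteq> {0..int d}"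
    using filt_ord_le_iff(1)[of _ "int d"] filt_ord_le_iff(2) JX span_le_d by auto
  then have fin: "finite ?A" by (rule finite_subset) simp
  have ne: "?A \<noteq> {}" using J(2) by auto
  show "divisor_reg_index n I J \<in> {0..int d}" unfolding eq using Max_in[OF fin ne] sub by blast
  have "divisor_reg_index n I J < int d \<longleftrightarrow> (\<forall>f\<in>J - I. filt_ord n I (coset n I f) \<le> int d - 1)"
    unfolding eq using Max_less_iff[OF fin ne] by auto
  also have "\<dots> \<longleftrightarrow> (\<forall>f\<in>J - I. f \<in> span_le (int d - 1))"
    by (intro ball_cong refl filt_ord_le_iff(1)) (use JX in auto)
  also have "\<dots> \<longleftrightarrow> J \<subseteq> span_le (int d - 1)"
    using span_mod_ideal[OF ideal_I] unfolding span_le_def by blast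
  finally show "divisor_reg_index n I J < int d \<longleftrightarrow> J \<subseteq> span_le (int d - 1)" .
qed

lemma sepdeg:
  assumes QS: "primary_decomposition (P_ring n) I QS" "Q \<in> QS"
  shows "sepdeg n I QS Q = int d \<longleftrightarrow> (\<forall>J\<in>minimal_divisors n QS Q. \<not> J \<subseteq> span_le (int d - 1))"
proof -
  let ?A = "divisor_reg_index n I ` minimal_divisors n QS Q"
  note md = minimal_divisor_ideal[OF fc QS]
  have sub: "?A \<subseteq> {0..int d}" using divisor_reg_index(1)[OF md] by blast
  then have fin: "finite ?A" by (rule finite_subset) simp
  have ne: "?A \<noteq> {}" using minimal_divisors_nonempty[OF fc QS] by simp
  have "sepdeg n I QS Q \<le> int d" unfolding sepdeg_def using Min_in[OF fin ne] sub by auto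
  then have "sepdeg n I QS Q = int d \<longleftrightarrow> (\<forall>a\<in>?A. \<not> a < int d)"
    unfolding sepdeg_def using Min_ge_iff[OF fin ne, of "int d"] by (auto simp: not_less)
  also have "\<dots> \<longleftrightarrow> (\<forall>J\<in>minimal_divisors n QS Q. \<not> J \<subseteq> span_le (int d - 1))"
    using divisor_reg_index(2)[OF md] by blast
  finally show ?thesis .
qed

text \<open>The right-hand side says that \<open>F\<^sub>d\<^sub>-\<^sub>1R\<close> contains a nonzero principal ideal. A minimal divisor with
  small separator degree is an ideal inside \<open>F\<^sub>d\<^sub>-\<^sub>1R\<close>. Conversely, the elements whose multiples all lie in
  \<open>F\<^sub>d\<^sub>-\<^sub>1R\<close> form an ideal \<open>A\<close>, and an element \<open>f\<close> of \<open>A\<close> with maximal annihilator generates a minimal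
  divisor inside \<open>A\<close> in every primary decomposition.\<close>

theorem not_cayley_bacharach_iff:
  "\<not> cayley_bacharach n I \<longleftrightarrow>
    (\<exists>f\<in>polys {..<n} - I. \<forall>p\<in>polys {..<n}. p * f \<in> span_le (int d - 1))"
proof
  assume ncb: "\<not> cayley_bacharach n I"
  obtain QS where QS: "primary_decomposition (P_ring n) I QS"
    using finite_codim.ex_primary_decomposition[OF fc] by blast
  then obtain Q where Q: "Q \<in> QS" "sepdeg n I QS Q \<noteq> int d"
    using ncb by (auto simp: cayley_bacharach_def reg_index_eq)
  then obtain J where J: "J \<in> minimal_divisors n QS Q" "J \<subseteq> span_le (int d - 1)"
    using sepdeg[OF QS] by blast
  note idJ = minimal_divisor_ideal[OF fc QS Q(1) J(1)]
  obtain f where "f \<in> J" "f \<notin> I" using idJ(2) by blast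
  then show "\<exists>f\<in>polys {..<n} - I. \<forall>p\<in>polys {..<n}. p * f \<in> span_le (int d - 1)"
    using is_ideal_mult[OF idJ(1)] is_ideal_subset[OF idJ(1)] J(2) by blast
next
  assume "\<exists>f\<in>polys {..<n} - I. \<forall>p\<in>polys {..<n}. p * f \<in> span_le (int d - 1)"
  then obtain f0 where f0: "f0 \<in> polys {..<n}" "f0 \<notin> I" "\<And>p. p \<in> polys {..<n} \<Longrightarrow> p * f0 \<in> span_le (int d - 1)"
    by blast
  let ?A = "{a \<in> polys {..<n}. \<forall>p\<in>polys {..<n}. p * a \<in> span_le (int d - 1)}"
  have A: "is_ideal {..<n} ?A"
  proof (rule is_idealI)
    show "0 \<in> ?A" using span_mod_ideal[OF ideal_I is_ideal_zero[OF ideal_I]] by (simp add: span_le_def)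
    show "a + b \<in> ?A" if "a \<in> ?A" "b \<in> ?A" for a b
      using that span_mod_add[OF ideal_I] by (auto simp: distrib_left span_le_def)
    show "q * a \<in> ?A" if "q \<in> polys {..<n}" "a \<in> ?A" for q a
      using that polys_mult[of _ "{..<n}" q] by (auto simp: mult.assoc[symmetric])
  qed auto
  have "\<not> ?A \<subseteq> I" using f0 by blast
  then obtain f where f: "f \<in> ?A" "f \<notin> I" and M: "maximalideal (colon {..<n} I f) (P_ring n)"
    using finite_codim.ex_associated_prime[OF fc ideal_I order_refl A] by blast
  have fX: "f \<in> polys {..<n}" using f by simp
  have "\<exists>Q\<in>QS. sepdeg n I QS Q \<noteq> int d" if QS: "primary_decomposition (P_ring n) I QS" for QS
  proof -
    have I: "I = polys {..<n} \<inter> \<Inter>QS" using QS by (simp add: primary_decomposition_def)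
    \<comment> \<open>the annihilator of \<open>f\<close> can only grow from \<open>I\<close> to \<open>B\<close>, and it is already maximal\<close>
    have eq: "colon {..<n} B f = colon {..<n} I f" if B: "B \<in> QS" "f \<notin> B" for B
    proof -
      have "colon {..<n} I f \<subseteq> colon {..<n} B f"
        using primary_component(2)[OF fc QS B(1)] by (auto simp: colon_def)
      moreover have "1 \<notin> colon {..<n} B f" using B(2) by (simp add: colon_def)
      ultimately show ?thesis
        using M colon_ideal[OF primary_component(1)[OF fc QS B(1)], of f] by (auto simp: maximalideal_iff)
    qed
    have rad: "radical_of (P_ring n) B = colon {..<n} I f" if B: "B \<in> QS" "f \<notin> B" for B
      using radical_eq_colon[OF fc QS B(1) fX] eq[OF B] M by simp
    obtain Q where Q: "Q \<in> QS" "f \<notin> Q" using f(2) I fX by blast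
    \<comment> \<open>two components that miss \<open>f\<close> would have the same radical\<close>
    have others: "f \<in> B" if "B \<in> QS" "B \<noteq> Q" for B
    proof (rule ccontr)
      assume "f \<notin> B"
      then have "radical_of (P_ring n) B = radical_of (P_ring n) Q" using rad that(1) Q by simp
      moreover have "inj_on (radical_of (P_ring n)) QS" using QS by (simp add: primary_decomposition_def)
      ultimately show False using that Q(1) by (auto dest: inj_onD)
    qed
    let ?J = "ideal_plus {..<n} Q f \<inter> \<Inter>(QS - {Q})"
    have "?J \<in> minimal_divisors n QS Q"
      using principal_minimal_divisor[OF fc QS Q(1) fX Q(2)] eq[OF Q] M by simp
    moreover have "?J \<subseteq> span_le (int d - 1)"
    proof
      fix x assume x: "x \<in> ?J"
      then obtain b p where b: "b \<in> Q" "p \<in> polys {..<n}" "x = b + p * f" by (auto simp: ideal_plus_def)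
      have "b \<in> B" if B: "B \<in> QS" "B \<noteq> Q" for B
      proof -
        note idB = primary_component(1)[OF fc QS B(1)]
        have "x - p * f \<in> B" using is_ideal_diff[OF idB] is_ideal_mult[OF idB b(2) others[OF B]] x B by blast
        then show ?thesis using b(3) by simp
      qed
      then have "b \<in> I" using b(1) I is_ideal_subset[OF primary_component(1)[OF fc QS Q(1)]] by blast
      then have "b \<in> span_le (int d - 1)" unfolding span_le_def by (rule span_mod_ideal[OF ideal_I])
      moreover have "p * f \<in> span_le (int d - 1)" using f(1) b(2) by blast
      ultimately show "x \<in> span_le (int d - 1)"
        unfolding b(3) span_le_def by (rule span_mod_add[OF ideal_I])
    qed
    ultimately show ?thesis using sepdeg[OF QS Q(1)] Q(1) by blast
  qed
  then show "\<not> cayley_bacharach n I" by (auto simp: cayley_bacharach_def reg_index_eq)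
qed

lemma zero_dim: "zero_dim_ideal n I"
proof -
  have "mon t \<notin> I" if "t \<in> T" for t
  proof
    assume "mon t \<in> I"
    then have "(mon t :: (nat, 'k) mpoly) = 0" using basis that by (simp add: df_basis_def indep_mod_def)
    then have "Poly_Mapping.keys (mon t :: (nat, 'k) mpoly) = {}" by (simp only: keys_zero)
    then show False by simp
  qed
  then have "I \<noteq> polys {..<n}" using d_attained terms_T by force
  then show ?thesis
    using finite_codim.prime_imp_maximal[OF fc] ideal_I by (simp add: zero_dim_ideal_def ideal_iff)
qed

end



section \<open>Terms evaluated at commuting matrices\<close>

lemma times_mat_entry:
  "A \<in> carrier_mat m m \<Longrightarrow> B \<in> carrier_mat m m \<Longrightarrow> i < m \<Longrightarrow> j < m \<Longrightarrow>
   (A * B) $$ (i, j) = (\<Sum>k<m. A $$ (i, k) * B $$ (k, j))"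
  by (auto simp: scalar_prod_def atLeast0LessThan intro!: sum.cong)

lemma pow_mat_add:
  assumes A: "A \<in> carrier_mat m m"
  shows "A ^\<^sub>m (k + l) = A ^\<^sub>m k * A ^\<^sub>m l"
proof (induction l)
  case 0
  then show ?case using right_mult_one_mat[OF pow_carrier_mat[OF A, of k]] A by simp
next
  case (Suc l)
  then show ?case using assoc_mult_mat[OF pow_carrier_mat[OF A] pow_carrier_mat[OF A] A] by simp
qed

lemma pow_mat_commute:
  assumes A: "A \<in> carrier_mat m m" and B: "B \<in> carrier_mat m m" and AB: "A * B = B * A"
  shows "A ^\<^sub>m k * B = B * A ^\<^sub>m k"
proof (induction k)
  case 0
  then show ?case using left_mult_one_mat[OF B] right_mult_one_mat[OF B] A by simp
next
  case (Suc k)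
  note P = pow_carrier_mat[OF A, of k]
  have "A ^\<^sub>m Suc k * B = A ^\<^sub>m k * (B * A)" using assoc_mult_mat[OF P A B] AB by simp
  also have "\<dots> = (A ^\<^sub>m k * B) * A" by (rule assoc_mult_mat[OF P B A, symmetric])
  also have "\<dots> = B * A ^\<^sub>m Suc k" using Suc.IH assoc_mult_mat[OF B P A] by simp
  finally show ?case .
qed

text \<open>The product that defines \<open>term_at_mats\<close>, over an arbitrary list of indeterminates to allow
  induction.\<close>

definition powers_prod :: "nat \<Rightarrow> (nat \<Rightarrow> 'a::comm_ring_1 mat) \<Rightarrow> nat list \<Rightarrow> (nat \<Rightarrow> nat) \<Rightarrow> 'a mat" where
  "powers_prod m A xs e = foldr (\<lambda>r N. (A r ^\<^sub>m e r) * N) xs (1\<^sub>m m)"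

lemma term_at_mats_powers_prod:
  "term_at_mats n m A t = powers_prod m A [0..<n] (Poly_Mapping.lookup t)"
  by (simp add: term_at_mats_def powers_prod_def)

lemma powers_prod_simps:
  "powers_prod m A [] e = 1\<^sub>m m"
  "powers_prod m A (r # xs) e = (A r ^\<^sub>m e r) * powers_prod m A xs e"
  by (simp_all add: powers_prod_def)

lemma powers_prod_carrier:
  "\<forall>r\<in>set xs. A r \<in> carrier_mat m m \<Longrightarrow> powers_prod m A xs e \<in> carrier_mat m m"
  by (induction xs) (auto simp: powers_prod_simps intro!: mult_carrier_mat)

lemma powers_prod_commute:
  assumes B: "B \<in> carrier_mat m m"
  shows "\<forall>r\<in>set xs. A r \<in> carrier_mat m m \<and> A r * B = B * A r \<Longrightarrow>
    powers_prod m A xs e * B = B * powers_prod m A xs e"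
proof (induction xs)
  case Nil
  then show ?case using B by (simp add: powers_prod_simps)
next
  case (Cons r xs)
  let ?P = "A r ^\<^sub>m e r" and ?R = "powers_prod m A xs e"
  have A: "A r \<in> carrier_mat m m" "A r * B = B * A r" using Cons.prems by auto
  have P: "?P \<in> carrier_mat m m" using A by simp
  have R: "?R \<in> carrier_mat m m" using Cons.prems by (intro powers_prod_carrier) auto
  have "?P * ?R * B = ?P * (B * ?R)" using Cons assoc_mult_mat[OF P R B] by simp
  also have "\<dots> = (B * ?P) * ?R"
    using assoc_mult_mat[OF P B R] pow_mat_commute[OF A(1) B A(2)] by simp
  also have "\<dots> = B * (?P * ?R)" by (rule assoc_mult_mat[OF B P R])
  finally show ?case by (simp add: powers_prod_simps)
qed

lemma powers_prod_add:
  "\<forall>r\<in>set xs. A r \<in> carrier_mat m m \<and> (\<forall>s\<in>set xs. A r * A s = A s * A r) \<Longrightarrow>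
   powers_prod m A xs (\<lambda>r. e r + f r) = powers_prod m A xs e * powers_prod m A xs f"
proof (induction xs)
  case Nil
  then show ?case by (simp add: powers_prod_simps)
next
  case (Cons r xs)
  let ?E = "A r ^\<^sub>m e r" and ?F = "A r ^\<^sub>m f r"
  let ?R = "powers_prod m A xs e" and ?S = "powers_prod m A xs f"
  have A: "A r \<in> carrier_mat m m" using Cons.prems by auto
  have E: "?E \<in> carrier_mat m m" and F: "?F \<in> carrier_mat m m" using A by simp_all
  have R: "?R \<in> carrier_mat m m" and S: "?S \<in> carrier_mat m m"
    using Cons.prems by (auto intro!: powers_prod_carrier)
  have "?R * A r = A r * ?R" by (rule powers_prod_commute[OF A]) (use Cons.prems in \<open>meson list.set_intros\<close>)
  then have FR: "?F * ?R = ?R * ?F" by (intro pow_mat_commute[OF A R]) simp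
  have IH: "powers_prod m A xs (\<lambda>r. e r + f r) = ?R * ?S"
    by (rule Cons.IH) (use Cons.prems in \<open>meson list.set_intros\<close>)
  have RS: "?R * ?S \<in> carrier_mat m m" and FS: "?F * ?S \<in> carrier_mat m m"
    using R S F by (auto intro: mult_carrier_mat)
  have "powers_prod m A (r # xs) (\<lambda>r. e r + f r) = (?E * ?F) * (?R * ?S)"
    unfolding powers_prod_simps pow_mat_add[OF A] IH ..
  also have "\<dots> = ?E * (?F * (?R * ?S))" by (rule assoc_mult_mat[OF E F RS])
  also have "?F * (?R * ?S) = (?F * ?R) * ?S" by (rule assoc_mult_mat[OF F R S, symmetric])
  also have "\<dots> = ?R * (?F * ?S)" unfolding FR by (rule assoc_mult_mat[OF R F S])
  also have "?E * \<dots> = (?E * ?R) * (?F * ?S)" by (rule assoc_mult_mat[OF E R FS, symmetric])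
  finally show ?case by (simp add: powers_prod_simps)
qed

lemma powers_prod_zero:
  "\<forall>r\<in>set xs. A r \<in> carrier_mat m m \<and> e r = 0 \<Longrightarrow> powers_prod m A xs e = 1\<^sub>m m"
  by (induction xs) (auto simp: powers_prod_simps)

lemma powers_prod_single:
  "\<forall>r\<in>set xs. A r \<in> carrier_mat m m \<Longrightarrow> distinct xs \<Longrightarrow> s \<in> set xs \<Longrightarrow>
   powers_prod m A xs (\<lambda>r. if r = s then 1 else 0) = A s"
proof (induction xs)
  case (Cons r xs)
  have A: "A s \<in> carrier_mat m m" "A r \<in> carrier_mat m m" using Cons.prems by auto
  show ?case
  proof (cases "r = s")
    case True
    then have "powers_prod m A xs (\<lambda>r. if r = s then 1 else 0) = 1\<^sub>m m"
      using Cons.prems by (intro powers_prod_zero) auto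
    then show ?thesis using True A by (simp add: powers_prod_simps)
  next
    case False
    then show ?thesis using Cons A left_mult_one_mat[OF A(1)] by (simp add: powers_prod_simps)
  qed
qed simp

context
  fixes n m :: nat and A :: "nat \<Rightarrow> 'a::comm_ring_1 mat"
  assumes A: "\<And>r. r < n \<Longrightarrow> A r \<in> carrier_mat m m"
begin

lemma term_at_mats_carrier: "term_at_mats n m A t \<in> carrier_mat m m"
  unfolding term_at_mats_powers_prod by (rule powers_prod_carrier) (simp add: A)

lemma term_at_mats_zero: "term_at_mats n m A 0 = 1\<^sub>m m"
  unfolding term_at_mats_powers_prod by (rule powers_prod_zero) (simp add: A)

lemma term_at_mats_x_term: "r < n \<Longrightarrow> term_at_mats n m A (x_term r) = A r"
proof -
  assume r: "r < n"
  have "Poly_Mapping.lookup (x_term r) = (\<lambda>s. if s = r then 1 else 0)"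
    by (auto simp: lookup_single when_def)
  then show ?thesis
    unfolding term_at_mats_powers_prod
    by (simp only:) (rule powers_prod_single, use r A in auto)
qed

text \<open>Through this multiplicativity the commutator relations of the border basis scheme make the space
  of coordinate vectors a module over \<open>P\<close>.\<close>

lemma term_at_mats_plus:
  assumes "\<And>r s. r < n \<Longrightarrow> s < n \<Longrightarrow> A r * A s = A s * A r"
  shows "term_at_mats n m A (s + t) = term_at_mats n m A s * term_at_mats n m A t"
  unfolding term_at_mats_powers_prod
  unfolding lookup_add[abs_def] by (rule powers_prod_add) (use A assms in \<open>auto simp del: index_mult_mat\<close>)

lemma term_at_mats_hom:
  assumes "comm_ring_hom h"
  shows "map_mat h (term_at_mats n m A t) = term_at_mats n m (\<lambda>r. map_mat h (A r)) t"
proof -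
  interpret comm_ring_hom h by (rule assms)
  have "map_mat h (powers_prod m A xs e) = powers_prod m (\<lambda>r. map_mat h (A r)) xs e"
    if "set xs \<subseteq> {..<n}" for xs e
    using that
  proof (induction xs)
    case Nil
    then show ?case by (simp add: powers_prod_simps mat_hom_one)
  next
    case (Cons r xs)
    then have "A r \<in> carrier_mat m m" "powers_prod m A xs e \<in> carrier_mat m m"
      using A by (auto intro!: powers_prod_carrier)
    then show ?case using Cons by (simp add: powers_prod_simps mat_hom_mult[of _ m m] mat_hom_pow[of _ m])
  qed
  then show ?thesis by (simp add: term_at_mats_powers_prod lessThan_atLeast0)
qed

end

definition poly_mat :: "'v set \<Rightarrow> nat \<Rightarrow> ('v, 'k::field) mpoly mat \<Rightarrow> bool" where
  "poly_mat X m A \<longleftrightarrow> A \<in> carrier_mat m m \<and> (\<forall>i<m. \<forall>j<m. A $$ (i, j) \<in> polys X)"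

lemma poly_mat_mult: "poly_mat X m A \<Longrightarrow> poly_mat X m B \<Longrightarrow> poly_mat X m (A * B)"
  by (auto simp: poly_mat_def times_mat_entry simp del: index_mult_mat(1) intro!: polys_sum polys_mult mult_carrier_mat)

lemma poly_mat_one: "poly_mat X m (1\<^sub>m m)"
  by (auto simp: poly_mat_def)

lemma poly_mat_pow: "poly_mat X m A \<Longrightarrow> poly_mat X m (A ^\<^sub>m k)"
  by (induction k) (auto simp: poly_mat_mult, auto simp: poly_mat_def)

lemma poly_mat_term:
  assumes "\<And>r. r < n \<Longrightarrow> poly_mat X m (A r)"
  shows "poly_mat X m (term_at_mats n m A t)"
proof -
  have "set xs \<subseteq> {..<n} \<Longrightarrow> poly_mat X m (powers_prod m A xs e)" for xs e
    by (induction xs) (auto simp: powers_prod_simps poly_mat_one intro!: poly_mat_mult poly_mat_pow assms)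
  then show ?thesis by (simp add: term_at_mats_powers_prod lessThan_atLeast0)
qed

lemma det_polys:
  assumes "\<And>i j. i < dim_row A \<Longrightarrow> j < dim_col A \<Longrightarrow> A $$ (i, j) \<in> polys X"
  shows "det A \<in> polys X"
proof (cases "dim_row A = dim_col A")
  case True
  have sg: "signof p \<in> polys X" for p :: "nat \<Rightarrow> nat" by (auto simp: sign_def)
  have ent: "A $$ (i, p i) \<in> polys X" if "p permutes {0..<dim_row A}" "i \<in> {0..<dim_row A}" for p i
    using that True permutes_in_image[OF that(1), of i] by (intro assms) auto
  show ?thesis unfolding det_def using True
    by (auto intro!: polys_sum polys_mult polys_prod sg ent)
next
  case False
  then show ?thesis by (auto simp: det_def)
qed

section \<open>Maximal minors and kernel vectors\<close>

lemma det_zero_iff: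
  fixes A :: "'a::field mat"
  assumes A: "A \<in> carrier_mat m m"
  shows "det A = 0 \<longleftrightarrow> (\<exists>v. (\<exists>i<m. v i \<noteq> 0) \<and> (\<forall>a<m. (\<Sum>i<m. A $$ (a, i) * v i) = 0))"
proof
  assume "det A = 0"
  then obtain v where v: "v \<in> carrier_vec m" "v \<noteq> 0\<^sub>v m" "A *\<^sub>v v = 0\<^sub>v m"
    using det_0_iff_vec_prod_zero_field[OF A] by blast
  have "\<exists>i<m. v $ i \<noteq> 0" using v(1,2) by (metis carrier_vecD eq_vecI index_zero_vec)
  moreover have "(\<Sum>i<m. A $$ (a, i) * v $ i) = 0" if "a < m" for a
  proof -
    have "(\<Sum>i<m. A $$ (a, i) * v $ i) = (A *\<^sub>v v) $ a"
      using that A v(1) by (auto simp: scalar_prod_def atLeast0LessThan intro!: sum.cong)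
    then show ?thesis using v(3) that by simp
  qed
  ultimately show "\<exists>v. (\<exists>i<m. v i \<noteq> 0) \<and> (\<forall>a<m. (\<Sum>i<m. A $$ (a, i) * v i) = 0)" by blast
next
  assume "\<exists>v. (\<exists>i<m. v i \<noteq> 0) \<and> (\<forall>a<m. (\<Sum>i<m. A $$ (a, i) * v i) = 0)"
  then obtain v where v: "\<exists>i<m. v i \<noteq> 0" "\<And>a. a < m \<Longrightarrow> (\<Sum>i<m. A $$ (a, i) * v i) = 0" by blast
  have "vec m v \<noteq> 0\<^sub>v m" using v(1) by (metis index_vec index_zero_vec(1))
  moreover have "A *\<^sub>v vec m v = 0\<^sub>v m"
    using A v(2) by (intro eq_vecI) (auto simp: scalar_prod_def atLeast0LessThan)
  ultimately show "det A = 0" using det_0_iff_vec_prod_zero_field[OF A] vec_carrier by blast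
qed

text \<open>Cramer's rule. Let \<open>r = q + 1\<close> be the least number such that all minors of order \<open>r\<close> in the first
  \<open>r\<close> columns vanish, and fix rows \<open>g 0, \<dots>, g (q - 1)\<close> with a nonzero minor in the first \<open>q\<close> columns.
  Appending any row \<open>b\<close> gives a vanishing determinant; its expansion along that row is a linear
  relation between the first \<open>r\<close> entries of row \<open>b\<close> whose coefficients, the cofactors \<open>v\<close>, do not
  depend on \<open>b\<close>. The last of them is the nonzero minor.\<close>

lemma kernel_of_vanishing_minors:
  fixes W :: "nat \<Rightarrow> nat \<Rightarrow> 'a::field"
  assumes minors: "\<And>g. (\<And>a. a < m \<Longrightarrow> g a < N) \<Longrightarrow> det (mat m m (\<lambda>(a, k). W (g a) k)) = 0"
  shows "\<exists>v. (\<exists>i<m. v i \<noteq> 0) \<and> (\<forall>a<N. (\<Sum>i<m. W a i * v i) = 0)"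
proof -
  define P where "P r \<longleftrightarrow> (\<forall>g. (\<forall>a<r. g a < N) \<longrightarrow> det (mat r r (\<lambda>(a, k). W (g a) k)) = 0)" for r
  define r where "r = (LEAST r. P r)"
  have Pm: "P m" using minors by (auto simp: P_def)
  then have Pr: "P r" and rm: "r \<le> m" unfolding r_def by (auto intro: LeastI Least_le)
  have "\<not> P 0" by (auto simp: P_def det_def)
  then obtain q where q: "r = Suc q" using Pr by (cases r) auto
  then have "\<not> P q" using not_less_Least[of q P] r_def by simp
  then obtain g where g: "\<And>a. a < q \<Longrightarrow> g a < N" "det (mat q q (\<lambda>(a, k). W (g a) k)) \<noteq> 0"
    unfolding P_def by blast
  \<comment> \<open>row \<open>q\<close> of \<open>C\<close> is arbitrary, as it is deleted in every cofactor used\<close>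
  define C where "C = mat r r (\<lambda>(a, k). if a < q then W (g a) k else 0)"
  define v where "v k = (if k < r then cofactor C q k else 0)" for k
  have "mat_delete C q q = mat q q (\<lambda>(a, k). W (g a) k)"
    by (rule eq_matI) (auto simp: C_def mat_delete_def q)
  then have "v q \<noteq> 0" using g(2) q by (simp add: v_def cofactor_def)
  moreover have "(\<Sum>i<m. W b i * v i) = 0" if b: "b < N" for b
  proof -
    let ?B = "mat r r (\<lambda>(a, k). W (if a < q then g a else b) k)"
    have "mat_delete ?B q k = mat_delete C q k" for k
      by (rule eq_matI) (auto simp: C_def mat_delete_def q)
    then have cof: "cofactor ?B q k = cofactor C q k" for k by (simp add: cofactor_def)
    have "0 = det ?B" using Pr g(1) b unfolding P_def by auto
    also have "\<dots> = (\<Sum>k<r. ?B $$ (q, k) * cofactor ?B q k)"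
      by (rule laplace_expansion_row) (auto simp: q)
    also have "\<dots> = (\<Sum>k<r. W b k * v k)" unfolding cof by (rule sum.cong) (auto simp: v_def q)
    also have "\<dots> = (\<Sum>i<m. W b i * v i)"
      using rm by (intro sum.mono_neutral_left) (auto simp: v_def)
    finally show ?thesis by simp
  qed
  ultimately show ?thesis using q rm by (intro exI[of _ v] conjI exI[of _ q]) auto
qed

lemma pick_lessThan: "k < m \<Longrightarrow> pick {..<m} k = k"
  using pick_card_in_set[of k "{..<m}"] by (simp add: Collect_conj_eq Int_absorb1 lessThan_def[symmetric] lessThan_subset_iff)

lemma submatrix_rows:
  assumes W: "W \<in> carrier_mat N m" and I: "I \<subseteq> {..<N}" "card I = m"
  shows "submatrix W I {..<m} = mat m m (\<lambda>(a, k). W $$ (pick I a, k))"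
proof -
  have "{i. i < dim_row W \<and> i \<in> I} = I" "{j. j < dim_col W \<and> j \<in> {..<m}} = {..<m}"
    using I(1) W by auto
  then have dims: "card {i. i < dim_row W \<and> i \<in> I} = m"
    "card {j. j < dim_col W \<and> j \<in> {..<m}} = m" using I(2) by simp_all
  show ?thesis
    unfolding submatrix_def dims by (rule cong_mat) (auto simp: pick_lessThan)
qed

text \<open>Minors for a set of rows and for a sequence of rows differ only in the order of the rows, and
  the kernel of a square matrix, which decides whether its determinant vanishes, ignores that order.\<close>

lemma maximal_minors_vanish_iff:
  fixes W :: "'a::field mat"
  assumes W: "W \<in> carrier_mat N m"
  shows "(\<forall>I. I \<subseteq> {..<N} \<and> card I = m \<longrightarrow> det (submatrix W I {..<m}) = 0) \<longleftrightarrow>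
    (\<exists>v. (\<exists>i<m. v i \<noteq> 0) \<and> (\<forall>a<N. (\<Sum>i<m. W $$ (a, i) * v i) = 0))"
proof
  assume minors: "\<forall>I. I \<subseteq> {..<N} \<and> card I = m \<longrightarrow> det (submatrix W I {..<m}) = 0"
  have "det (mat m m (\<lambda>(a, k). W $$ (g a, k))) = 0" if g: "\<And>a. a < m \<Longrightarrow> g a < N" for g
  proof (cases "inj_on g {..<m}")
    case True
    let ?I = "g ` {..<m}"
    have I: "?I \<subseteq> {..<N}" "card ?I = m" using g card_image[OF True] by auto
    then have "det (mat m m (\<lambda>(a, k). W $$ (pick ?I a, k))) = 0"
      using minors submatrix_rows[OF W I] by metis
    then obtain v where v: "\<exists>i<m. v i \<noteq> 0"
        "\<And>a. a < m \<Longrightarrow> (\<Sum>i<m. W $$ (pick ?I a, i) * v i) = 0"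
      using det_zero_iff[of "mat m m (\<lambda>(a, k). W $$ (pick ?I a, k))" m] by auto
    have "(\<Sum>i<m. W $$ (g a, i) * v i) = 0" if a: "a < m" for a
    proof -
      have "card {b \<in> ?I. b < g a} < card ?I" using a by (intro psubset_card_mono) auto
      then show ?thesis using v(2) I(2) pick_card_in_set[of "g a" ?I] a by (metis imageI lessThan_iff)
    qed
    then show ?thesis using v(1) det_zero_iff[of "mat m m (\<lambda>(a, k). W $$ (g a, k))" m] by auto
  next
    case False
    then obtain a b where "a < m" "b < m" "a \<noteq> b" "g a = g b" by (auto simp: inj_on_def)
    then show ?thesis by (intro det_identical_rows[of _ m a b]) (auto intro!: eq_vecI)
  qed
  then show "\<exists>v. (\<exists>i<m. v i \<noteq> 0) \<and> (\<forall>a<N. (\<Sum>i<m. W $$ (a, i) * v i) = 0)"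
    by (rule kernel_of_vanishing_minors)
next
  assume "\<exists>v. (\<exists>i<m. v i \<noteq> 0) \<and> (\<forall>a<N. (\<Sum>i<m. W $$ (a, i) * v i) = 0)"
  then obtain v where v: "\<exists>i<m. v i \<noteq> 0" "\<And>a. a < N \<Longrightarrow> (\<Sum>i<m. W $$ (a, i) * v i) = 0" by blast
  have "det (submatrix W I {..<m}) = 0" if I: "I \<subseteq> {..<N}" "card I = m" for I
  proof -
    have "pick I a < N" if "a < m" for a
      using pick_in_set[of a I] I that by auto
    then show ?thesis
      unfolding submatrix_rows[OF W I]
      using v det_zero_iff[of "mat m m (\<lambda>(a, k). W $$ (pick I a, k))" m] by auto
  qed
  then show "\<forall>I. I \<subseteq> {..<N} \<and> card I = m \<longrightarrow> det (submatrix W I {..<m}) = 0" by blast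
qed



section \<open>Border bases\<close>

lemma term_deg_plus: "term_deg (s + t) = term_deg s + term_deg t"
  unfolding term_deg_def by (rule setsum_keys_plus_distrib) auto

lemma term_deg_zero [simp]: "term_deg 0 = 0"
  by (simp add: term_deg_def)

lemma term_deg_x_term [simp]: "term_deg (Poly_Mapping.single r (Suc 0)) = 1"
  by (simp add: term_deg_def)

lemma term_induct [case_names zero step]:
  assumes "P 0" and step: "\<And>r t. P t \<Longrightarrow> P (x_term r + t)"
  shows "P (t :: nat trm)"
proof (induction "term_deg t" arbitrary: t rule: less_induct)
  case less
  show ?case
  proof (cases "t = 0")
    case False
    then obtain r where r: "r \<in> Poly_Mapping.keys t" by (metis ex_in_conv keys_eq_empty)
    have t: "t = x_term r + (t - x_term r)"
      using r by (intro poly_mapping_eqI) (auto simp: lookup_add lookup_minus lookup_single when_def in_keys_iff)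
    then have "term_deg t = 1 + term_deg (t - x_term r)" by (metis term_deg_plus term_deg_x_term One_nat_def)
    then have "P (t - x_term r)" using less by simp
    then show ?thesis using step t by metis
  qed (simp add: assms)
qed

definition comb :: "nat trm list \<Rightarrow> (nat \<Rightarrow> 'k::field) \<Rightarrow> (nat, 'k) mpoly" where
  "comb ts v = (\<Sum>i<length ts. Poly_Mapping.single (ts ! i) (v i))"

lemma comb_lookup:
  assumes "distinct ts" "i < length ts"
  shows "Poly_Mapping.lookup (comb ts v) (ts ! i) = v i"
proof -
  have "Poly_Mapping.lookup (comb ts v) (ts ! i) = (\<Sum>j<length ts. if j = i then v j else 0)"
    unfolding comb_def lookup_sum
    by (rule sum.cong) (auto simp: lookup_single when_def nth_eq_iff_index_eq[OF assms(1)] assms(2))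
  then show ?thesis using assms(2) by simp
qed

lemma keys_comb: "Poly_Mapping.keys (comb ts v) \<subseteq> {ts ! i | i. i < length ts \<and> v i \<noteq> 0}"
  unfolding comb_def
  by (rule order_trans[OF keys_sum]) (auto split: if_splits)

lemma keys_comb_set: "Poly_Mapping.keys (comb ts v) \<subseteq> set ts"
  using keys_comb[of ts v] by auto

lemma comb_of_lookup:
  assumes "distinct ts" "Poly_Mapping.keys q \<subseteq> set ts"
  shows "comb ts (\<lambda>i. Poly_Mapping.lookup q (ts ! i)) = q"
proof (rule poly_mapping_eqI)
  fix t
  show "Poly_Mapping.lookup (comb ts (\<lambda>i. Poly_Mapping.lookup q (ts ! i))) t = Poly_Mapping.lookup q t"
  proof (cases "t \<in> set ts")
    case True
    then show ?thesis using comb_lookup[OF assms(1)] by (metis in_set_conv_nth)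
  next
    case False
    then have "t \<notin> Poly_Mapping.keys (comb ts (\<lambda>i. Poly_Mapping.lookup q (ts ! i)))" "t \<notin> Poly_Mapping.keys q"
      using keys_comb_set assms(2) by blast+
    then show ?thesis by (simp add: in_keys_iff)
  qed
qed

lemma comb_cong: "(\<And>i. i < length ts \<Longrightarrow> v i = w i) \<Longrightarrow> comb ts v = comb ts w"
  by (simp add: comb_def)

lemma comb_diff: "comb ts v - comb ts w = comb ts (\<lambda>i. v i - w i)"
  by (simp add: comb_def single_diff sum_subtractf)

lemma comb_sum: "comb ts (\<lambda>i. \<Sum>j\<in>A. c j * v j i) = (\<Sum>j\<in>A. const_poly (c j) * comb ts (v j))"
  by (induction A rule: infinite_finite_induct)
    (auto simp: comb_def single_add sum.distrib sum_distrib_left const_poly_mult_single)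

text \<open>The value of the \<open>r\<close>-th generic multiplication matrix at the point \<open>\<Gamma>\<close>.\<close>

definition generic_mat :: "nat trm list \<Rightarrow> nat trm list \<Rightarrow> 'k::field mat \<Rightarrow> nat \<Rightarrow> 'k mat" where
  "generic_mat ts bs \<Gamma> r = mat (length ts) (length ts) (\<lambda>(i, j).
     let t = x_term r + ts ! j in
     if t \<in> set ts then (if ts ! i = t then 1 else 0)
     else \<Gamma> $$ (i, (THE m. m < length bs \<and> bs ! m = t)))"

definition df_matrix :: "nat trm list \<Rightarrow> nat trm list \<Rightarrow> 'k::field mat \<Rightarrow> bool" where
  "df_matrix ts bs \<Gamma> \<longleftrightarrow> \<Gamma> \<in> carrier_mat (length ts) (length bs) \<and>
     (\<forall>i<length ts. \<forall>j<length bs. term_deg (bs ! j) < term_deg (ts ! i) \<longrightarrow> \<Gamma> $$ (i, j) = 0)"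

definition commuting_point :: "nat \<Rightarrow> nat trm list \<Rightarrow> nat trm list \<Rightarrow> 'k::field mat \<Rightarrow> bool" where
  "commuting_point n ts bs \<Gamma> \<longleftrightarrow> (\<forall>r<n. \<forall>s<n.
     generic_mat ts bs \<Gamma> r * generic_mat ts bs \<Gamma> s = generic_mat ts bs \<Gamma> s * generic_mat ts bs \<Gamma> r)"

locale border_setting =
  fixes n :: nat and ts bs :: "nat trm list"
  assumes order: "order_ideal n ts" and border: "enumerates_border n ts bs"
begin

abbreviation \<mu> where "\<mu> \<equiv> length ts"
abbreviation \<nu> where "\<nu> \<equiv> length bs"

lemma ts: "ts \<noteq> []" "distinct ts" "set ts \<subseteq> terms {..<n}" "sorted (map term_deg ts)"
  "s + u \<in> set ts \<Longrightarrow> s \<in> set ts"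
  using order by (auto simp: order_ideal_def)

lemma bs: "distinct bs" "set bs = border n (set ts)"
  using border by (auto simp: enumerates_border_def)

lemma bs_terms: "set bs \<subseteq> terms {..<n}"
  using bs(2) ts(3) by (auto simp: border_def)

lemma zero_in_ts: "0 \<in> set ts"
  using ts(1) ts(5)[of 0 "hd ts"] by simp

lemma ts_0: "ts ! 0 = 0"
proof -
  obtain i where i: "i < \<mu>" "ts ! i = 0" using zero_in_ts by (metis in_set_conv_nth)
  have "term_deg (ts ! 0) \<le> term_deg (ts ! i)"
    using sorted_nth_mono[OF ts(4), of 0 i] i ts(1) by simp
  then have "term_deg (ts ! 0) = 0" using i by simp
  then show ?thesis by (auto simp: term_deg_def in_keys_iff intro!: poly_mapping_eqI)
qed

lemma border_index:
  assumes "x_term r + s \<notin> set ts" "s \<in> set ts" "r < n"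
  shows "\<exists>j<\<nu>. bs ! j = x_term r + s \<and> (THE m. m < \<nu> \<and> bs ! m = x_term r + s) = j"
proof -
  have "x_term r + s \<in> set bs" using assms by (auto simp: bs(2) border_def)
  then obtain j where j: "j < \<nu>" "bs ! j = x_term r + s" by (metis in_set_conv_nth)
  have "(THE m. m < \<nu> \<and> bs ! m = x_term r + s) = j"
    by (rule the_equality) (use j bs(1) nth_eq_iff_index_eq in fastforce)+
  then show ?thesis using j by blast
qed

lemma border_pred:
  assumes "j < \<nu>"
  shows "\<exists>r<n. \<exists>k<\<mu>. bs ! j = x_term r + ts ! k \<and> x_term r + ts ! k \<notin> set ts"
proof -
  have "bs ! j \<in> border n (set ts)" using assms bs(2) by (metis nth_mem)
  then show ?thesis unfolding border_def by (auto simp: in_set_conv_nth) (metis in_set_conv_nth)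
qed

lemma generic_mat_carrier: "generic_mat ts bs \<Gamma> r \<in> carrier_mat \<mu> \<mu>"
  by (simp add: generic_mat_def)

lemma generic_mat_in:
  "i < \<mu> \<Longrightarrow> j < \<mu> \<Longrightarrow> x_term r + ts ! j \<in> set ts \<Longrightarrow>
   generic_mat ts bs \<Gamma> r $$ (i, j) = (if ts ! i = x_term r + ts ! j then 1 else 0)"
  by (simp add: generic_mat_def Let_def)

lemma generic_mat_border:
  assumes "i < \<mu>" "j < \<mu>" "r < n" "m < \<nu>" "bs ! m = x_term r + ts ! j"
  shows "generic_mat ts bs \<Gamma> r $$ (i, j) = \<Gamma> $$ (i, m)"
proof -
  have "x_term r + ts ! j \<in> border n (set ts)" using assms(4,5) bs(2) by (metis nth_mem)
  then have n: "x_term r + ts ! j \<notin> set ts" by (simp add: border_def)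
  have "(THE m. m < \<nu> \<and> bs ! m = x_term r + ts ! j) = m"
    by (rule the_equality) (use assms bs(1) nth_eq_iff_index_eq in fastforce)+
  then show ?thesis using n assms(1,2) by (simp add: generic_mat_def Let_def)
qed

definition border_poly :: "'k::field mat \<Rightarrow> nat \<Rightarrow> (nat, 'k) mpoly" where
  "border_poly \<Gamma> j = mon (bs ! j) - comb ts (\<lambda>i. \<Gamma> $$ (i, j))"

lemma comb_polys: "comb ts v \<in> polys {..<n}"
  using keys_subset_polys[OF keys_comb_set ts(3)] .

lemma border_poly_polys: "j < \<nu> \<Longrightarrow> border_poly \<Gamma> j \<in> polys {..<n}"
  unfolding border_poly_def using bs_terms nth_mem[of j bs] by (intro polys_diff comb_polys) auto

lemma point_ideal_alt: "point_ideal n ts bs \<Gamma> = genideal (P_ring n) {border_poly \<Gamma> j | j. j < \<nu>}"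
  by (simp add: point_ideal_def border_poly_def comb_def)

lemma point_ideal_ideal: "is_ideal {..<n} (point_ideal n ts bs \<Gamma>)"
  unfolding point_ideal_alt ideal_iff[symmetric]
  by (rule ring.genideal_ideal[OF ring_poly_ring]) (auto simp: border_poly_polys)

lemma border_poly_in_point_ideal: "j < \<nu> \<Longrightarrow> border_poly \<Gamma> j \<in> point_ideal n ts bs \<Gamma>"
  unfolding point_ideal_alt
  using ring.genideal_self[OF ring_poly_ring, of "{border_poly \<Gamma> j | j. j < \<nu>}" "{..<n}"] border_poly_polys
  by auto

lemma point_ideal_minimal:
  assumes "is_ideal {..<n} J" "\<And>j. j < \<nu> \<Longrightarrow> border_poly \<Gamma> j \<in> J"
  shows "point_ideal n ts bs \<Gamma> \<subseteq> J"
  unfolding point_ideal_alt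
  by (rule ring.genideal_minimal[OF ring_poly_ring]) (use assms in \<open>auto simp: ideal_iff\<close>)

text \<open>Multiply a reduction of \<open>t\<close> by \<open>x\<^sub>r\<close>: each term that leaves \<open>\<O>\<close> is then a border term, which its border
  polynomial rewrites. As \<open>\<Gamma>\<close> is degree filtered, the rewriting does not raise degrees.\<close>

lemma border_reduction:
  assumes I: "is_ideal {..<n} I" and \<Gamma>: "df_matrix ts bs \<Gamma>"
    and g: "\<And>j. j < \<nu> \<Longrightarrow> border_poly \<Gamma> j \<in> I" and t: "t \<in> terms {..<n}"
  shows "mon t \<in> span_mod I {s \<in> set ts. term_deg s \<le> term_deg t}"
  using t
proof (induction t rule: term_induct)
  case zero
  then show ?case by (intro span_mod_monom[OF I]) (simp add: zero_in_ts)
next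
  case (step r t)
  then have r: "r < n" and t: "t \<in> terms {..<n}" by auto
  let ?D = "{s \<in> set ts. term_deg s \<le> term_deg (x_term r + t)}"
  obtain q where q: "Poly_Mapping.keys q \<subseteq> {s \<in> set ts. term_deg s \<le> term_deg t}" "mon t - q \<in> I"
    using step t by (auto simp: span_mod_def)
  have "q * mon (x_term r) \<in> span_mod I ?D"
  proof (rule span_mod_monomials[OF I])
    fix s assume "s \<in> Poly_Mapping.keys q"
    then have s: "s \<in> set ts" "term_deg s \<le> term_deg t" using q(1) by auto
    have "mon (x_term r + s) \<in> span_mod I ?D"
    proof (cases "x_term r + s \<in> set ts")
      case True
      then show ?thesis using s(2) by (intro span_mod_monom[OF I]) (simp add: term_deg_plus)
    next
      case False
      then obtain j where j: "j < \<nu>" "bs ! j = x_term r + s" using border_index s(1) r by blast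
      have "Poly_Mapping.keys (comb ts (\<lambda>i. \<Gamma> $$ (i, j))) \<subseteq> ?D"
      proof
        fix u assume "u \<in> Poly_Mapping.keys (comb ts (\<lambda>i. \<Gamma> $$ (i, j)))"
        then obtain i where i: "u = ts ! i" "i < \<mu>" "\<Gamma> $$ (i, j) \<noteq> 0" using keys_comb by blast
        then have "term_deg u \<le> term_deg (bs ! j)"
          using \<Gamma> j(1) by (auto simp: df_matrix_def not_less[symmetric])
        then show "u \<in> ?D" using i s(2) by (auto simp: j(2) term_deg_plus)
      qed
      then show ?thesis using g[OF j(1)] unfolding border_poly_def j(2) by (rule span_modI)
    qed
    then show "mon s * mon (x_term r) \<in> span_mod I ?D" by (simp add: mult_single add.commute)
  qed
  moreover have "mon (x_term r + t) - q * mon (x_term r) \<in> I"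
    using is_ideal_mult[OF I _ q(2), of "mon (x_term r)"] r
    by (simp add: mult_single right_diff_distrib mult.commute[of q])
  ultimately show ?case using span_mod_cong[OF I] by blast
qed

lemma border_basis_spans:
  fixes I :: "(nat, 'k::field) mpoly set"
  assumes "is_ideal {..<n} I" and "df_matrix ts bs \<Gamma>" and "\<And>j. j < \<nu> \<Longrightarrow> border_poly \<Gamma> j \<in> I"
  shows "low_polys n (int i) \<subseteq> span_mod I {t \<in> set ts. term_deg t \<le> i}"
    and "polys {..<n} \<subseteq> span_mod I (set ts)"
proof -
  have r: "mon t \<in> span_mod I {s \<in> set ts. term_deg s \<le> term_deg t}" if "t \<in> terms {..<n}" for t
    by (rule border_reduction[OF assms that])
  show "low_polys n (int i) \<subseteq> span_mod I {t \<in> set ts. term_deg t \<le> i}"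
  proof
    fix p :: "(nat, 'k) mpoly" assume p: "p \<in> low_polys n (int i)"
    have "p * 1 \<in> span_mod I {t \<in> set ts. term_deg t \<le> i}"
    proof (rule span_mod_monomials[OF assms(1)])
      fix t assume "t \<in> Poly_Mapping.keys p"
      then have "t \<in> terms {..<n}" "term_deg t \<le> i" using p by (auto simp: low_polys_def polys_def)
      then show "mon t * 1 \<in> span_mod I {t \<in> set ts. term_deg t \<le> i}"
        using r[of t] by (auto intro: span_mod_mono[THEN subsetD, rotated 2])
    qed
    then show "p \<in> span_mod I {t \<in> set ts. term_deg t \<le> i}" by simp
  qed
  show "polys {..<n} \<subseteq> span_mod I (set ts)"
  proof
    fix p :: "(nat, 'k) mpoly" assume p: "p \<in> polys {..<n}"
    have "p * 1 \<in> span_mod I (set ts)"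
    proof (rule span_mod_monomials[OF assms(1)])
      fix t assume "t \<in> Poly_Mapping.keys p"
      then have "t \<in> terms {..<n}" using p by (auto simp: polys_def)
      then show "mon t * 1 \<in> span_mod I (set ts)"
        using r[of t] by (auto intro: span_mod_mono[THEN subsetD, rotated 2])
    qed
    then show "p \<in> span_mod I (set ts)" by simp
  qed
qed

lemma indep_comb:
  assumes "indep_mod I (set ts)" "comb ts v - comb ts w \<in> I" "i < \<mu>"
  shows "v i = w i"
proof -
  have "comb ts (\<lambda>i. v i - w i) = 0"
    using assms(1,2) keys_comb_set unfolding comb_diff indep_mod_def by blast
  then have "Poly_Mapping.lookup (comb ts (\<lambda>i. v i - w i)) (ts ! i) = 0" by simp
  then show ?thesis using comb_lookup[OF ts(2) assms(3), of "\<lambda>i. v i - w i"] by simp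
qed

subsection \<open>From ideals to matrices\<close>

lemma x_mult_basis:
  assumes g: "\<And>j. j < \<nu> \<Longrightarrow> border_poly \<Gamma> j \<in> I" and I: "is_ideal {..<n} I" and r: "r < n" and j: "j < \<mu>"
  shows "mon (x_term r + ts ! j) - comb ts (\<lambda>i. generic_mat ts bs \<Gamma> r $$ (i, j)) \<in> I"
proof (cases "x_term r + ts ! j \<in> set ts")
  case True
  have "comb ts (\<lambda>i. generic_mat ts bs \<Gamma> r $$ (i, j)) =
      comb ts (\<lambda>i. Poly_Mapping.lookup (mon (x_term r + ts ! j)) (ts ! i))"
    by (rule comb_cong) (auto simp: generic_mat_in[OF _ j True] lookup_single when_def)
  also have "\<dots> = mon (x_term r + ts ! j)" by (rule comb_of_lookup[OF ts(2)]) (use True in auto)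
  finally show ?thesis using is_ideal_zero[OF I] by simp
next
  case False
  then obtain m where m: "m < \<nu>" "bs ! m = x_term r + ts ! j" using border_index r j nth_mem by blast
  have "comb ts (\<lambda>i. generic_mat ts bs \<Gamma> r $$ (i, j)) = comb ts (\<lambda>i. \<Gamma> $$ (i, m))"
    by (rule comb_cong) (rule generic_mat_border[OF _ j r m])
  then show ?thesis using g[OF m(1)] by (simp add: border_poly_def m(2))
qed

lemma x_mult_comb:
  assumes g: "\<And>j. j < \<nu> \<Longrightarrow> border_poly \<Gamma> j \<in> I" and I: "is_ideal {..<n} I" and r: "r < n"
  shows "mon (x_term r) * comb ts v - comb ts (\<lambda>i. \<Sum>j<\<mu>. v j * generic_mat ts bs \<Gamma> r $$ (i, j)) \<in> I"
proof -
  have "mon (x_term r) * comb ts v = (\<Sum>j<\<mu>. const_poly (v j) * mon (x_term r + ts ! j))"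
    by (simp add: comb_def sum_distrib_left mult_single const_poly_mult_single)
  then have "mon (x_term r) * comb ts v - comb ts (\<lambda>i. \<Sum>j<\<mu>. v j * generic_mat ts bs \<Gamma> r $$ (i, j)) =
      (\<Sum>j<\<mu>. const_poly (v j) * (mon (x_term r + ts ! j) - comb ts (\<lambda>i. generic_mat ts bs \<Gamma> r $$ (i, j))))"
    by (simp add: comb_sum sum_subtractf right_diff_distrib)
  also have "\<dots> \<in> I"
    using x_mult_basis[OF g I r] is_ideal_mult[OF I polys_const_poly] by (intro is_ideal_sum[OF I]) auto
  finally show ?thesis .
qed

text \<open>Both products of two generic matrices express \<open>x\<^sub>r x\<^sub>s t\<^sub>k\<close> in the basis \<open>\<O>\<close> modulo \<open>I\<close>.\<close>

lemma commuting_of_ideal: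
  assumes I: "is_ideal {..<n} I" and ind: "indep_mod I (set ts)"
    and g: "\<And>j. j < \<nu> \<Longrightarrow> border_poly \<Gamma> j \<in> I"
  shows "commuting_point n ts bs \<Gamma>"
proof -
  let ?A = "generic_mat ts bs \<Gamma>"
  have main: "mon (x_term s + (x_term r + ts ! k)) - comb ts (\<lambda>i. (?A s * ?A r) $$ (i, k)) \<in> I"
    if rs: "r < n" "s < n" "k < \<mu>" for r s k
  proof -
    let ?v = "\<lambda>i. ?A r $$ (i, k)"
    have "mon (x_term s) * (mon (x_term r + ts ! k) - comb ts ?v) \<in> I"
      using rs by (intro is_ideal_mult[OF I _ x_mult_basis[OF g I]]) auto
    then have "mon (x_term s + (x_term r + ts ! k)) - mon (x_term s) * comb ts ?v \<in> I"
      by (simp add: right_diff_distrib mult_single)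
    moreover have eq: "comb ts (\<lambda>i. \<Sum>j<\<mu>. ?v j * ?A s $$ (i, j)) = comb ts (\<lambda>i. (?A s * ?A r) $$ (i, k))"
      by (rule comb_cong)
        (simp add: times_mat_entry[OF generic_mat_carrier generic_mat_carrier _ rs(3)] mult.commute del: index_mult_mat(1))
    ultimately show ?thesis
      using is_ideal_diff_trans[OF I _ x_mult_comb[OF g I rs(2), of ?v, unfolded eq]] by blast
  qed
  have "(?A s * ?A r) $$ (i, k) = (?A r * ?A s) $$ (i, k)" if "r < n" "s < n" "k < \<mu>" "i < \<mu>" for r s k i
  proof (rule indep_comb[OF ind _ that(4)])
    have eq: "x_term r + (x_term s + ts ! k) = x_term s + (x_term r + ts ! k)" by (simp only: add.left_commute)
    show "comb ts (\<lambda>i. (?A s * ?A r) $$ (i, k)) - comb ts (\<lambda>i. (?A r * ?A s) $$ (i, k)) \<in> I"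
      using main[OF that(1,2,3)] main[OF that(2,1,3), unfolded eq]
      by (rule is_ideal_diff_trans[OF I is_ideal_diff_swap[OF I, THEN iffD1]])
  qed
  moreover have "dim_row (?A r) = \<mu>" "dim_col (?A r) = \<mu>" for r using generic_mat_carrier[of \<Gamma> r] by auto
  ultimately have "?A r * ?A s = ?A s * ?A r" if "r < n" "s < n" for r s
    by (intro eq_matI) (use that in \<open>simp_all del: index_mult_mat(1)\<close>)
  then show ?thesis unfolding commuting_point_def by blast
qed

text \<open>The entries of \<open>\<Gamma>\<close> are the coefficients of the border terms in the basis \<open>\<O>\<close>. The degree
  filtration puts \<open>b\<^sub>j\<close> into the span of the \<open>t\<^sub>i\<close> of degree at most \<open>deg b\<^sub>j\<close>, which makes \<open>\<Gamma>\<close> degree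
  filtered. The border polynomials generate all of \<open>I\<close>, since modulo them every polynomial reduces to the
  span of \<open>\<O>\<close>, and \<open>\<O>\<close> is independent modulo \<open>I\<close>.\<close>

lemma ex_matrix_of_ideal:
  assumes I: "is_ideal {..<n} (I :: (nat, 'k::field) mpoly set)" and df: "df_basis n (set ts) I"
  shows "\<exists>\<Gamma>. df_matrix ts bs \<Gamma> \<and> commuting_point n ts bs \<Gamma> \<and> point_ideal n ts bs \<Gamma> = I"
proof -
  have "\<exists>q. Poly_Mapping.keys q \<subseteq> {s \<in> set ts. term_deg s \<le> term_deg (bs ! j)} \<and> mon (bs ! j) - q \<in> I"
    if "j < \<nu>" for j
  proof -
    have "mon (bs ! j) \<in> low_polys n (int (term_deg (bs ! j)))"
      using bs_terms that nth_mem[of j bs] by (auto simp: low_polys_def)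
    then show ?thesis using df unfolding df_basis_def span_mod_def by blast
  qed
  then have "\<forall>j. \<exists>q. j < \<nu> \<longrightarrow> Poly_Mapping.keys q \<subseteq> {s \<in> set ts. term_deg s \<le> term_deg (bs ! j)} \<and>
      mon (bs ! j) - q \<in> I" by blast
  from choice[OF this] obtain q where
    q: "\<And>j. j < \<nu> \<Longrightarrow> Poly_Mapping.keys (q j) \<subseteq> {s \<in> set ts. term_deg s \<le> term_deg (bs ! j)}"
      "\<And>j. j < \<nu> \<Longrightarrow> mon (bs ! j) - q j \<in> I" by blast
  define \<Gamma> where "\<Gamma> = mat \<mu> \<nu> (\<lambda>(i, j). Poly_Mapping.lookup (q j) (ts ! i))"
  have g: "border_poly \<Gamma> j \<in> I" if j: "j < \<nu>" for j
  proof -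
    have "comb ts (\<lambda>i. \<Gamma> $$ (i, j)) = comb ts (\<lambda>i. Poly_Mapping.lookup (q j) (ts ! i))"
      by (rule comb_cong) (simp add: \<Gamma>_def j)
    also have "\<dots> = q j" by (rule comb_of_lookup[OF ts(2)]) (use q(1)[OF j] in auto)
    finally show ?thesis using q(2)[OF j] by (simp add: border_poly_def)
  qed
  have \<Gamma>: "df_matrix ts bs \<Gamma>"
  proof -
    have "\<Gamma> $$ (i, j) = 0" if ij: "i < \<mu>" "j < \<nu>" "term_deg (bs ! j) < term_deg (ts ! i)" for i j
    proof -
      have "ts ! i \<notin> Poly_Mapping.keys (q j)" using q(1)[OF ij(2)] ij(3) by auto
      then show ?thesis using ij by (simp add: \<Gamma>_def in_keys_iff)
    qed
    then show ?thesis by (auto simp: df_matrix_def \<Gamma>_def)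
  qed
  have sub: "point_ideal n ts bs \<Gamma> \<subseteq> I" by (rule point_ideal_minimal[OF I g])
  have ind: "indep_mod I (set ts)" using df by (simp add: df_basis_def)
  have "p \<in> point_ideal n ts bs \<Gamma>" if p: "p \<in> I" for p
  proof -
    have "p \<in> span_mod (point_ideal n ts bs \<Gamma>) (set ts)"
      using border_basis_spans(2)[OF point_ideal_ideal \<Gamma> border_poly_in_point_ideal] is_ideal_subset[OF I p] by blast
    then obtain r where r: "Poly_Mapping.keys r \<subseteq> set ts" "p - r \<in> point_ideal n ts bs \<Gamma>"
      by (auto simp: span_mod_def)
    then have "r \<in> I" using is_ideal_diff_mem[OF I, of p r] p sub by auto
    then have "r = 0" using ind r(1) by (auto simp: indep_mod_def)
    then show ?thesis using r(2) by simp
  qed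
  then show ?thesis using sub \<Gamma> commuting_of_ideal[OF I ind g] by blast
qed

subsection \<open>From matrices to ideals\<close>

definition term_mat :: "'k::field mat \<Rightarrow> nat trm \<Rightarrow> 'k mat" where
  "term_mat \<Gamma> t = term_at_mats n \<mu> (generic_mat ts bs \<Gamma>) t"

text \<open>This is the vector \<open>p(A)e\<^sub>0\<close>, where \<open>A\<close> is the tuple of generic matrices at \<open>\<Gamma>\<close> and \<open>e\<^sub>0\<close> the
  unit vector that belongs to the basis term \<open>1\<close>. It turns out to be the coordinate vector of \<open>p\<close> with
  respect to \<open>\<O>\<close> (\<open>comb_coords\<close>).\<close>

definition coords :: "'k::field mat \<Rightarrow> (nat, 'k) mpoly \<Rightarrow> nat \<Rightarrow> 'k" where
  "coords \<Gamma> p i = (\<Sum>t\<in>Poly_Mapping.keys p. Poly_Mapping.lookup p t * term_mat \<Gamma> t $$ (i, 0))"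

lemma term_mat_carrier: "term_mat \<Gamma> t \<in> carrier_mat \<mu> \<mu>"
  unfolding term_mat_def by (rule term_at_mats_carrier) (rule generic_mat_carrier)

lemma coords_add: "coords \<Gamma> (p + q) i = coords \<Gamma> p i + coords \<Gamma> q i"
  unfolding coords_def by (rule setsum_keys_plus_distrib) (auto simp: algebra_simps)

lemma coords_single: "coords \<Gamma> (Poly_Mapping.single t c) i = c * term_mat \<Gamma> t $$ (i, 0)"
  by (simp add: coords_def)

lemma coords_zero [simp]: "coords \<Gamma> 0 i = 0"
  by (simp add: coords_def)

lemma coords_sum: "coords \<Gamma> (sum f A) i = (\<Sum>a\<in>A. coords \<Gamma> (f a) i)"
  by (induction A rule: infinite_finite_induct) (auto simp: coords_add)

lemma coords_diff: "coords \<Gamma> (p - q) i = coords \<Gamma> p i - coords \<Gamma> q i"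
  using coords_add[of \<Gamma> "p - q" q i] by simp

context
  fixes \<Gamma> :: "'k::field mat"
  assumes comm: "commuting_point n ts bs \<Gamma>"
begin

lemma term_mat_plus: "term_mat \<Gamma> (s + t) = term_mat \<Gamma> s * term_mat \<Gamma> t"
  unfolding term_mat_def
  by (rule term_at_mats_plus) (use generic_mat_carrier comm in \<open>auto simp: commuting_point_def\<close>)

lemma coords_mult_single:
  assumes i: "i < \<mu>"
  shows "coords \<Gamma> (Poly_Mapping.single t c * p) i = c * (\<Sum>k<\<mu>. term_mat \<Gamma> t $$ (i, k) * coords \<Gamma> p k)"
proof -
  have z: "0 < \<mu>" using ts(1) by simp
  have "coords \<Gamma> (Poly_Mapping.single t c * p) i =
      (\<Sum>s\<in>Poly_Mapping.keys p. coords \<Gamma> (Poly_Mapping.single (t + s) (c * Poly_Mapping.lookup p s)) i)"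
    by (subst (1) sum_monomials[of p]) (simp add: sum_distrib_left mult_single coords_sum)
  also have "\<dots> = (\<Sum>s\<in>Poly_Mapping.keys p. c * (\<Sum>k<\<mu>. term_mat \<Gamma> t $$ (i, k) *
      (Poly_Mapping.lookup p s * term_mat \<Gamma> s $$ (k, 0))))"
    by (simp add: coords_single term_mat_plus times_mat_entry[OF term_mat_carrier term_mat_carrier i z]
        sum_distrib_left mult_ac del: index_mult_mat(1))
  also have "\<dots> = c * (\<Sum>k<\<mu>. term_mat \<Gamma> t $$ (i, k) * coords \<Gamma> p k)"
    unfolding coords_def sum_distrib_left by (rule sum.swap)
  finally show ?thesis .
qed

lemma coords_mult_zero:
  assumes "\<And>i. i < \<mu> \<Longrightarrow> coords \<Gamma> p i = 0" "i < \<mu>"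
  shows "coords \<Gamma> (q * p) i = 0"
proof -
  have "q * p = (\<Sum>t\<in>Poly_Mapping.keys q. Poly_Mapping.single t (Poly_Mapping.lookup q t) * p)"
    by (subst (1) sum_monomials[of q]) (simp add: sum_distrib_right)
  then show ?thesis using assms by (simp add: coords_sum coords_mult_single)
qed

text \<open>A basis term \<open>x\<^sub>r t\<^sub>j\<close> maps \<open>e\<^sub>0\<close> to \<open>A\<^sub>r e\<^sub>j\<close> by induction, and the \<open>j\<close>-th column of \<open>A\<^sub>r\<close> is the unit
  vector of \<open>x\<^sub>r t\<^sub>j\<close> by definition.\<close>

lemma term_mat_basis:
  assumes "t \<in> set ts" "i < \<mu>"
  shows "term_mat \<Gamma> t $$ (i, 0) = (if ts ! i = t then 1 else 0)"
  using assms
proof (induction t arbitrary: i rule: term_induct)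
  case zero
  have "term_mat \<Gamma> 0 = 1\<^sub>m \<mu>" unfolding term_mat_def by (rule term_at_mats_zero) (rule generic_mat_carrier)
  moreover have "ts ! i = 0 \<longleftrightarrow> i = 0" using ts_0 nth_eq_iff_index_eq[OF ts(2), of i 0] zero ts(1) by auto
  ultimately show ?case using zero ts(1) by simp
next
  case (step r t)
  have r: "r < n" using step.prems(1) ts(3) by auto
  have "t \<in> set ts" using ts(5)[of t "x_term r"] step.prems(1) by (simp add: add.commute)
  then obtain j where j: "j < \<mu>" "ts ! j = t" by (metis in_set_conv_nth)
  have z: "0 < \<mu>" using ts(1) by simp
  have "term_mat \<Gamma> (x_term r + t) = generic_mat ts bs \<Gamma> r * term_mat \<Gamma> t"
    unfolding term_mat_plus using term_at_mats_x_term[of n "generic_mat ts bs \<Gamma>" \<mu> r, OF generic_mat_carrier r]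
    by (simp add: term_mat_def)
  then have "term_mat \<Gamma> (x_term r + t) $$ (i, 0) =
      (\<Sum>k<\<mu>. generic_mat ts bs \<Gamma> r $$ (i, k) * term_mat \<Gamma> t $$ (k, 0))"
    using times_mat_entry[OF generic_mat_carrier term_mat_carrier step.prems(2) z] by simp
  also have "\<dots> = (\<Sum>k<\<mu>. if k = j then generic_mat ts bs \<Gamma> r $$ (i, k) else 0)"
    using step.IH[OF \<open>t \<in> set ts\<close>] j nth_eq_iff_index_eq[OF ts(2)] by (intro sum.cong) auto
  also have "\<dots> = generic_mat ts bs \<Gamma> r $$ (i, j)" using j by simp
  also have "\<dots> = (if ts ! i = x_term r + t then 1 else 0)"
    using generic_mat_in[OF step.prems(2) j(1), of r \<Gamma>] j(2) step.prems(1) by simp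
  finally show ?case .
qed

lemma coords_basis: "Poly_Mapping.keys q \<subseteq> set ts \<Longrightarrow> i < \<mu> \<Longrightarrow> coords \<Gamma> q i = Poly_Mapping.lookup q (ts ! i)"
proof -
  assume q: "Poly_Mapping.keys q \<subseteq> set ts" and i: "i < \<mu>"
  have "coords \<Gamma> q i = (\<Sum>t\<in>Poly_Mapping.keys q. if t = ts ! i then Poly_Mapping.lookup q t else 0)"
    unfolding coords_def using q i by (intro sum.cong) (auto simp: term_mat_basis subset_iff)
  then show ?thesis by (simp add: in_keys_iff)
qed

lemma coords_border:
  assumes j: "j < \<nu>" and i: "i < \<mu>"
  shows "coords \<Gamma> (border_poly \<Gamma> j) i = 0"
proof -
  obtain r k where rk: "r < n" "k < \<mu>" "bs ! j = x_term r + ts ! k" using border_pred[OF j] by blast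
  have "coords \<Gamma> (mon (bs ! j)) i = (\<Sum>l<\<mu>. term_mat \<Gamma> (x_term r) $$ (i, l) * coords \<Gamma> (mon (ts ! k)) l)"
    using coords_mult_single[OF i, of "x_term r" 1 "mon (ts ! k)"] by (simp add: mult_single rk(3))
  also have "\<dots> = (\<Sum>l<\<mu>. if l = k then generic_mat ts bs \<Gamma> r $$ (i, l) else 0)"
    using rk(1,2) term_at_mats_x_term[of n "generic_mat ts bs \<Gamma>" \<mu> r, OF generic_mat_carrier]
    by (intro sum.cong) (auto simp: coords_basis lookup_single when_def nth_eq_iff_index_eq[OF ts(2)] term_mat_def)
  also have "\<dots> = \<Gamma> $$ (i, j)" using rk generic_mat_border[OF i rk(2,1) j rk(3)] by simp
  finally show ?thesis
    using coords_basis[OF keys_comb_set i, of "\<lambda>i. \<Gamma> $$ (i, j)"] comb_lookup[OF ts(2) i, of "\<lambda>i. \<Gamma> $$ (i, j)"]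
    by (simp add: border_poly_def coords_diff)
qed

text \<open>The border polynomials lie in the kernel of \<open>coords\<close>, which is an ideal because the matrices
  commute.\<close>

lemma coords_point_ideal:
  assumes "p \<in> point_ideal n ts bs \<Gamma>" "i < \<mu>"
  shows "coords \<Gamma> p i = 0"
proof -
  let ?K = "{p \<in> polys {..<n}. \<forall>i<\<mu>. coords \<Gamma> p i = 0}"
  have "is_ideal {..<n} ?K"
    by (rule is_idealI) (auto simp: coords_add coords_mult_zero)
  then have "point_ideal n ts bs \<Gamma> \<subseteq> ?K"
    by (rule point_ideal_minimal) (auto simp: border_poly_polys coords_border)
  then show ?thesis using assms by blast
qed

lemma coords_cong: "p - q \<in> point_ideal n ts bs \<Gamma> \<Longrightarrow> i < \<mu> \<Longrightarrow> coords \<Gamma> p i = coords \<Gamma> q i"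
  using coords_point_ideal[of "p - q" i] by (simp add: coords_diff)

text \<open>The map \<open>coords\<close> vanishes on the ideal and is injective on the span of \<open>\<O>\<close>.\<close>

lemma point_ideal_indep: "indep_mod (point_ideal n ts bs \<Gamma>) (set ts)"
  unfolding indep_mod_def
proof (intro ballI impI)
  fix q assume q: "q \<in> point_ideal n ts bs \<Gamma>" "Poly_Mapping.keys q \<subseteq> set ts"
  have "comb ts (\<lambda>i. Poly_Mapping.lookup q (ts ! i)) = comb ts (\<lambda>i. 0)"
    by (rule comb_cong) (use coords_point_ideal[OF q(1)] coords_basis[OF q(2)] in simp)
  then show "q = 0" using comb_of_lookup[OF ts(2) q(2)] by (simp add: comb_def)
qed

lemma point_ideal_df_basis: "df_matrix ts bs \<Gamma> \<Longrightarrow> df_basis n (set ts) (point_ideal n ts bs \<Gamma>)"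
  unfolding df_basis_def
  using point_ideal_indep border_basis_spans(1)[OF point_ideal_ideal _ border_poly_in_point_ideal] by blast

end

lemma point_ideal_inj:
  assumes "df_matrix ts bs \<Gamma>" "df_matrix ts bs \<Gamma>'" "commuting_point n ts bs \<Gamma>"
    and eq: "point_ideal n ts bs \<Gamma> = point_ideal n ts bs \<Gamma>'"
  shows "\<Gamma> = \<Gamma>'"
proof (rule eq_matI)
  fix i j assume "i < dim_row \<Gamma>'" "j < dim_col \<Gamma>'"
  then have ij: "i < \<mu>" "j < \<nu>" using assms(2) by (auto simp: df_matrix_def)
  have "border_poly \<Gamma>' j - border_poly \<Gamma> j \<in> point_ideal n ts bs \<Gamma>"
    using is_ideal_diff[OF point_ideal_ideal] border_poly_in_point_ideal[OF ij(2)] eq by metis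
  then have "comb ts (\<lambda>i. \<Gamma> $$ (i, j)) - comb ts (\<lambda>i. \<Gamma>' $$ (i, j)) \<in> point_ideal n ts bs \<Gamma>"
    by (simp add: border_poly_def)
  then show "\<Gamma> $$ (i, j) = \<Gamma>' $$ (i, j)"
    by (rule indep_comb[OF point_ideal_indep[OF assms(3)] _ ij(1)])
qed (use assms in \<open>auto simp: df_matrix_def\<close>)

end



section \<open>The Cayley-Bacharach property in terms of multiplication matrices\<close>

lemma upward_closed_interval:
  assumes S: "S \<subseteq> {..<m::nat}" and up: "\<And>i j. i \<in> S \<Longrightarrow> i \<le> j \<Longrightarrow> j < m \<Longrightarrow> j \<in> S"
  shows "S = {m - card S..<m}"
proof (cases "S = {}")
  case False
  have fin: "finite S" using S finite_subset by blast
  have "S = {Min S..<m}"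
  proof (intro equalityI subsetI)
    fix i assume "i \<in> {Min S..<m}"
    then show "i \<in> S" using up[OF Min_in[OF fin False]] by auto
  qed (use S fin in auto)
  then show ?thesis using S Min_in[OF fin False] by (metis card_atLeastLessThan diff_diff_cancel lessThan_iff less_imp_le_nat subsetD)
qed simp

context border_setting
begin

abbreviation \<Delta> where "\<Delta> \<equiv> top_count ts"
abbreviation d where "d \<equiv> term_deg (last ts)"

lemma term_deg_le_d: "i < \<mu> \<Longrightarrow> term_deg (ts ! i) \<le> d"
  using sorted_nth_mono[OF ts(4), of i "\<mu> - 1"] ts(1) by (simp add: last_conv_nth)

lemma top_indices: "{i. i < \<mu> \<and> term_deg (ts ! i) = d} = {\<mu> - \<Delta>..<\<mu>}"
  unfolding top_count_def
proof (rule upward_closed_interval)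
  fix i j assume "i \<in> {i. i < \<mu> \<and> term_deg (ts ! i) = d}" "i \<le> j" "j < \<mu>"
  then show "j \<in> {i. i < \<mu> \<and> term_deg (ts ! i) = d}"
    using sorted_nth_mono[OF ts(4), of i j] term_deg_le_d[of j] by auto
qed auto

lemma \<Delta>_le: "\<Delta> \<le> \<mu>"
proof -
  have "\<Delta> \<le> card {..<\<mu>}" unfolding top_count_def by (rule card_mono) auto
  then show ?thesis by simp
qed

context
  fixes \<Gamma> :: "'k::field mat"
  assumes comm: "commuting_point n ts bs \<Gamma>" and df: "df_matrix ts bs \<Gamma>"
begin

lemma df_quotient_point: "df_quotient n (set ts) (point_ideal n ts bs \<Gamma>) d"
proof
  show "term_deg t \<le> d" if "t \<in> set ts" for t
    using that term_deg_le_d by (metis in_set_conv_nth)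
  show "\<exists>t\<in>set ts. term_deg t = d" using ts(1) by auto
qed (use ts point_ideal_ideal point_ideal_df_basis[OF comm df] in auto)

interpretation df_quotient n "set ts" "point_ideal n ts bs \<Gamma>" d
  by (rule df_quotient_point)

lemma comb_coords:
  assumes "p \<in> polys {..<n}"
  shows "p - comb ts (coords \<Gamma> p) \<in> point_ideal n ts bs \<Gamma>"
proof -
  obtain q where q: "Poly_Mapping.keys q \<subseteq> set ts" "p - q \<in> point_ideal n ts bs \<Gamma>"
    using border_basis_spans(2)[OF point_ideal_ideal df border_poly_in_point_ideal] assms
    by (auto simp: span_mod_def)
  have "comb ts (coords \<Gamma> p) = comb ts (\<lambda>i. Poly_Mapping.lookup q (ts ! i))"
    by (rule comb_cong) (simp add: coords_cong[OF comm q(2)] coords_basis[OF comm q(1)])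
  then show ?thesis using comb_of_lookup[OF ts(2) q(1)] q(2) by simp
qed

lemma span_below_top_iff:
  assumes p: "p \<in> polys {..<n}"
  shows "p \<in> span_le (int d - 1) \<longleftrightarrow> (\<forall>k\<in>{\<mu> - \<Delta>..<\<mu>}. coords \<Gamma> p k = 0)"
proof
  assume "p \<in> span_le (int d - 1)"
  then obtain q where q: "Poly_Mapping.keys q \<subseteq> {t \<in> set ts. int (term_deg t) \<le> int d - 1}"
    "p - q \<in> point_ideal n ts bs \<Gamma>" by (auto simp: span_le_def span_mod_def)
  show "\<forall>k\<in>{\<mu> - \<Delta>..<\<mu>}. coords \<Gamma> p k = 0"
  proof
    fix k assume "k \<in> {\<mu> - \<Delta>..<\<mu>}"
    then have k: "k < \<mu>" "term_deg (ts ! k) = d" unfolding top_indices[symmetric] by auto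
    then have "ts ! k \<notin> Poly_Mapping.keys q" using q(1) by auto
    then show "coords \<Gamma> p k = 0"
      using coords_cong[OF comm q(2) k(1)] coords_basis[OF comm _ k(1), of q] q(1)
      by (auto simp: in_keys_iff)
  qed
next
  assume z: "\<forall>k\<in>{\<mu> - \<Delta>..<\<mu>}. coords \<Gamma> p k = 0"
  have "Poly_Mapping.keys (comb ts (coords \<Gamma> p)) \<subseteq> {t \<in> set ts. int (term_deg t) \<le> int d - 1}"
  proof
    fix t assume "t \<in> Poly_Mapping.keys (comb ts (coords \<Gamma> p))"
    then obtain i where i: "t = ts ! i" "i < \<mu>" "coords \<Gamma> p i \<noteq> 0" using keys_comb by blast
    then have "i \<notin> {i. i < \<mu> \<and> term_deg (ts ! i) = d}" unfolding top_indices using z by blast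
    then have "term_deg t < d" using term_deg_le_d[OF i(2)] i by auto
    then show "t \<in> {t \<in> set ts. int (term_deg t) \<le> int d - 1}" using i by auto
  qed
  then show "p \<in> span_le (int d - 1)"
    unfolding span_le_def using comb_coords[OF p] by (rule span_modI)
qed

lemma coords_mult_comb:
  assumes l: "l < \<mu>" and k: "k < \<mu>"
  shows "coords \<Gamma> (mon (ts ! l) * comb ts v) k = (\<Sum>i<\<mu>. term_mat \<Gamma> (ts ! i) $$ (k, l) * v i)"
proof -
  have "coords \<Gamma> (mon (ts ! l) * comb ts v) k =
      (\<Sum>i<\<mu>. coords \<Gamma> (Poly_Mapping.single (ts ! i) (v i) * mon (ts ! l)) k)"
    by (simp add: comb_def sum_distrib_left coords_sum mult.commute)
  also have "\<dots> = (\<Sum>i<\<mu>. v i * (\<Sum>m<\<mu>. term_mat \<Gamma> (ts ! i) $$ (k, m) * (if m = l then 1 else 0)))"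
    by (intro sum.cong refl)
      (auto simp: coords_mult_single[OF comm k] coords_basis[OF comm] lookup_single when_def
        nth_eq_iff_index_eq[OF ts(2)] l intro!: sum.cong arg_cong[of _ _ "(*) _"])
  also have "\<dots> = (\<Sum>i<\<mu>. v i * term_mat \<Gamma> (ts ! i) $$ (k, l))"
    using l by (simp add: if_distrib[of "(*) _"] cong: if_cong)
  finally show ?thesis by (simp add: mult.commute)
qed

text \<open>The condition on \<open>v\<close> says that the multiples of \<open>f = \<Sum>\<^sub>i v\<^sub>i t\<^sub>i\<close> by basis terms have no coordinate at
  a basis term of top degree: the \<open>k\<close>-th coordinate of \<open>t\<^sub>l f\<close> is \<open>\<Sum>\<^sub>i (M\<^bsub>t\<^sub>i\<^esub>)\<^sub>k\<^sub>l v\<^sub>i\<close>, and the terms of top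
  degree are the last \<open>\<Delta>\<close> ones.\<close>

theorem not_cayley_bacharach_point_iff:
  "\<not> cayley_bacharach n (point_ideal n ts bs \<Gamma>) \<longleftrightarrow>
    (\<exists>v. (\<exists>i<\<mu>. v i \<noteq> 0) \<and>
      (\<forall>k\<in>{\<mu> - \<Delta>..<\<mu>}. \<forall>l<\<mu>. (\<Sum>i<\<mu>. term_mat \<Gamma> (ts ! i) $$ (k, l) * v i) = 0))"
proof -
  let ?I = "point_ideal n ts bs \<Gamma>"
  have mt: "mon (ts ! l) \<in> polys {..<n}" if "l < \<mu>" for l
    using ts(3) nth_mem[OF that] by auto
  have all: "(\<forall>p\<in>polys {..<n}. p * f \<in> span_le (int d - 1)) \<longleftrightarrow> (\<forall>l<\<mu>. mon (ts ! l) * f \<in> span_le (int d - 1))"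
    if f: "f \<in> polys {..<n}" for f
  proof (intro iffI ballI)
    fix p :: "(nat, 'k) mpoly" assume h: "\<forall>l<\<mu>. mon (ts ! l) * f \<in> span_le (int d - 1)" and p: "p \<in> polys {..<n}"
    let ?q = "comb ts (coords \<Gamma> p)"
    have "?q * f \<in> span_le (int d - 1)"
      unfolding span_le_def
    proof (rule span_mod_monomials[OF ideal_I])
      fix t assume "t \<in> Poly_Mapping.keys ?q"
      then have "t \<in> set ts" using keys_comb_set by blast
      then show "mon t * f \<in> span_mod ?I {t \<in> set ts. int (term_deg t) \<le> int d - 1}"
        using h unfolding span_le_def by (auto simp: in_set_conv_nth)
    qed
    moreover have "p * f - ?q * f \<in> ?I"
      using is_ideal_mult2[OF ideal_I f comb_coords[OF p]] by (simp add: left_diff_distrib)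
    ultimately show "p * f \<in> span_le (int d - 1)"
      unfolding span_le_def using span_mod_cong[OF ideal_I] by blast
  qed (use mt in blast)
  have comb_iff: "(\<forall>l<\<mu>. mon (ts ! l) * comb ts v \<in> span_le (int d - 1)) \<longleftrightarrow>
      (\<forall>k\<in>{\<mu> - \<Delta>..<\<mu>}. \<forall>l<\<mu>. (\<Sum>i<\<mu>. term_mat \<Gamma> (ts ! i) $$ (k, l) * v i) = 0)" for v
    using span_below_top_iff[OF polys_mult[OF mt comb_polys]] coords_mult_comb by auto
  show ?thesis
    unfolding not_cayley_bacharach_iff
  proof
    assume "\<exists>f\<in>polys {..<n} - ?I. \<forall>p\<in>polys {..<n}. p * f \<in> span_le (int d - 1)"
    then obtain f where f: "f \<in> polys {..<n}" "f \<notin> ?I" "\<forall>p\<in>polys {..<n}. p * f \<in> span_le (int d - 1)" by blast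
    let ?v = "coords \<Gamma> f"
    have "\<exists>i<\<mu>. ?v i \<noteq> 0"
    proof (rule ccontr)
      assume "\<not> (\<exists>i<\<mu>. ?v i \<noteq> 0)"
      then have "comb ts ?v = 0" by (simp add: comb_def)
      then show False using comb_coords[OF f(1)] f(2) by simp
    qed
    moreover have "mon (ts ! l) * comb ts ?v \<in> span_le (int d - 1)" if l: "l < \<mu>" for l
    proof -
      have "mon (ts ! l) * f - mon (ts ! l) * comb ts ?v \<in> ?I"
        using is_ideal_mult[OF ideal_I mt[OF l] comb_coords[OF f(1)]] by (simp add: right_diff_distrib)
      moreover have "mon (ts ! l) * f \<in> span_le (int d - 1)" using f(3) mt[OF l] by blast
      ultimately show ?thesis unfolding span_le_def using span_mod_cong[OF ideal_I] by blast
    qed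
    ultimately show "\<exists>v. (\<exists>i<\<mu>. v i \<noteq> 0) \<and>
      (\<forall>k\<in>{\<mu> - \<Delta>..<\<mu>}. \<forall>l<\<mu>. (\<Sum>i<\<mu>. term_mat \<Gamma> (ts ! i) $$ (k, l) * v i) = 0)"
      using comb_iff by blast
  next
    assume "\<exists>v. (\<exists>i<\<mu>. v i \<noteq> 0) \<and>
      (\<forall>k\<in>{\<mu> - \<Delta>..<\<mu>}. \<forall>l<\<mu>. (\<Sum>i<\<mu>. term_mat \<Gamma> (ts ! i) $$ (k, l) * v i) = 0)"
    then obtain v i where v: "i < \<mu>" "v i \<noteq> 0" "\<forall>l<\<mu>. mon (ts ! l) * comb ts v \<in> span_le (int d - 1)"
      unfolding comb_iff by blast
    have "comb ts v \<notin> ?I"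
    proof
      assume "comb ts v \<in> ?I"
      then have "coords \<Gamma> (comb ts v) i = 0" using coords_point_ideal[OF comm] v(1) by blast
      then show False
        using coords_basis[OF comm keys_comb_set v(1), of v] comb_lookup[OF ts(2) v(1), of v] v(2) by simp
    qed
    then show "\<exists>f\<in>polys {..<n} - ?I. \<forall>p\<in>polys {..<n}. p * f \<in> span_le (int d - 1)"
      using all[OF comb_polys] v(3) comb_polys by blast
  qed
qed

end

end

section \<open>Rational points\<close>

lemma nth_concat_uniform:
  assumes "\<And>j. j < k \<Longrightarrow> length (f j) = m"
  shows "length (concat (map f [0..<k])) = k * m \<and>
    (\<forall>a<k * m. concat (map f [0..<k]) ! a = f (a div m) ! (a mod m))"
  using assms
proof (induction k)
  case (Suc k)
  then have IH: "length (concat (map f [0..<k])) = k * m"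
    "\<And>a. a < k * m \<Longrightarrow> concat (map f [0..<k]) ! a = f (a div m) ! (a mod m)" and m: "length (f k) = m" by auto
  have "concat (map f [0..<Suc k]) ! a = f (a div m) ! (a mod m)" if a: "a < Suc k * m" for a
  proof (cases "a < k * m")
    case True
    then show ?thesis using IH by (simp add: nth_append)
  next
    case False
    then have "a = k * m + (a - k * m)" "a - k * m < m" using a by auto
    then have "a div m = k" "a mod m = a - k * m"
      by (metis div_mult_self3 div_less add_0_right less_nat_zero_code, metis mod_mult_self3 mod_less)
    then show ?thesis using False IH by (simp add: nth_append)
  qed
  then show ?case using IH m by simp
qed simp

definition point_eval :: "('k::field \<Rightarrow> 'l::field) \<Rightarrow> 'l mat \<Rightarrow> (nat \<times> nat, 'k) mpoly \<Rightarrow> 'l" where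
  "point_eval \<phi> \<Gamma> = poly_eval \<phi> (\<lambda>(i, j). \<Gamma> $$ (i, j))"

lemma point_eval_hom: "comm_ring_hom \<phi> \<Longrightarrow> comm_ring_hom (point_eval \<phi> \<Gamma>)"
  unfolding point_eval_def by (rule comm_ring_hom_poly_eval)

lemma point_eval_c_var: "comm_ring_hom \<phi> \<Longrightarrow> point_eval \<phi> \<Gamma> (c_var i j) = \<Gamma> $$ (i, j)"
  unfolding point_eval_def by (subst poly_eval_c_var) auto

lemma rational_points_iff: "\<Gamma> \<in> rational_points \<phi> \<mu> \<nu> I \<longleftrightarrow>
    \<Gamma> \<in> carrier_mat \<mu> \<nu> \<and> (\<forall>p\<in>I. point_eval \<phi> \<Gamma> p = 0)"
  by (simp add: rational_points_def point_eval_def)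

context border_setting
begin

abbreviation C_vars where "C_vars \<equiv> {..<\<mu>} \<times> {..<\<nu>}"

lemma mult_mat_carrier: "(mult_mat ts bs r :: (nat \<times> nat, 'k::field) mpoly mat) \<in> carrier_mat \<mu> \<mu>"
  by (simp add: mult_mat_def)

lemma c_var_polys: "i < \<mu> \<Longrightarrow> j < \<nu> \<Longrightarrow> c_var i j \<in> polys C_vars"
  by (simp add: c_var_def terms_def)

lemma mult_mat_entry:
  assumes "i < \<mu>" "j < \<mu>" "r < n"
  shows "mult_mat ts bs r $$ (i, j) \<in> {0, 1 :: (nat \<times> nat, 'k::field) mpoly} \<union> c_var i ` {..<\<nu>}"
proof (cases "x_term r + ts ! j \<in> set ts")
  case True
  then show ?thesis using assms by (simp add: mult_mat_def Let_def)
next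
  case False
  then obtain m where "m < \<nu>" "(THE m. m < \<nu> \<and> bs ! m = x_term r + ts ! j) = m"
    using border_index[of r "ts ! j"] assms nth_mem[of j ts] by auto
  then show ?thesis using assms False by (simp add: mult_mat_def Let_def)
qed

lemma poly_mat_mult_mat: "r < n \<Longrightarrow> poly_mat C_vars \<mu> (mult_mat ts bs r :: (nat \<times> nat, 'k::field) mpoly mat)"
  unfolding poly_mat_def
proof (intro conjI allI impI mult_mat_carrier)
  fix i j assume "r < n" "i < \<mu>" "j < \<mu>"
  then show "mult_mat ts bs r $$ (i, j) \<in> (polys C_vars :: (nat \<times> nat, 'k) mpoly set)"
    using mult_mat_entry[of i j r, where 'k = 'k] c_var_polys by fastforce
qed

lemma poly_mat_df_mult_mat: "r < n \<Longrightarrow> poly_mat C_vars \<mu> (df_mult_mat ts bs r :: (nat \<times> nat, 'k::field) mpoly mat)"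
  unfolding poly_mat_def
proof (intro conjI allI impI)
  show "df_mult_mat ts bs r \<in> carrier_mat \<mu> \<mu>"
    by (simp add: df_mult_mat_def mult_mat_carrier)
  fix i j assume ij: "r < n" "i < \<mu>" "j < \<mu>"
  let ?h = "poly_eval const_poly (\<lambda>(i, j). if term_deg (bs ! j) < term_deg (ts ! i) then 0 else c_var i j) ::
    (nat \<times> nat, 'k) mpoly \<Rightarrow> (nat \<times> nat, 'k) mpoly"
  have c: "comm_ring_hom (const_poly :: 'k \<Rightarrow> (nat \<times> nat, 'k) mpoly)" ..
  interpret h: comm_ring_hom ?h by (rule comm_ring_hom_poly_eval[OF c])
  have "df_mult_mat ts bs r $$ (i, j) = ?h (mult_mat ts bs r $$ (i, j))"
    using mult_mat_carrier[of r, where 'k = 'k] ij by (simp add: df_mult_mat_def)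
  then show "df_mult_mat ts bs r $$ (i, j) \<in> (polys C_vars :: (nat \<times> nat, 'k) mpoly set)"
    using mult_mat_entry[OF ij(2,3,1), where 'k = 'k] c_var_polys[OF ij(2)]
    by (auto simp: poly_eval_c_var[OF c])
qed

definition df_term_mat :: "nat trm \<Rightarrow> (nat \<times> nat, 'k::field) mpoly mat" where
  "df_term_mat t = term_at_mats n \<mu> (df_mult_mat ts bs) t"

lemma poly_mat_df_term_mat: "poly_mat C_vars \<mu> (df_term_mat t :: (nat \<times> nat, 'k::field) mpoly mat)"
  unfolding df_term_mat_def by (rule poly_mat_term) (rule poly_mat_df_mult_mat)

text \<open>Row \<open>a\<close> of \<open>W\<close> is row \<open>l = a mod \<mu>\<close> of the block \<open>V\<^sub>j\<close> with \<open>j = a div \<mu>\<close>; the transposition in the definition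
  of \<open>V\<^sub>j\<close> makes \<open>l\<close> the column index of \<open>M\<^bsub>t\<^sub>i\<^esub>\<close>.\<close>

lemma W_mat:
  shows W_mat_carrier: "(W_mat n ts bs :: (nat \<times> nat, 'k::field) mpoly mat) \<in> carrier_mat (\<Delta> * \<mu>) \<mu>"
    and W_mat_entry: "a < \<Delta> * \<mu> \<Longrightarrow> i < \<mu> \<Longrightarrow>
      (W_mat n ts bs :: (nat \<times> nat, 'k::field) mpoly mat) $$ (a, i) =
        df_term_mat (ts ! i) $$ (\<mu> - \<Delta> + a div \<mu>, a mod \<mu>)"
proof -
  let ?V = "V_mat n ts bs :: nat \<Rightarrow> (nat \<times> nat, 'k) mpoly mat"
  have V: "?V j \<in> carrier_mat \<mu> \<mu>" for j
    unfolding V_mat_def using mat_of_cols_carrier(1)[of \<mu>] by (metis length_map)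
  have len: "length (rows (?V j)) = \<mu>" for j using V[of j] by simp
  note conc = nth_concat_uniform[of \<Delta> "\<lambda>j. rows (?V j)" \<mu>, OF len]
  show carr: "(W_mat n ts bs :: (nat \<times> nat, 'k) mpoly mat) \<in> carrier_mat (\<Delta> * \<mu>) \<mu>"
    unfolding W_mat_def carrier_mat_def using conc by simp
  assume a: "a < \<Delta> * \<mu>" and i: "i < \<mu>"
  have am: "a div \<mu> < \<Delta>" "a mod \<mu> < \<mu>" using a ts(1) by (simp_all add: less_mult_imp_div_less)
  have M: "(df_term_mat (ts ! i) :: (nat \<times> nat, 'k) mpoly mat) \<in> carrier_mat \<mu> \<mu>" using poly_mat_df_term_mat[of "ts ! i", where 'k = 'k] by (simp add: poly_mat_def)
  have "W_mat n ts bs $$ (a, i) = rows (?V (a div \<mu>)) ! (a mod \<mu>) $ i"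
    unfolding W_mat_def mat_of_rows_def using conc a i by simp
  also have "\<dots> = ?V (a div \<mu>) $$ (a mod \<mu>, i)" using V[of "a div \<mu>"] am i by simp
  also have "\<dots> = df_term_mat (ts ! i) $$ (\<mu> - \<Delta> + a div \<mu>, a mod \<mu>)"
    using am i M \<Delta>_le unfolding V_mat_def df_term_mat_def[symmetric] mat_of_cols_def by auto
  finally show "(W_mat n ts bs :: (nat \<times> nat, 'k) mpoly mat) $$ (a, i) =
    df_term_mat (ts ! i) $$ (\<mu> - \<Delta> + a div \<mu>, a mod \<mu>)" .
qed

definition commutator_entries :: "(nat \<times> nat, 'k::field) mpoly set" where
  "commutator_entries = {(mult_mat ts bs r * mult_mat ts bs s - mult_mat ts bs s * mult_mat ts bs r) $$ (i, j)
       | r s i j. r < n \<and> s < n \<and> i < \<mu> \<and> j < \<mu>}"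

definition df_vars :: "(nat \<times> nat, 'k::field) mpoly set" where
  "df_vars = {c_var i j | i j. i < \<mu> \<and> j < \<nu> \<and> term_deg (ts ! i) > term_deg (bs ! j)}"

definition minors :: "(nat \<times> nat, 'k::field) mpoly set" where
  "minors = {det (submatrix (W_mat n ts bs) I {..<\<mu>}) | I. I \<subseteq> {..<\<Delta> * \<mu>} \<and> card I = \<mu>}"

lemma commutator_entries_polys: "(commutator_entries :: (nat \<times> nat, 'k::field) mpoly set) \<subseteq> polys C_vars"
proof
  fix p :: "(nat \<times> nat, 'k) mpoly" assume "p \<in> commutator_entries"
  then obtain r s i j where p: "p = (mult_mat ts bs r * mult_mat ts bs s - mult_mat ts bs s * mult_mat ts bs r) $$ (i, j)"
    "r < n" "s < n" "i < \<mu>" "j < \<mu>" by (auto simp: commutator_entries_def)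
  let ?A = "mult_mat ts bs :: nat \<Rightarrow> (nat \<times> nat, 'k) mpoly mat"
  have "poly_mat C_vars \<mu> (?A r * ?A s)" "poly_mat C_vars \<mu> (?A s * ?A r)"
    using p by (auto intro!: poly_mat_mult poly_mat_mult_mat)
  then have "(?A r * ?A s) $$ (i, j) - (?A s * ?A r) $$ (i, j) \<in> polys C_vars"
    using p(4,5) by (intro polys_diff) (auto simp: poly_mat_def simp del: index_mult_mat)
  then show "p \<in> polys C_vars"
    using p mult_mat_carrier[of r, where 'k = 'k] mult_mat_carrier[of s, where 'k = 'k] by (simp del: index_mult_mat(1))
qed

lemma df_vars_polys: "(df_vars :: (nat \<times> nat, 'k::field) mpoly set) \<subseteq> polys C_vars"
  by (auto simp: df_vars_def c_var_polys)

lemma minors_polys: "(minors :: (nat \<times> nat, 'k::field) mpoly set) \<subseteq> polys C_vars"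
proof
  fix p :: "(nat \<times> nat, 'k) mpoly" assume "p \<in> minors"
  then obtain I where I: "I \<subseteq> {..<\<Delta> * \<mu>}" "card I = \<mu>" "p = det (submatrix (W_mat n ts bs) I {..<\<mu>})"
    by (auto simp: minors_def)
  have "W_mat n ts bs $$ (pick I i, j) \<in> (polys C_vars :: (nat \<times> nat, 'k) mpoly set)" if ij: "i < \<mu>" "j < \<mu>" for i j
  proof -
    have a: "pick I i < \<Delta> * \<mu>" using pick_in_set[of i I] I ij by auto
    then have "\<mu> - \<Delta> + pick I i div \<mu> < \<mu>" "pick I i mod \<mu> < \<mu>"
      using \<Delta>_le less_mult_imp_div_less[OF a] ts(1) by auto
    then show ?thesis using W_mat_entry[OF a ij(2), where 'k = 'k] poly_mat_df_term_mat[of "ts ! j", where 'k = 'k] by (simp add: poly_mat_def)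
  qed
  then show "p \<in> polys C_vars"
    unfolding I(3) submatrix_rows[OF W_mat_carrier I(1,2)] by (intro det_polys) auto
qed

lemma ideals:
  shows "is_ideal C_vars (df_scheme_ideal n ts bs :: (nat \<times> nat, 'k::field) mpoly set)"
    and "is_ideal C_vars (noncb_ideal n ts bs :: (nat \<times> nat, 'k) mpoly set)"
    and "(df_scheme_ideal n ts bs :: (nat \<times> nat, 'k) mpoly set) \<subseteq> noncb_ideal n ts bs"
proof -
  show i: "is_ideal C_vars (df_scheme_ideal n ts bs :: (nat \<times> nat, 'k) mpoly set)"
    unfolding df_scheme_ideal_def border_scheme_ideal_def df_ideal_def
      commutator_entries_def[symmetric] df_vars_def[symmetric]
    by (intro set_add_is_ideal genideal_is_ideal commutator_entries_polys df_vars_polys)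
  have j: "is_ideal C_vars (minors_ideal n ts bs :: (nat \<times> nat, 'k) mpoly set)"
    unfolding minors_ideal_def minors_def[symmetric] by (intro genideal_is_ideal minors_polys)
  show "is_ideal C_vars (noncb_ideal n ts bs :: (nat \<times> nat, 'k) mpoly set)"
    unfolding noncb_ideal_def by (rule set_add_is_ideal[OF i j])
  show "(df_scheme_ideal n ts bs :: (nat \<times> nat, 'k) mpoly set) \<subseteq> noncb_ideal n ts bs"
    unfolding noncb_ideal_def set_add_def' using is_ideal_zero[OF j] by force
qed

context
  fixes \<phi> :: "'k::field \<Rightarrow> 'l::field"
  assumes hom: "comm_ring_hom \<phi>"
begin

text \<open>The polynomials that vanish at a point form an ideal, so generators suffice.\<close>

lemma rational_points_genideal:
  assumes "S \<subseteq> polys C_vars"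
  shows "\<Gamma> \<in> rational_points \<phi> \<mu> \<nu> (genideal (poly_ring C_vars) S) \<longleftrightarrow>
    \<Gamma> \<in> carrier_mat \<mu> \<nu> \<and> (\<forall>p\<in>S. point_eval \<phi> \<Gamma> p = 0)"
proof -
  let ?ev = "point_eval \<phi> \<Gamma>"
  interpret ev: comm_ring_hom ?ev by (rule point_eval_hom[OF hom])
  let ?K = "{p \<in> polys C_vars. ?ev p = 0}"
  have "is_ideal C_vars ?K" by (rule is_idealI) (auto simp: ev.hom_add ev.hom_mult)
  then have "genideal (poly_ring C_vars) S \<subseteq> ?K" if "\<forall>p\<in>S. ?ev p = 0"
    using that assms by (intro ring.genideal_minimal[OF ring_poly_ring]) (auto simp: ideal_iff)
  moreover have "S \<subseteq> genideal (poly_ring C_vars) S"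
    using ring.genideal_self[OF ring_poly_ring] assms by (metis poly_ring_simps(1))
  ultimately show ?thesis unfolding rational_points_iff by blast
qed

lemma rational_points_set_add:
  assumes "is_ideal C_vars I" "is_ideal C_vars J"
  shows "\<Gamma> \<in> rational_points \<phi> \<mu> \<nu> (I <+>\<^bsub>poly_ring C_vars\<^esub> J) \<longleftrightarrow>
    \<Gamma> \<in> rational_points \<phi> \<mu> \<nu> I \<and> \<Gamma> \<in> rational_points \<phi> \<mu> \<nu> J"
proof -
  interpret ev: comm_ring_hom "point_eval \<phi> \<Gamma>" by (rule point_eval_hom[OF hom])
  have "I \<subseteq> I <+>\<^bsub>poly_ring C_vars\<^esub> J" "J \<subseteq> I <+>\<^bsub>poly_ring C_vars\<^esub> J"
    using is_ideal_zero[OF assms(1)] is_ideal_zero[OF assms(2)] by (force simp: set_add_def')+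
  moreover have "point_eval \<phi> \<Gamma> p = 0"
    if "p \<in> I <+>\<^bsub>poly_ring C_vars\<^esub> J" "\<forall>p\<in>I. point_eval \<phi> \<Gamma> p = 0" "\<forall>p\<in>J. point_eval \<phi> \<Gamma> p = 0" for p
    using that by (auto simp: set_add_def' ev.hom_add)
  ultimately show ?thesis unfolding rational_points_iff by blast
qed

context
  fixes \<Gamma> :: "'l mat" assumes \<Gamma>: "\<Gamma> \<in> carrier_mat \<mu> \<nu>"
begin

abbreviation ev :: "(nat \<times> nat, 'k) mpoly \<Rightarrow> 'l" where
  "ev \<equiv> point_eval \<phi> \<Gamma>"

interpretation ev: comm_ring_hom ev by (rule point_eval_hom[OF hom])

lemma ev_mult_mat: "r < n \<Longrightarrow> map_mat ev (mult_mat ts bs r) = generic_mat ts bs \<Gamma> r"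
  by (rule eq_matI) (auto simp: mult_mat_def generic_mat_def Let_def point_eval_c_var[OF hom])

lemma ev_df_mult_mat:
  assumes "r < n" and df: "df_matrix ts bs \<Gamma>"
  shows "map_mat ev (df_mult_mat ts bs r) = generic_mat ts bs \<Gamma> r"
proof (rule eq_matI)
  fix i j assume "i < dim_row (generic_mat ts bs \<Gamma> r)" "j < dim_col (generic_mat ts bs \<Gamma> r)"
  then have ij: "i < \<mu>" "j < \<mu>" by (auto simp: generic_mat_def)
  let ?h = "poly_eval const_poly (\<lambda>(i, j). if term_deg (bs ! j) < term_deg (ts ! i) then 0 else c_var i j) ::
    (nat \<times> nat, 'k) mpoly \<Rightarrow> (nat \<times> nat, 'k) mpoly"
  have c: "comm_ring_hom (const_poly :: 'k \<Rightarrow> (nat \<times> nat, 'k) mpoly)" ..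
  interpret h: comm_ring_hom ?h by (rule comm_ring_hom_poly_eval[OF c])
  have "map_mat ev (df_mult_mat ts bs r) $$ (i, j) = ev (?h (mult_mat ts bs r $$ (i, j)))"
    using mult_mat_carrier[of r, where 'k = 'k] ij by (simp add: df_mult_mat_def)
  also have "\<dots> = ev (mult_mat ts bs r $$ (i, j))"
    using mult_mat_entry[OF ij assms(1), where 'k = 'k] df ij
    by (auto simp: poly_eval_c_var[OF c] point_eval_c_var[OF hom] df_matrix_def)
  also have "\<dots> = generic_mat ts bs \<Gamma> r $$ (i, j)"
    using ev_mult_mat[OF assms(1)] mult_mat_carrier[of r, where 'k = 'k] ij by (metis carrier_matD index_map_mat(1))
  finally show "map_mat ev (df_mult_mat ts bs r) $$ (i, j) = generic_mat ts bs \<Gamma> r $$ (i, j)" .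
qed (simp_all add: df_mult_mat_def mult_mat_def generic_mat_def)

lemma commutators_vanish_iff: "(\<forall>p\<in>commutator_entries. ev p = 0) \<longleftrightarrow> commuting_point n ts bs \<Gamma>"
proof -
  let ?A = "mult_mat ts bs :: nat \<Rightarrow> (nat \<times> nat, 'k) mpoly mat" and ?G = "generic_mat ts bs \<Gamma>"
  have A: "?A r \<in> carrier_mat \<mu> \<mu>" for r by (rule mult_mat_carrier)
  have G: "?G r \<in> carrier_mat \<mu> \<mu>" for r by (rule generic_mat_carrier)
  have AA: "?A r * ?A s \<in> carrier_mat \<mu> \<mu>" for r s by (rule mult_carrier_mat[OF A A])
  have GG: "?G r * ?G s \<in> carrier_mat \<mu> \<mu>" for r s by (rule mult_carrier_mat[OF G G])
  have e: "ev ((?A r * ?A s - ?A s * ?A r) $$ (i, j)) = (?G r * ?G s) $$ (i, j) - (?G s * ?G r) $$ (i, j)"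
    if "r < n" "s < n" "i < \<mu>" "j < \<mu>" for r s i j
  proof -
    have p: "ev ((?A r * ?A s) $$ (i, j)) = (?G r * ?G s) $$ (i, j)" if "r < n" "s < n" for r s
    proof -
      have "ev ((?A r * ?A s) $$ (i, j)) = map_mat ev (?A r * ?A s) $$ (i, j)"
        using AA[of r s] \<open>i < \<mu>\<close> \<open>j < \<mu>\<close> by (metis carrier_matD index_map_mat(1))
      also have "\<dots> = (?G r * ?G s) $$ (i, j)"
        using that by (simp add: ev.mat_hom_mult[OF A A] ev_mult_mat del: index_mult_mat)
      finally show ?thesis .
    qed
    have "(?A r * ?A s - ?A s * ?A r) $$ (i, j) = (?A r * ?A s) $$ (i, j) - (?A s * ?A r) $$ (i, j)"
      using AA[of s r] that by (intro index_minus_mat) auto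
    then show ?thesis using p that by (simp add: ev.hom_minus del: index_mult_mat)
  qed
  have "(\<forall>p\<in>commutator_entries. ev p = 0) \<longleftrightarrow>
      (\<forall>r<n. \<forall>s<n. \<forall>i<\<mu>. \<forall>j<\<mu>. ev ((?A r * ?A s - ?A s * ?A r) $$ (i, j)) = 0)"
    unfolding commutator_entries_def by blast
  also have "\<dots> \<longleftrightarrow>
      (\<forall>r<n. \<forall>s<n. \<forall>i<\<mu>. \<forall>j<\<mu>. (?G r * ?G s) $$ (i, j) = (?G s * ?G r) $$ (i, j))"
    by (simp add: e del: index_mult_mat index_minus_mat)
  also have "\<dots> \<longleftrightarrow> (\<forall>r<n. \<forall>s<n. ?G r * ?G s = ?G s * ?G r)"
  proof -
    have "?G r * ?G s = ?G s * ?G r \<longleftrightarrow> (\<forall>i<\<mu>. \<forall>j<\<mu>. (?G r * ?G s) $$ (i, j) = (?G s * ?G r) $$ (i, j))" for r s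
      using mat_eq_iff[of "?G r * ?G s" "?G s * ?G r"] carrier_matD[OF GG[of r s]] carrier_matD[OF GG[of s r]] by metis
    then show ?thesis by simp
  qed
  finally show ?thesis by (simp add: commuting_point_def)
qed

lemma df_vars_vanish_iff: "(\<forall>p\<in>df_vars. ev p = 0) \<longleftrightarrow> df_matrix ts bs \<Gamma>"
  using \<Gamma> by (force simp: df_vars_def df_matrix_def point_eval_c_var[OF hom])

lemma minors_vanish_iff:
  assumes df: "df_matrix ts bs \<Gamma>" and comm: "commuting_point n ts bs \<Gamma>"
  shows "(\<forall>p\<in>minors. ev p = 0) \<longleftrightarrow> \<not> cayley_bacharach n (point_ideal n ts bs \<Gamma>)"
proof -
  let ?W = "map_mat ev (W_mat n ts bs)"
  have W: "?W \<in> carrier_mat (\<Delta> * \<mu>) \<mu>" using W_mat_carrier by simp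
  have "map_mat ev (df_term_mat t) = term_mat \<Gamma> t" for t
  proof -
    have "map_mat ev (df_term_mat t) = term_at_mats n \<mu> (\<lambda>r. map_mat ev (df_mult_mat ts bs r)) t"
      unfolding df_term_mat_def
      by (rule term_at_mats_hom[OF _ ev.comm_ring_hom_axioms]) (use poly_mat_df_mult_mat in \<open>auto simp: poly_mat_def\<close>)
    also have "\<dots> = term_mat \<Gamma> t"
      unfolding term_mat_def term_at_mats_def
      by (rule foldr_cong) (auto simp: ev_df_mult_mat[OF _ df])
    finally show ?thesis .
  qed
  then have tm: "ev (df_term_mat t $$ (k, l)) = term_mat \<Gamma> t $$ (k, l)" if "k < \<mu>" "l < \<mu>" for t k l
    using poly_mat_df_term_mat[of t, where 'k = 'k] that unfolding poly_mat_def
    by (metis carrier_matD index_map_mat(1))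
  have Wc: "(W_mat n ts bs :: (nat \<times> nat, 'k) mpoly mat) \<in> carrier_mat (\<Delta> * \<mu>) \<mu>" by (rule W_mat_carrier)
  have W_entry: "?W $$ (a, i) = term_mat \<Gamma> (ts ! i) $$ (\<mu> - \<Delta> + a div \<mu>, a mod \<mu>)"
    if "a < \<Delta> * \<mu>" "i < \<mu>" for a i
  proof -
    have "\<mu> - \<Delta> + a div \<mu> < \<mu>" "a mod \<mu> < \<mu>"
      using \<Delta>_le less_mult_imp_div_less[OF that(1)] ts(1) by auto
    then show ?thesis
      using tm[of "\<mu> - \<Delta> + a div \<mu>" "a mod \<mu>" "ts ! i"] W_mat_entry[OF that, where 'k = 'k]
        carrier_matD[OF Wc] that by simp
  qed
  have sub: "ev (det (submatrix (W_mat n ts bs) I {..<\<mu>})) = det (submatrix ?W I {..<\<mu>})"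
    if I: "I \<subseteq> {..<\<Delta> * \<mu>}" "card I = \<mu>" for I
  proof -
    have "map_mat ev (submatrix (W_mat n ts bs) I {..<\<mu>}) = submatrix ?W I {..<\<mu>}"
      unfolding submatrix_rows[OF Wc I] submatrix_rows[OF W I]
    proof (rule eq_matI)
      fix i j assume "i < dim_row (mat \<mu> \<mu> (\<lambda>(a, k). ?W $$ (pick I a, k)))"
        "j < dim_col (mat \<mu> \<mu> (\<lambda>(a, k). ?W $$ (pick I a, k)))"
      then have ij: "i < \<mu>" "j < \<mu>" by auto
      moreover have "pick I i < \<Delta> * \<mu>" using pick_in_set[of i I] I ij by auto
      ultimately show "map_mat ev (mat \<mu> \<mu> (\<lambda>(a, k). W_mat n ts bs $$ (pick I a, k))) $$ (i, j) =
          mat \<mu> \<mu> (\<lambda>(a, k). ?W $$ (pick I a, k)) $$ (i, j)"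
        using Wc by simp
    qed auto
    then show ?thesis by (metis ev.hom_det)
  qed
  have "(\<forall>p\<in>minors. ev p = 0) \<longleftrightarrow>
      (\<forall>I. I \<subseteq> {..<\<Delta> * \<mu>} \<and> card I = \<mu> \<longrightarrow> det (submatrix ?W I {..<\<mu>}) = 0)"
    unfolding minors_def using sub by (auto; metis)
  also have "\<dots> \<longleftrightarrow> (\<exists>v. (\<exists>i<\<mu>. v i \<noteq> 0) \<and> (\<forall>a<\<Delta> * \<mu>. (\<Sum>i<\<mu>. ?W $$ (a, i) * v i) = 0))"
    by (rule maximal_minors_vanish_iff[OF W])
  also have "\<dots> \<longleftrightarrow> (\<exists>v. (\<exists>i<\<mu>. v i \<noteq> 0) \<and>
      (\<forall>k\<in>{\<mu> - \<Delta>..<\<mu>}. \<forall>l<\<mu>. (\<Sum>i<\<mu>. term_mat \<Gamma> (ts ! i) $$ (k, l) * v i) = 0))"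
  proof -
    have "(\<forall>a<\<Delta> * \<mu>. (\<Sum>i<\<mu>. ?W $$ (a, i) * v i) = 0) \<longleftrightarrow>
        (\<forall>k\<in>{\<mu> - \<Delta>..<\<mu>}. \<forall>l<\<mu>. (\<Sum>i<\<mu>. term_mat \<Gamma> (ts ! i) $$ (k, l) * v i) = 0)" (is "?L \<longleftrightarrow> ?R") for v
    proof
      assume L: ?L
      show ?R
      proof (intro ballI allI impI)
        fix k l assume k: "k \<in> {\<mu> - \<Delta>..<\<mu>}" and l: "l < \<mu>"
        let ?a = "(k - (\<mu> - \<Delta>)) * \<mu> + l"
        have "k - (\<mu> - \<Delta>) < \<Delta>" using k \<Delta>_le by auto
        then have "Suc (k - (\<mu> - \<Delta>)) * \<mu> \<le> \<Delta> * \<mu>" by (intro mult_le_mono1) simp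
        then have a: "?a < \<Delta> * \<mu>" using l by simp
        have "?a div \<mu> = k - (\<mu> - \<Delta>)" "?a mod \<mu> = l" using l ts(1) by simp_all
        then have "term_mat \<Gamma> (ts ! i) $$ (k, l) = ?W $$ (?a, i)" if "i < \<mu>" for i
          using W_entry[OF a that] k by simp
        then have "(\<Sum>i<\<mu>. term_mat \<Gamma> (ts ! i) $$ (k, l) * v i) = (\<Sum>i<\<mu>. ?W $$ (?a, i) * v i)"
          by (intro sum.cong refl arg_cong2[of _ _ _ _ "(*)"]) blast
        also have "\<dots> = 0" using L a by blast
        finally show "(\<Sum>i<\<mu>. term_mat \<Gamma> (ts ! i) $$ (k, l) * v i) = 0" .
      qed
    next
      assume R: ?R
      show ?L
      proof (intro allI impI)
        fix a assume a: "a < \<Delta> * \<mu>"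
        have "\<mu> - \<Delta> + a div \<mu> \<in> {\<mu> - \<Delta>..<\<mu>}" "a mod \<mu> < \<mu>"
          using \<Delta>_le less_mult_imp_div_less[OF a] ts(1) by auto
        then have "(\<Sum>i<\<mu>. term_mat \<Gamma> (ts ! i) $$ (\<mu> - \<Delta> + a div \<mu>, a mod \<mu>) * v i) = 0"
          using R by blast
        moreover have "(\<Sum>i<\<mu>. ?W $$ (a, i) * v i) =
            (\<Sum>i<\<mu>. term_mat \<Gamma> (ts ! i) $$ (\<mu> - \<Delta> + a div \<mu>, a mod \<mu>) * v i)"
          by (intro sum.cong refl arg_cong2[of _ _ _ _ "(*)"] W_entry[OF a]) simp
        ultimately show "(\<Sum>i<\<mu>. ?W $$ (a, i) * v i) = 0" by simp
      qed
    qed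
    then show ?thesis by simp
  qed
  also have "\<dots> \<longleftrightarrow> \<not> cayley_bacharach n (point_ideal n ts bs \<Gamma>)"
    by (rule not_cayley_bacharach_point_iff[OF comm df, symmetric])
  finally show ?thesis .
qed

end

text \<open>The three summands of the ideal contribute the three conditions; the last one has its meaning
  only in the presence of the other two, which provide the degree filtered border basis.\<close>

lemma noncb_points_iff:
  "\<Gamma> \<in> rational_points \<phi> \<mu> \<nu> (noncb_ideal n ts bs) \<longleftrightarrow>
    df_matrix ts bs \<Gamma> \<and> commuting_point n ts bs \<Gamma> \<and> \<not> cayley_bacharach n (point_ideal n ts bs \<Gamma>)"
proof -
  have id: "is_ideal C_vars (genideal (poly_ring C_vars) (commutator_entries :: (nat \<times> nat, 'k) mpoly set))"
    "is_ideal C_vars (genideal (poly_ring C_vars) (df_vars :: (nat \<times> nat, 'k) mpoly set))"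
    "is_ideal C_vars (genideal (poly_ring C_vars) (minors :: (nat \<times> nat, 'k) mpoly set))"
    by (intro genideal_is_ideal commutator_entries_polys df_vars_polys minors_polys)+
  have "\<Gamma> \<in> rational_points \<phi> \<mu> \<nu> (noncb_ideal n ts bs) \<longleftrightarrow> \<Gamma> \<in> carrier_mat \<mu> \<nu> \<and>
      (\<forall>p\<in>commutator_entries. ev \<Gamma> p = 0) \<and> (\<forall>p\<in>df_vars. ev \<Gamma> p = 0) \<and> (\<forall>p\<in>minors. ev \<Gamma> p = 0)"
    unfolding noncb_ideal_def df_scheme_ideal_def border_scheme_ideal_def df_ideal_def minors_ideal_def
      commutator_entries_def[symmetric] df_vars_def[symmetric] minors_def[symmetric]
      rational_points_set_add[OF set_add_is_ideal[OF id(1,2)] id(3)] rational_points_set_add[OF id(1,2)]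
      Int_iff rational_points_genideal[OF commutator_entries_polys] rational_points_genideal[OF df_vars_polys]
      rational_points_genideal[OF minors_polys] by blast
  also have "\<dots> \<longleftrightarrow> df_matrix ts bs \<Gamma> \<and> commuting_point n ts bs \<Gamma> \<and> \<not> cayley_bacharach n (point_ideal n ts bs \<Gamma>)"
    using commutators_vanish_iff[of \<Gamma>] df_vars_vanish_iff[of \<Gamma>] minors_vanish_iff[of \<Gamma>]
    by (auto simp: df_matrix_def)
  finally show ?thesis .
qed

lemma noncb_points_bij:
  "bij_betw (point_ideal n ts bs)
    (rational_points \<phi> \<mu> \<nu> (noncb_ideal n ts bs))
    {I. zero_dim_ideal n I \<and> has_df_border_basis n ts I \<and> \<not> cayley_bacharach n I}"
proof (rule bij_betwI')
  fix \<Gamma> \<Gamma>' assume "\<Gamma> \<in> rational_points \<phi> \<mu> \<nu> (noncb_ideal n ts bs)" "\<Gamma>' \<in> rational_points \<phi> \<mu> \<nu> (noncb_ideal n ts bs)"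
  then show "point_ideal n ts bs \<Gamma> = point_ideal n ts bs \<Gamma>' \<longleftrightarrow> \<Gamma> = \<Gamma>'"
    unfolding noncb_points_iff using point_ideal_inj by blast
next
  fix \<Gamma> assume "\<Gamma> \<in> rational_points \<phi> \<mu> \<nu> (noncb_ideal n ts bs)"
  then have \<Gamma>: "df_matrix ts bs \<Gamma>" "commuting_point n ts bs \<Gamma>" "\<not> cayley_bacharach n (point_ideal n ts bs \<Gamma>)"
    unfolding noncb_points_iff by auto
  interpret df_quotient n "set ts" "point_ideal n ts bs \<Gamma>" d by (rule df_quotient_point[OF \<Gamma>(2,1)])
  show "point_ideal n ts bs \<Gamma> \<in> {I. zero_dim_ideal n I \<and> has_df_border_basis n ts I \<and> \<not> cayley_bacharach n I}"
    using zero_dim \<Gamma>(3) has_df_border_basis_iff[OF point_ideal_ideal ts(2,3)] point_ideal_df_basis[OF \<Gamma>(2,1)] by blast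
next
  fix I :: "(nat, 'l) mpoly set"
  assume "I \<in> {I. zero_dim_ideal n I \<and> has_df_border_basis n ts I \<and> \<not> cayley_bacharach n I}"
  then have I: "is_ideal {..<n} I" "has_df_border_basis n ts I" "\<not> cayley_bacharach n I"
    by (auto simp: zero_dim_ideal_def ideal_iff)
  then have "df_basis n (set ts) I" using has_df_border_basis_iff[OF I(1) ts(2,3)] by blast
  then show "\<exists>\<Gamma>\<in>rational_points \<phi> \<mu> \<nu> (noncb_ideal n ts bs). I = point_ideal n ts bs \<Gamma>"
    using ex_matrix_of_ideal[OF I(1)] I(3) unfolding Bex_def noncb_points_iff by metis
qed

end

end

theorem mainTheorem2:
  fixes n :: nat
    and ts bs :: "(nat \<Rightarrow>\<^sub>0 nat) list"
    and \<phi> :: "'k::field \<Rightarrow> 'l::field"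
  assumes "order_ideal n ts"
    and "enumerates_border n ts bs"
    and "field_hom \<phi>"
  shows "ideal (noncb_ideal n ts bs) (C_ring ts bs :: ((nat \<times> nat, 'k) mpoly) ring) \<and>
    (df_scheme_ideal n ts bs :: (nat \<times> nat, 'k) mpoly set) \<subseteq> noncb_ideal n ts bs \<and>
    bij_betw (point_ideal n ts bs)
      (rational_points (\<lambda>c. c) (length ts) (length bs)
        (noncb_ideal n ts bs :: (nat \<times> nat, 'k) mpoly set))
      {I :: (nat, 'k) mpoly set.
        zero_dim_ideal n I \<and> has_df_border_basis n ts I \<and> \<not> cayley_bacharach n I} \<and>
    bij_betw (point_ideal n ts bs)
      (rational_points \<phi> (length ts) (length bs)
        (noncb_ideal n ts bs :: (nat \<times> nat, 'k) mpoly set))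
      {I :: (nat, 'l) mpoly set.
        zero_dim_ideal n I \<and> has_df_border_basis n ts I \<and> \<not> cayley_bacharach n I}"
proof -
  interpret border_setting n ts bs by unfold_locales (fact assms)+
  interpret \<phi>: field_hom \<phi> by (fact assms)
  have id: "comm_ring_hom (\<lambda>c::'k. c)" by unfold_locales auto
  show ?thesis
    using ideals noncb_points_bij[OF id] noncb_points_bij[OF \<phi>.comm_ring_hom_axioms]
    by (auto simp: ideal_iff)
qed

end
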